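(* Let $p\in P^{Log}(\mathbb{R})$, $r\in\mathbb{N}$, $\delta\in(0,1)$ and $f\in L_{p(\cdot)}$. Then $$\Omega_r(f,\delta)_{p(\cdot)}\le c_{12}\,\delta^r\left(A_0(f)_{p(\cdot)}+\int_{1/2}^{1/\delta}u^{r-1}A_{u/2}(f)_{p(\cdot)}\,du\right),$$ where $c_{12}=12\,c_{13}\,c_7\,(1+2^{2r-1})\,2^r$ and $c_{13}=2c_5\,(1+72\,c_7c_5)$.
   Context: For a measurable function $p:\mathbb{R}\to[1,\infty)$ let $p^-=\operatorname{ess\,inf}_{\mathbb{R}}p$ and $p^+=\operatorname{ess\,sup}_{\mathbb{R}}p$. The class $P^{Log}(\mathbb{R})$ consists of all measurable $p:\mathbb{R}\to[1,\infty)$ with $1\le p^-$, $p^+<\infty$ for which there are positive constants $c_1(p),c_2(p)$ and a number $p_\infty>1$ such that, for all $x,y\in\mathbb{R}$, $|\frac1{p(x)}-\frac1{p(y)}|\log(e+1/|x-y|)\le c_1(p)$ (for $x\neq y$) and $|\frac1{p(x)}-\frac1{p_\infty}|\log(e+|x|)\le c_2(p)$. Put $c_3(p)=\max\{c_1(p),c_2(p)\}$. $L_{p(\cdot)}$ is the set of measurable $f:\mathbb{R}\to\mathbb{R}$ with $\int_{\mathbb{R}}|f(y)/\lambda|^{p(y)}dy<\infty$ for some $\lambda>0$, with norm $\|f\|_{p(\cdot)}=\inf\{\eta>0:\int_{\mathbb{R}}|f(y)/\eta|^{p(y)}dy<1\}$. An entire function $f$ is of exponential type $\sigma\ge0$ if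 $\limsup_{\rho\to\infty}\rho^{-1}\ln\max_{|z|=\rho}|f(z)|\le\sigma$. $\mathcal{G}_{\sigma,p(\cdot)}$ is the set of entire functions of exponential type $\sigma$ whose restriction to $\mathbb{R}$ belongs to $L_{p(\cdot)}$, and $A_\sigma(f)_{p(\cdot)}=\inf\{\|f-g\|_{p(\cdot)}:g\in\mathcal{G}_{\sigma,p(\cdot)}\}$. $T_\delta f(x)=\frac1\delta\int_0^\delta f(x+t)\,dt$, $I$ is the identity operator, and $\Omega_r(f,\delta)_{p(\cdot)}=\|(I-T_\delta)^rf\|_{p(\cdot)}$. Constants: $c_5=2^{p^++1}3^{p^+}\big(1+2\cdot3^{p^+}\big[\sum_{k=2}^\infty2^{-k}+2\big]\big)\exp(8c_3(p))$ and $c_7=2\exp(8c_3(p))$. *)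

theory Defs
  imports "HOL-Analysis.Analysis" "HOL-Probability.Essential_Supremum"
begin

definition p_minus :: "(real \<Rightarrow> real) \<Rightarrow> ereal" where
  "p_minus p = Sup {c. AE x in lebesgue. c \<le> ereal (p x)}"

definition p_plus :: "(real \<Rightarrow> real) \<Rightarrow> ereal" where
  "p_plus p = esssup lebesgue (\<lambda>x. ereal (p x))"

(* The constants c1(p), c2(p) and p_infinity are not unique; the relation below says that the
   given numbers are an admissible choice for p. *)
definition log_Hoelder :: "(real \<Rightarrow> real) \<Rightarrow> real \<Rightarrow> real \<Rightarrow> real \<Rightarrow> bool" where
  "log_Hoelder p c1 c2 p_inf \<longleftrightarrow>
     c1 > 0 \<and> c2 > 0 \<and> p_inf > 1 \<and>
     (\<forall>x y. x \<noteq> y \<longrightarrow> \<bar>1 / p x - 1 / p y\<bar> * ln (exp 1 + 1 / \<bar>x - y\<bar>) \<le> c1) \<and>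
     (\<forall>x. \<bar>1 / p x - 1 / p_inf\<bar> * ln (exp 1 + \<bar>x\<bar>) \<le> c2)"

definition P_Log :: "(real \<Rightarrow> real) set" where
  "P_Log = {p. p \<in> borel_measurable lebesgue \<and> (\<forall>x. 1 \<le> p x) \<and>
               1 \<le> p_minus p \<and> p_plus p < \<infinity> \<and>
               (\<exists>c1 c2 p_inf. log_Hoelder p c1 c2 p_inf)}"

definition modular :: "(real \<Rightarrow> real) \<Rightarrow> (real \<Rightarrow> real) \<Rightarrow> ennreal" where
  "modular p f = (\<integral>\<^sup>+ y. ennreal (\<bar>f y\<bar> powr p y) \<partial>lebesgue)"

definition L_var :: "(real \<Rightarrow> real) \<Rightarrow> (real \<Rightarrow> real) set" where
  "L_var p = {f. f \<in> borel_measurable lebesgue \<and>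
                 (\<exists>s>0. modular p (\<lambda>y. f y / s) < \<infinity>)}"

(* The infimum is taken in ennreal, so that the norm is infinite when no admissible eta exists. *)
definition norm_var :: "(real \<Rightarrow> real) \<Rightarrow> (real \<Rightarrow> real) \<Rightarrow> ennreal" where
  "norm_var p f = Inf {ennreal \<eta> | \<eta>. \<eta> > 0 \<and> modular p (\<lambda>y. f y / \<eta>) < 1}"

(* The supremum over the compact sphere is a maximum. If f is not identically zero, this maximum
   is positive for every rho > 0; for f = 0 the HOL convention ln 0 = 0 makes the limsup 0 in
   place of -infinity, and the zero function is of exponential type sigma either way. *)
definition exp_type :: "real \<Rightarrow> (complex \<Rightarrow> complex) \<Rightarrow> bool" where
  "exp_type \<sigma> f \<longleftrightarrow> f holomorphic_on UNIV \<and>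
     Limsup at_top (\<lambda>\<rho>::real. ereal (ln (SUP z\<in>sphere 0 \<rho>. norm (f z)) / \<rho>)) \<le> ereal \<sigma>"

(* L_var consists of real-valued functions, so the restriction to the real line is required to be
   real-valued. *)
definition G_class :: "real \<Rightarrow> (real \<Rightarrow> real) \<Rightarrow> (complex \<Rightarrow> complex) set" where
  "G_class \<sigma> p = {g. exp_type \<sigma> g \<and> (\<forall>x::real. g (of_real x) \<in> \<real>) \<and>
                     (\<lambda>x::real. Re (g (of_real x))) \<in> L_var p}"

definition best_approx :: "real \<Rightarrow> (real \<Rightarrow> real) \<Rightarrow> (real \<Rightarrow> real) \<Rightarrow> ennreal" where
  "best_approx \<sigma> p f = (INF g\<in>G_class \<sigma> p. norm_var p (\<lambda>x. f x - Re (g (of_real x))))"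

definition T_op :: "real \<Rightarrow> (real \<Rightarrow> real) \<Rightarrow> real \<Rightarrow> real" where
  "T_op \<delta> f x = 1 / \<delta> * (LINT t:{0..\<delta>}|lebesgue. f (x + t))"

definition Omega :: "nat \<Rightarrow> (real \<Rightarrow> real) \<Rightarrow> real \<Rightarrow> (real \<Rightarrow> real) \<Rightarrow> ennreal" where
  "Omega r p \<delta> f = norm_var p (((\<lambda>h x. h x - T_op \<delta> h x) ^^ r) f)"

(* In the constants below, c3 stands for max c1 c2. *)
definition const5 :: "(real \<Rightarrow> real) \<Rightarrow> real \<Rightarrow> real" where
  "const5 p c3 = (let q = real_of_ereal (p_plus p) in
     2 powr (q + 1) * 3 powr q *
     (1 + 2 * 3 powr q * ((\<Sum>\<^sub>\<infinity>k\<in>{2::nat..}. 1 / 2 ^ k) + 2)) * exp (8 * c3))"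

definition const7 :: "real \<Rightarrow> real" where
  "const7 c3 = 2 * exp (8 * c3)"

definition const13 :: "(real \<Rightarrow> real) \<Rightarrow> real \<Rightarrow> real" where
  "const13 p c3 = 2 * const5 p c3 * (1 + 72 * const7 c3 * const5 p c3)"

definition const12 :: "nat \<Rightarrow> (real \<Rightarrow> real) \<Rightarrow> real \<Rightarrow> real" where
  "const12 r p c3 = 12 * const13 p c3 * const7 c3 * (1 + 2 ^ (2 * r - 1)) * 2 ^ r"

end

theory Submission
  imports Defs "HOL-Complex_Analysis.Complex_Analysis" "HOL-Probability.Sinc_Integral"
begin

text \<open>Write \<open>U = I - T\<^sub>\<delta>\<close> and \<open>A \<sigma>\<close> for the error of best approximation of \<open>f\<close> by functions of type \<open>\<sigma>\<close>. The
theorem is an inverse theorem of Bernstein type, and the idea is the classical one. Take the types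
\<open>\<tau> j = 2 ^ j * s\<close> for \<open>j \<le> m\<close>, with \<open>1 / 2 < s \<le> 1\<close> and \<open>\<tau> m = 1 / (2 * \<delta>)\<close>, and approximants \<open>g j\<close>
of type \<open>\<tau> j\<close>, together with one approximant \<open>g\<^sub>*\<close> of type 0. Then \<open>f\<close> is the sum of \<open>f - g m\<close>, of the differences
\<open>g (j + 1) - g j\<close>, of \<open>g 0 - g\<^sub>*\<close>, and of \<open>g\<^sub>*\<close>. The operator \<open>U\<^sup>r\<close> is bounded on the first summand,
multiplies the norm of a function of type \<open>\<sigma>\<close> at most by a constant times \<open>(\<sigma> * \<delta>) ^ r\<close>, and
annihilates functions of type 0. This leaves \<open>\<delta> ^ r\<close> times the sum of \<open>A 0\<close> and of the \<open>\<tau> j ^ r * A (\<tau> j)\<close>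
(lemma \<open>norm_U_op_le_dyadic_sum\<close>). As \<open>A\<close> decreases, the integral over \<open>u \<in> {\<tau> j<..2 * \<tau> j}\<close> is at least
\<open>\<tau> j ^ r * A (\<tau> j)\<close> (lemma \<open>dyadic_blocks_le_integral\<close>).

Translations are in general unbounded on variable exponent spaces, so the two bounds for \<open>U\<^sup>r\<close> are reduced to
means over intervals around the point. These are bounded uniformly in the interval, with a constant
\<open>C_mean = 9 * exp (4 * c)\<close> that involves only the log-Hoelder constant (lemma \<open>norm_le_interval_mean\<close>): large
values are controlled by the local condition, small values by the condition at infinity. Poisson means
are dominated by dyadic sums of such means (lemma \<open>norm_le_poisson_mean\<close>).

The Bernstein inequality rests on complex analysis. A function \<open>h\<close> of type \<open>\<sigma>\<close> in the space is bounded on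
the real axis, and then \<open>\<bar>h (x + \<i> * y)\<bar>\<close> is at most \<open>exp (\<sigma> * \<bar>y\<bar>)\<close> times the Poisson mean of
\<open>\<bar>h\<bar>\<close> at \<open>x\<close> (lemma \<open>exp_type_poisson_bound\<close>), by the Phragmen-Lindeloef principle and the
Poisson inequality. Cauchy's formula on the lines at height \<open>\<plusminus> r / \<sigma>\<close> turns this into a bound
of the \<open>r\<close>-th derivative by \<open>(3 * \<sigma>) ^ r\<close> times a double Poisson mean (lemma
\<open>exp_type_higher_deriv_bound\<close>), and \<open>U\<^sup>r h\<close> is a mean of this derivative up to the factor \<open>r * \<delta> ^ r\<close>.

As a function of \<open>r\<close>, the constant of the theorem grows like \<open>8 ^ r\<close>. All bounds above are therefore arranged to be at most
exponential in \<open>r\<close>, with \<open>U\<^sup>r\<close> estimated as a whole: an \<open>r\<close>-fold use of a bound for \<open>U\<close> would give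
the \<open>r\<close>-th power of \<open>C_mean\<close>.\<close>

section \<open>The Luxemburg norm in modular form\<close>

lemma borel_imp_lebesgue_measurable:
  "f \<in> borel_measurable lebesgue" if "f \<in> borel_measurable borel" for f :: "real \<Rightarrow> real"
  using measurable_completion[of f lborel borel] that by simp

locale exponent =
  fixes p :: "real \<Rightarrow> real"
  assumes p_borel [measurable]: "p \<in> borel_measurable borel"
    and p_ge_1: "\<And>x. 1 \<le> p x"
begin

text \<open>The inequality between norm and \<open>K\<close> in modular form. Pointwise estimates act on modulars directly,
and the strict inequality in the definition of \<^const>\<open>norm_var\<close> makes no difference to the infimum.\<close>
definition norm_le :: "(real \<Rightarrow> real) \<Rightarrow> real \<Rightarrow> bool" where
  "norm_le f K \<longleftrightarrow> f \<in> borel_measurable lebesgue \<and> 0 < K \<and> modular p (\<lambda>y. f y / K) \<le> 1"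

lemma p_pos: "0 < p x"
  using p_ge_1[of x] by linarith

lemma p_lebesgue [measurable]: "p \<in> borel_measurable lebesgue"
  by (rule borel_imp_lebesgue_measurable) measurable

text \<open>Since \<open>p \<ge> 1\<close>, a factor \<open>t \<le> 1\<close> enters the modular as \<open>t powr p y \<le> t\<close>. By this linear gain a
bound \<open>N \<ge> 1\<close> for a modular is also a bound for the norm, whatever the size of \<open>p\<close>.\<close>
lemma modular_scale_le:
  assumes "0 < t" "t \<le> 1" and f: "f \<in> borel_measurable lebesgue"
  shows "modular p (\<lambda>y. t * f y) \<le> ennreal t * modular p f"
proof -
  have "(t * \<bar>f y\<bar>) powr p y \<le> t * \<bar>f y\<bar> powr p y" for y
  proof -
    have "t powr p y \<le> t powr 1"
      using assms p_ge_1 by (intro powr_mono') auto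
    then have "t powr p y \<le> t" using assms by simp
    then show ?thesis using assms
      by (simp add: powr_mult mult_right_mono)
  qed
  then have "modular p (\<lambda>y. t * f y) \<le> (\<integral>\<^sup>+ y. ennreal t * ennreal (\<bar>f y\<bar> powr p y) \<partial>lebesgue)"
    unfolding modular_def using assms
    by (intro nn_integral_mono) (simp add: abs_mult flip: ennreal_mult)
  also have "\<dots> = ennreal t * modular p f"
    unfolding modular_def using f p_lebesgue by (intro nn_integral_cmult) simp
  finally show ?thesis .
qed

lemma norm_le_imp_norm_var:
  assumes "norm_le f K" shows "norm_var p f \<le> ennreal K"
proof (rule ennreal_le_epsilon)
  fix e :: real assume e: "0 < e"
  have f: "f \<in> borel_measurable lebesgue" and K: "0 < K" and m: "modular p (\<lambda>y. f y / K) \<le> 1"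
    using assms by (auto simp: norm_le_def)
  have "modular p (\<lambda>y. f y / (K + e)) = modular p (\<lambda>y. K / (K + e) * (f y / K))"
    using K by simp
  also have "\<dots> \<le> ennreal (K / (K + e)) * modular p (\<lambda>y. f y / K)"
    using K e f by (intro modular_scale_le) auto
  also have "\<dots> \<le> ennreal (K / (K + e)) * 1" using m by (intro mult_left_mono) auto
  also have "\<dots> < 1" using K e by simp
  finally have "modular p (\<lambda>y. f y / (K + e)) < 1" .
  then have "norm_var p f \<le> ennreal (K + e)"
    unfolding norm_var_def using K e
    by (intro Inf_lower CollectI exI[of _ "K + e"] conjI refl) (use K e in linarith, assumption)
  then show "norm_var p f \<le> ennreal K + ennreal e" using K e by simp
qed

lemma modular_mono:
  assumes "\<And>y. \<bar>f y\<bar> \<le> \<bar>g y\<bar>" shows "modular p f \<le> modular p g"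
  unfolding modular_def using assms p_pos
  by (intro nn_integral_mono ennreal_leI powr_mono2) (auto intro: less_imp_le)

lemma norm_le_mono_bound:
  assumes "norm_le f K" "K \<le> K'" shows "norm_le f K'"
proof -
  have "modular p (\<lambda>y. f y / K') \<le> modular p (\<lambda>y. f y / K)"
    using assms by (intro modular_mono) (auto simp: norm_le_def intro!: divide_left_mono)
  then show ?thesis using assms by (auto simp: norm_le_def)
qed

lemma norm_var_less_imp_norm_le:
  assumes "norm_var p f < ennreal K" and f: "f \<in> borel_measurable lebesgue"
  shows "norm_le f K"
proof -
  obtain \<eta> where \<eta>: "\<eta> > 0" "modular p (\<lambda>y. f y / \<eta>) < 1" "ennreal \<eta> < ennreal K"
    using assms(1) unfolding norm_var_def Inf_less_iff by auto
  have "norm_le f \<eta>" using \<eta> f by (auto simp: norm_le_def)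
  moreover have "\<eta> \<le> K" using \<eta> by (simp add: ennreal_less_iff)
  ultimately show ?thesis by (rule norm_le_mono_bound)
qed

lemma norm_le_dominated:
  assumes "norm_le g K" "f \<in> borel_measurable lebesgue" "\<And>y. \<bar>f y\<bar> \<le> \<bar>g y\<bar>"
  shows "norm_le f K"
proof -
  have "modular p (\<lambda>y. f y / K) \<le> modular p (\<lambda>y. g y / K)"
    using assms by (intro modular_mono) (auto simp: norm_le_def intro!: divide_right_mono)
  then show ?thesis using assms by (auto simp: norm_le_def)
qed

lemma norm_le_scale:
  assumes "norm_le f K" "0 < c" shows "norm_le (\<lambda>x. c * f x) (c * K)"
  using assms by (auto simp: norm_le_def)

lemma powr_convex_comb:
  fixes a b s t u v :: real
  assumes "1 \<le> s" "0 \<le> u" "0 \<le> v" "0 < a" "0 < b" "a + b = 1"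
  shows "(a * u + b * v) powr s \<le> a * u powr s + b * v powr s"
proof -
  have *: "t powr s \<le> t" if "0 < t" "t \<le> 1" for t :: real
    using powr_mono'[of 1 s t] that assms by simp
  consider "u = 0" | "v = 0" | "0 < u" "0 < v" using assms by linarith
  then show ?thesis
  proof cases
    case 1
    then show ?thesis using assms *[of b] by (simp add: powr_mult mult_right_mono)
  next
    case 2
    then show ?thesis using assms *[of a] by (simp add: powr_mult mult_right_mono)
  next
    case 3
    have "1 - b = a" using assms(6) by linarith
    then show ?thesis
      using convex_onD[OF powr_convex[OF assms(1)], of b u v] 3 assms(4,5) by auto
  qed
qed

text \<open>Convexity of \<open>u powr p y\<close> with the weights \<open>K / (K + L)\<close> and \<open>L / (K + L)\<close>.\<close>
lemma norm_le_add:
  assumes "norm_le f K" "norm_le g L" shows "norm_le (\<lambda>x. f x + g x) (K + L)"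
proof -
  have [measurable]: "f \<in> borel_measurable lebesgue" "g \<in> borel_measurable lebesgue"
    and K: "0 < K" "0 < L"
    and m: "modular p (\<lambda>y. f y / K) \<le> 1" "modular p (\<lambda>y. g y / L) \<le> 1"
    using assms by (auto simp: norm_le_def)
  define a b where "a = K / (K + L)" and "b = L / (K + L)"
  have ab: "0 < a" "0 < b" "a + b = 1" using K by (auto simp: a_def b_def simp flip: add_divide_distrib)
  have pt: "\<bar>(f y + g y) / (K + L)\<bar> powr p y
      \<le> a * \<bar>f y / K\<bar> powr p y + b * \<bar>g y / L\<bar> powr p y" for y
  proof -
    have "(f y + g y) / (K + L) = a * (f y / K) + b * (g y / L)"
      using K by (simp add: a_def b_def add_divide_distrib)
    then have "\<bar>(f y + g y) / (K + L)\<bar> \<le> a * \<bar>f y / K\<bar> + b * \<bar>g y / L\<bar>"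
      using ab using abs_triangle_ineq[of "a * (f y / K)" "b * (g y / L)"] by (simp add: abs_mult)
    then have "\<bar>(f y + g y) / (K + L)\<bar> powr p y \<le> (a * \<bar>f y / K\<bar> + b * \<bar>g y / L\<bar>) powr p y"
      using p_pos[of y] by (intro powr_mono2) auto
    also have "\<dots> \<le> a * \<bar>f y / K\<bar> powr p y + b * \<bar>g y / L\<bar> powr p y"
      using ab p_ge_1 by (intro powr_convex_comb) auto
    finally show ?thesis .
  qed
  have "modular p (\<lambda>y. (f y + g y) / (K + L))
      \<le> (\<integral>\<^sup>+ y. ennreal a * ennreal (\<bar>f y / K\<bar> powr p y)
            + ennreal b * ennreal (\<bar>g y / L\<bar> powr p y) \<partial>lebesgue)"
    unfolding modular_def using pt ab
    by (intro nn_integral_mono) (simp flip: ennreal_mult ennreal_plus)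
  also have "\<dots> = ennreal a * modular p (\<lambda>y. f y / K) + ennreal b * modular p (\<lambda>y. g y / L)"
    unfolding modular_def by (subst nn_integral_add) (auto simp: nn_integral_cmult)
  also have "\<dots> \<le> ennreal a * 1 + ennreal b * 1"
    using m by (intro add_mono mult_left_mono) auto
  also have "\<dots> = 1" using ab by (simp flip: ennreal_plus)
  finally show ?thesis using K by (auto simp: norm_le_def)
qed

text \<open>Fatou's lemma for the modulars.\<close>
lemma norm_le_limit:
  assumes f: "\<And>n. norm_le (f n) K" and lim: "\<And>x. (\<lambda>n. f n x) \<longlonglongrightarrow> g x"
  shows "norm_le g K"
proof -
  have fm [measurable]: "f n \<in> borel_measurable lebesgue" for n using f by (auto simp: norm_le_def)
  have K: "0 < K" using f by (auto simp: norm_le_def)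
  have [measurable]: "g \<in> borel_measurable lebesgue"
    by (rule borel_measurable_LIMSEQ_metric[OF fm lim])
  have c: "(\<lambda>n. ennreal (\<bar>f n y / K\<bar> powr p y)) \<longlonglongrightarrow> ennreal (\<bar>g y / K\<bar> powr p y)" for y
    using lim[of y] K p_pos[of y]
    by (intro tendsto_ennrealI tendsto_powr' tendsto_intros) auto
  have "modular p (\<lambda>y. g y / K)
      = (\<integral>\<^sup>+ y. liminf (\<lambda>n. ennreal (\<bar>f n y / K\<bar> powr p y)) \<partial>lebesgue)"
    unfolding modular_def using c by (intro nn_integral_cong lim_imp_Liminf[symmetric]) auto
  also have "\<dots> \<le> liminf (\<lambda>n. modular p (\<lambda>y. f n y / K))"
    unfolding modular_def by (intro nn_integral_liminf) measurable
  also have "\<dots> \<le> 1"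
    using f by (intro Liminf_le always_eventually allI) (auto simp: norm_le_def)
  finally show ?thesis using K by (auto simp: norm_le_def)
qed

text \<open>Transfers an operator bound from the modular form to norms, by letting \<open>K\<close> decrease to the norm
of \<open>f\<close>.\<close>
lemma norm_var_le_of_norm_le:
  assumes "\<And>K. norm_le f K \<Longrightarrow> norm_le g (C * K)" "0 < C" "f \<in> borel_measurable lebesgue"
  shows "norm_var p g \<le> ennreal C * norm_var p f"
proof (cases "norm_var p f")
  case (real n)
  show ?thesis
  proof (rule ennreal_le_epsilon)
    fix e :: real assume e: "0 < e"
    have "norm_var p f < ennreal (n + e / C)" using real e assms by (simp add: ennreal_less_iff)
    then have "norm_le f (n + e / C)" using assms by (intro norm_var_less_imp_norm_le)
    then have "norm_le g (C * (n + e / C))" by (rule assms)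
    then have "norm_var p g \<le> ennreal (C * (n + e / C))" by (rule norm_le_imp_norm_var)
    also have "C * (n + e / C) = C * n + e" using assms by (simp add: field_simps)
    finally show "norm_var p g \<le> ennreal C * norm_var p f + ennreal e"
      using real assms e by (simp add: ennreal_mult)
  qed
next
  case top
  then show ?thesis using assms by (simp add: ennreal_mult_top)
qed

lemma norm_var_triangle:
  assumes "f \<in> borel_measurable lebesgue" "g \<in> borel_measurable lebesgue"
  shows "norm_var p (\<lambda>x. f x + g x) \<le> norm_var p f + norm_var p g"
proof (cases "norm_var p f = top \<or> norm_var p g = top")
  case False
  then obtain a b where ab: "norm_var p f = ennreal a" "norm_var p g = ennreal b" "0 \<le> a" "0 \<le> b"
    by (cases "norm_var p f"; cases "norm_var p g") auto
  show ?thesis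
  proof (rule ennreal_le_epsilon)
    fix e :: real assume e: "0 < e"
    have "norm_le f (a + e / 2)" "norm_le g (b + e / 2)"
      using ab e assms by (auto intro!: norm_var_less_imp_norm_le simp: ennreal_less_iff)
    from norm_le_imp_norm_var[OF norm_le_add[OF this]]
    have "norm_var p (\<lambda>x. f x + g x) \<le> ennreal (a + b + e)" by (simp add: algebra_simps)
    then show "norm_var p (\<lambda>x. f x + g x) \<le> norm_var p f + norm_var p g + ennreal e"
      using ab e by simp
  qed
qed (auto simp: top_add add_top)

lemma norm_var_minus: "norm_var p (\<lambda>x. - f x) = norm_var p f"
  unfolding norm_var_def modular_def by simp

lemma L_var_iff_norm_le:
  assumes "f \<in> borel_measurable lebesgue"
  shows "f \<in> L_var p \<longleftrightarrow> (\<exists>K. norm_le f K)"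
proof
  assume "f \<in> L_var p"
  then obtain s where s: "s > 0" "modular p (\<lambda>y. f y / s) < \<infinity>" by (auto simp: L_var_def)
  then obtain m where m: "modular p (\<lambda>y. f y / s) = ennreal m" "0 \<le> m"
    by (cases "modular p (\<lambda>y. f y / s)") auto
  define t where "t = 1 / (m + 1)"
  have t: "0 < t" "t \<le> 1" using m by (auto simp: t_def)
  have "modular p (\<lambda>y. t * (f y / s)) \<le> ennreal t * modular p (\<lambda>y. f y / s)"
    using t assms by (intro modular_scale_le) auto
  also have "\<dots> = ennreal (t * m)" using m t by (simp add: ennreal_mult)
  also have "\<dots> \<le> 1" using m by (simp add: t_def)
  finally have "modular p (\<lambda>y. f y / (s / t)) \<le> 1" using t by (simp add: mult.commute)
  then show "\<exists>K. norm_le f K" using assms s t by (intro exI[of _ "s / t"]) (auto simp: norm_le_def)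
next
  assume "\<exists>K. norm_le f K"
  then show "f \<in> L_var p"
    by (auto simp: L_var_def norm_le_def less_top[symmetric] top_unique)
qed

end

section \<open>Means over intervals\<close>

text \<open>This is how the decay condition at infinity enters. Exponents whose reciprocals differ by at most
\<open>c / ln W\<close> are interchangeable on \<open>[0, 1]\<close> up to the factor \<open>exp (- 2 * c)\<close> and the additive error
\<open>W powr (- 2)\<close>: if \<open>t powr b\<close> is smaller than the left-hand side, then \<open>t\<close> is so small that the left-hand
side is below \<open>W powr (- 2)\<close>. For \<open>W = exp 1 + \<bar>x\<bar>\<close> this error is integrable in \<open>x\<close>.\<close>
lemma exponent_switch:
  fixes a b c t W :: real
  assumes "0 < a" "0 < b" "0 \<le> t" "t \<le> 1" "1 < W" "0 \<le> c" "\<bar>1 / a - 1 / b\<bar> * ln W \<le> c"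
  shows "(exp (- 2 * c) * t) powr a \<le> t powr b + W powr (- 2)"
proof (cases "t = 0")
  case False
  \<comment> \<open>In logarithmic coordinates both alternatives are linear inequalities.\<close>
  define \<tau> where "\<tau> = - ln t"
  have t: "t = exp (- \<tau>)" "0 \<le> \<tau>" using False assms by (auto simp: \<tau>_def)
  have l: "(exp (- 2 * c) * t) powr a = exp (- ((2 * c + \<tau>) * a))"
    by (simp add: t powr_def exp_add[symmetric] algebra_simps)
  have r: "t powr b = exp (- (\<tau> * b))" "W powr (- 2) = exp (- (2 * ln W))"
    using assms by (auto simp: t powr_def)
  have "\<tau> * b \<le> (2 * c + \<tau>) * a \<or> 2 * ln W \<le> (2 * c + \<tau>) * a"
  proof (rule disjCI)
    assume "\<not> 2 * ln W \<le> (2 * c + \<tau>) * a"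
    then have A: "(2 * c + \<tau>) * a < 2 * ln W" by simp
    show "\<tau> * b \<le> (2 * c + \<tau>) * a"
    proof (rule ccontr)
      assume "\<not> \<tau> * b \<le> (2 * c + \<tau>) * a"
      then have B: "2 * c * a < \<tau> * (b - a)" by (simp add: algebra_simps)
      have "0 \<le> 2 * c * a" using assms by simp
      with B have "0 < \<tau> * (b - a)" by linarith
      then have ab: "a < b" using t by (simp add: zero_less_mult_iff)
      have "1 / a - 1 / b = (b - a) / (a * b)" using assms by (simp add: field_simps)
      then have "(b - a) / (a * b) * ln W \<le> c"
        using assms(7) mult_right_mono[OF abs_ge_self[of "1 / a - 1 / b"], of "ln W"] assms(5)
        by simp
      then have C: "(b - a) * ln W \<le> c * (a * b)"
        using assms by (simp add: field_simps)
      have "(2 * c + \<tau>) * a * (b - a) = 2 * c * a * (b - a) + a * (\<tau> * (b - a))"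
        by (simp add: algebra_simps)
      also have "\<dots> > 2 * c * a * (b - a) + a * (2 * c * a)"
        using B assms(1) by simp
      also have "2 * c * a * (b - a) + a * (2 * c * a) = 2 * (c * (a * b))"
        by (simp add: algebra_simps)
      finally have "2 * ln W * (b - a) < (2 * c + \<tau>) * a * (b - a)" using C
        mult.commute[of "ln W" "b - a"] by linarith
      then show False using A ab by (simp add: mult_less_cancel_right)
    qed
  qed
  then show ?thesis unfolding l r
    by (smt (verit) exp_gt_zero exp_le_cancel_iff)
qed (use assms in auto)

lemma powr_tangent:
  fixes s u G :: real
  assumes "1 \<le> s" "0 \<le> u" "0 < G"
  shows "G powr s + s * G powr (s - 1) * u \<le> u powr s + s * G powr (s - 1) * G"
proof (cases "u = 0")
  case True
  have "s * G powr (s - 1) * G = s * G powr s"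
    using assms by (simp add: powr_diff)
  moreover have "G powr s * 1 \<le> G powr s * s" using assms by (intro mult_left_mono) auto
  ultimately have "G powr s \<le> s * G powr (s - 1) * G" by (simp only: mult_1_right mult.commute[of s])
  then show ?thesis using True by simp
next
  case False
  have "(s * G powr (s - 1)) * (u - G) \<le> u powr s - G powr s"
  proof (rule convex_on_imp_above_tangent[OF powr_convex[OF assms(1)], where c = G])
    show "((\<lambda>x. x powr s) has_field_derivative s * G powr (s - 1)) (at G within {0<..})"
      using assms by (auto intro!: derivative_eq_intros)
  qed (use assms False in \<open>auto simp: interior_open\<close>)
  then show ?thesis by (simp add: algebra_simps)
qed

text \<open>Integrates the tangent inequality at the mean value \<open>G\<close>, written without subtraction so that both
sides are integrals of nonnegative functions.\<close>
lemma interval_Jensen: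
  fixes g :: "real \<Rightarrow> real"
  assumes [measurable]: "g \<in> borel_measurable borel" and g0: "\<And>y. 0 \<le> g y"
    and uv: "u < v" and s: "1 \<le> s" and G: "0 \<le> G"
    and int: "(\<integral>\<^sup>+ y\<in>{u..v}. ennreal (g y) \<partial>lborel) = ennreal ((v - u) * G)"
  shows "ennreal ((v - u) * G powr s) \<le> (\<integral>\<^sup>+ y\<in>{u..v}. ennreal (g y powr s) \<partial>lborel)"
proof (cases "G = 0")
  case False
  then have G: "0 < G" using G by simp
  let ?k = "s * G powr (s - 1)"
  have k: "0 \<le> ?k" using s by simp
  have c: "(\<integral>\<^sup>+ y\<in>{u..v}. ennreal z \<partial>lborel) = ennreal ((v - u) * z)" if "0 \<le> z" for z
    using uv that by (simp add: nn_integral_cmult_indicator ennreal_mult mult.commute)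
  have e: "ennreal (a + b) * indicator {u..v} y
      = ennreal a * indicator {u..v} y + ennreal b * indicator {u..v} y" if "0 \<le> a" "0 \<le> b" for a b y
    using that by (simp add: distrib_right)
  have m: "(\<integral>\<^sup>+ y\<in>{u..v}. ennreal (?k * g y) \<partial>lborel) = ennreal ((v - u) * (?k * G))"
  proof -
    have "(\<integral>\<^sup>+ y\<in>{u..v}. ennreal (?k * g y) \<partial>lborel)
      = (\<integral>\<^sup>+ y. ennreal ?k * (ennreal (g y) * indicator {u..v} y) \<partial>lborel)"
      by (intro nn_integral_cong) (simp only: ennreal_mult[OF k g0] mult.assoc[of "ennreal _"])
    also have "\<dots> = ennreal ?k * ennreal ((v - u) * G)"
      by (subst nn_integral_cmult) (auto simp: int)
    finally show ?thesis using k G uv by (simp flip: ennreal_mult add: mult_ac)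
  qed
  have "ennreal ((v - u) * G powr s) + ennreal ((v - u) * (?k * G))
      = (\<integral>\<^sup>+ y\<in>{u..v}. ennreal (G powr s + ?k * g y) \<partial>lborel)"
    using k g0 by (subst e) (auto simp: nn_integral_add c m)
  also have "\<dots> \<le> (\<integral>\<^sup>+ y\<in>{u..v}. ennreal (g y powr s + ?k * G) \<partial>lborel)"
    using powr_tangent[OF s g0 G] by (intro nn_integral_mono mult_right_mono ennreal_leI) auto
  also have "\<dots> = (\<integral>\<^sup>+ y\<in>{u..v}. ennreal (g y powr s) \<partial>lborel) + ennreal ((v - u) * (?k * G))"
    using k G by (subst e) (auto simp: nn_integral_add c)
  finally show ?thesis by (simp add: ennreal_add_left_cancel_le add.commute)
qed simp

text \<open>Tonelli: each \<open>y\<close> lies in the window of \<open>x\<close> for a set of \<open>x\<close> of length \<open>b - a\<close>.\<close>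
lemma nn_integral_window:
  fixes \<phi> :: "real \<Rightarrow> ennreal"
  assumes [measurable]: "\<phi> \<in> borel_measurable borel" and "a \<le> b"
  shows "(\<integral>\<^sup>+ x. (\<integral>\<^sup>+ y\<in>{x+a..x+b}. \<phi> y \<partial>lborel) \<partial>lborel) = ennreal (b - a) * (\<integral>\<^sup>+ y. \<phi> y \<partial>lborel)"
proof -
  have "(\<integral>\<^sup>+ x. (\<integral>\<^sup>+ y\<in>{x+a..x+b}. \<phi> y \<partial>lborel) \<partial>lborel)
      = (\<integral>\<^sup>+ x. (\<integral>\<^sup>+ y. \<phi> y * indicator {a..b} (y - x) \<partial>lborel) \<partial>lborel)"
    by (intro nn_integral_cong) (auto simp: indicator_def)
  also have "\<dots> = (\<integral>\<^sup>+ y. (\<integral>\<^sup>+ x. \<phi> y * indicator {a..b} (y - x) \<partial>lborel) \<partial>lborel)"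
    by (rule lborel_pair.Fubini') measurable
  also have "\<dots> = (\<integral>\<^sup>+ y. \<phi> y * ennreal (b - a) \<partial>lborel)"
  proof (intro nn_integral_cong)
    fix y
    have "(\<integral>\<^sup>+ x. \<phi> y * indicator {a..b} (y - x) \<partial>lborel)
       = (\<integral>\<^sup>+ x. \<phi> y * indicator {y-b..y-a} x \<partial>lborel)"
      by (intro nn_integral_cong) (auto simp: indicator_def)
    also have "\<dots> = \<phi> y * ennreal (b - a)"
      using assms by (subst nn_integral_cmult_indicator) auto
    finally show "(\<integral>\<^sup>+ x. \<phi> y * indicator {a..b} (y - x) \<partial>lborel) = \<phi> y * ennreal (b - a)" .
  qed
  also have "\<dots> = ennreal (b - a) * (\<integral>\<^sup>+ y. \<phi> y \<partial>lborel)"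
    by (subst nn_integral_multc) (auto simp: mult.commute)
  finally show ?thesis .
qed

text \<open>The error term of the lemma \<open>exponent_switch\<close> for \<open>W = exp 1 + \<bar>x\<bar>\<close>.\<close>
definition decay_weight :: "real \<Rightarrow> real" where "decay_weight x = (exp 1 + \<bar>x\<bar>) powr (- 2)"

lemma decay_weight_borel [measurable]: "decay_weight \<in> borel_measurable borel"
  unfolding decay_weight_def by measurable

lemma nn_integral_decay_weight: "(\<integral>\<^sup>+ x. ennreal (decay_weight x) \<partial>lborel) \<le> ennreal pi"
proof -
  have "decay_weight x \<le> inverse (1 + x\<^sup>2)" for x
  proof -
    have "0 < exp 1 + \<bar>x\<bar>" by (smt (verit) exp_gt_zero)
    then have "decay_weight x = inverse ((exp 1 + \<bar>x\<bar>)\<^sup>2)"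
      unfolding decay_weight_def by (simp add: powr_minus)
    also have "\<dots> \<le> inverse (1 + x\<^sup>2)"
    proof (rule le_imp_inverse_le)
      have "(1::real) \<le> exp 1" by simp
      then have "(1 + \<bar>x\<bar>)\<^sup>2 \<le> (exp 1 + \<bar>x\<bar>)\<^sup>2" by (intro power_mono) auto
      then show "1 + x\<^sup>2 \<le> (exp 1 + \<bar>x\<bar>)\<^sup>2" by (simp add: power2_eq_square algebra_simps)
    qed (simp add: add_pos_nonneg)
    finally show ?thesis .
  qed
  then have "(\<integral>\<^sup>+ x. ennreal (decay_weight x) \<partial>lborel) \<le> (\<integral>\<^sup>+ x. ennreal (inverse (1 + x\<^sup>2)) \<partial>lborel)"
    by (intro nn_integral_mono ennreal_leI)
  also have "\<dots> = ennreal pi"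
  proof -
    have i: "integrable lborel (\<lambda>x::real. inverse (1 + x\<^sup>2))"
      using integrable_inverse_1_plus_square by (simp add: set_integrable_def)
    have "(LINT x|lborel. inverse (1 + x\<^sup>2)) = pi"
      using LBINT_inverse_1_plus_square
      by (simp add: interval_lebesgue_integral_def set_lebesgue_integral_def)
    then show ?thesis
      using nn_integral_eq_integral[OF i] by (simp add: add_nonneg_nonneg)
  qed
  finally show ?thesis .
qed

definition interval_mean :: "real \<Rightarrow> real \<Rightarrow> (real \<Rightarrow> real) \<Rightarrow> real \<Rightarrow> real" where
  "interval_mean a b f x = 1 / (b - a) * (LINT y:{x+a..x+b}|lebesgue. \<bar>f y\<bar>)"

lemma sets_lebesgue_interval [measurable]: "{a..b::real} \<in> sets lebesgue"
  by simp

lemma interval_mean_nonneg: "a \<le> b \<Longrightarrow> 0 \<le> interval_mean a b f x"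
  unfolding interval_mean_def set_lebesgue_integral_def
  by (intro mult_nonneg_nonneg integral_nonneg_AE) auto

lemma nn_integral_interval_mean:
  assumes "set_integrable lebesgue {x+a..x+b} f" "a < b"
  shows "(\<integral>\<^sup>+ y\<in>{x+a..x+b}. ennreal \<bar>f y\<bar> \<partial>lebesgue) = ennreal ((b - a) * interval_mean a b f x)"
proof -
  have i: "integrable lebesgue (\<lambda>y. indicator {x+a..x+b} y * \<bar>f y\<bar>)"
    using set_integrable_abs[OF assms(1)] by (simp add: set_integrable_def)
  have "(\<integral>\<^sup>+ y\<in>{x+a..x+b}. ennreal \<bar>f y\<bar> \<partial>lebesgue)
      = (\<integral>\<^sup>+ y. ennreal (indicator {x+a..x+b} y * \<bar>f y\<bar>) \<partial>lebesgue)"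
    by (intro nn_integral_cong) (auto simp: indicator_def)
  also have "\<dots> = ennreal (LINT y:{x+a..x+b}|lebesgue. \<bar>f y\<bar>)"
    using nn_integral_eq_integral[OF i] by (simp add: set_lebesgue_integral_def)
  finally show ?thesis using assms by (simp add: interval_mean_def)
qed

lemma interval_mean_cong_AE:
  assumes "AE y in lebesgue. \<bar>f y\<bar> = \<bar>g y\<bar>" "f \<in> borel_measurable lebesgue" "g \<in> borel_measurable lebesgue"
  shows "interval_mean a b f x = interval_mean a b g x"
  unfolding interval_mean_def set_lebesgue_integral_def
proof (intro arg_cong2[where f = "(*)"] refl integral_cong_AE)
  have [measurable]: "f \<in> borel_measurable lebesgue" "g \<in> borel_measurable lebesgue"
    using assms by auto
  show "(\<lambda>y. indicator {x+a..x+b} y *\<^sub>R \<bar>f y\<bar>) \<in> borel_measurable lebesgue" by measurable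
  show "(\<lambda>y. indicator {x+a..x+b} y *\<^sub>R \<bar>g y\<bar>) \<in> borel_measurable lebesgue" by measurable
qed (use assms(1) in auto)

lemma interval_mean_lborel:
  assumes [measurable]: "f \<in> borel_measurable borel"
  shows "interval_mean a b f x = 1 / (b - a) * (LINT y|lborel. indicator {a..b} (y - x) * \<bar>f y\<bar>)"
proof -
  have "(LINT y:{x+a..x+b}|lebesgue. \<bar>f y\<bar>) = (LINT y|lborel. indicator {x+a..x+b} y * \<bar>f y\<bar>)"
    unfolding set_lebesgue_integral_def by (subst integral_completion) auto
  also have "\<dots> = (LINT y|lborel. indicator {a..b} (y - x) * \<bar>f y\<bar>)"
    by (intro Bochner_Integration.integral_cong refl) (auto simp: indicator_def)
  finally show ?thesis by (simp add: interval_mean_def)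
qed

lemma interval_mean_borel:
  assumes [measurable]: "f \<in> borel_measurable borel"
  shows "interval_mean a b f \<in> borel_measurable borel"
  unfolding interval_mean_lborel[OF assms, abs_def] by measurable

context exponent
begin

lemma abs_le_1_plus_powr: "\<bar>u\<bar> \<le> 1 + \<bar>u\<bar> powr p x"
proof (cases "\<bar>u\<bar> \<le> 1")
  case False
  then have "\<bar>u\<bar> powr 1 \<le> \<bar>u\<bar> powr p x" using p_ge_1 by (intro powr_mono) auto
  then show ?thesis using False by simp
qed (simp add: add_increasing2)

lemma norm_le_local_integral:
  assumes "norm_le f K" "u \<le> v"
  shows "(\<integral>\<^sup>+ y\<in>{u..v}. ennreal \<bar>f y\<bar> \<partial>lebesgue) \<le> ennreal (K * (v - u + 1))"
proof -
  have [measurable]: "f \<in> borel_measurable lebesgue" and K: "0 < K"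
    and m: "modular p (\<lambda>y. f y / K) \<le> 1"
    using assms by (auto simp: norm_le_def)
  have pt: "\<bar>f y\<bar> \<le> K * (1 + \<bar>f y / K\<bar> powr p y)" for y
  proof -
    have "\<bar>f y\<bar> = K * \<bar>f y / K\<bar>" using K by simp
    also have "\<dots> \<le> K * (1 + \<bar>f y / K\<bar> powr p y)"
      using K abs_le_1_plus_powr[of "f y / K" y] by (intro mult_left_mono) auto
    finally show ?thesis .
  qed
  have "(\<integral>\<^sup>+ y\<in>{u..v}. ennreal \<bar>f y\<bar> \<partial>lebesgue)
      \<le> (\<integral>\<^sup>+ y. ennreal K * (indicator {u..v} y + ennreal (\<bar>f y / K\<bar> powr p y)) \<partial>lebesgue)"
  proof (intro nn_integral_mono)
    fix y
    have "ennreal \<bar>f y\<bar> \<le> ennreal K * (1 + ennreal (\<bar>f y / K\<bar> powr p y))"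
      using ennreal_leI[OF pt[of y]] K by (simp add: ennreal_mult)
    then show "ennreal \<bar>f y\<bar> * indicator {u..v} y
      \<le> ennreal K * (indicator {u..v} y + ennreal (\<bar>f y / K\<bar> powr p y))"
      by (auto simp: indicator_def)
  qed
  also have "\<dots> = ennreal K * (ennreal (v - u) + modular p (\<lambda>y. f y / K))"
    using assms(2) by (simp add: nn_integral_cmult nn_integral_add modular_def)
  also have "\<dots> \<le> ennreal K * (ennreal (v - u) + 1)"
    using m by (intro mult_left_mono add_left_mono) auto
  also have "\<dots> = ennreal (K * (v - u + 1))"
    using K assms(2) by (simp add: ennreal_mult)
  finally show ?thesis .
qed

lemma norm_le_set_integrable:
  assumes "norm_le f K" shows "set_integrable lebesgue {u..v} f"
proof (cases "u \<le> v")
  case True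
  have [measurable]: "f \<in> borel_measurable lebesgue" using assms by (simp add: norm_le_def)
  have m: "(\<lambda>y. indicator {u..v} y *\<^sub>R f y) \<in> borel_measurable lebesgue" by measurable
  have "(\<integral>\<^sup>+ y. ennreal (norm (indicator {u..v} y *\<^sub>R f y)) \<partial>lebesgue)
      = (\<integral>\<^sup>+ y\<in>{u..v}. ennreal \<bar>f y\<bar> \<partial>lebesgue)"
    by (intro nn_integral_cong) (auto simp: indicator_def)
  also have "\<dots> < \<infinity>"
    using norm_le_local_integral[OF assms True] by (simp add: le_less_trans)
  finally show ?thesis unfolding set_integrable_def
    by (intro integrableI_bounded m)
qed (simp add: set_integrable_def)

end

locale log_exponent = exponent +
  fixes c q :: real
  assumes q_gt_1: "1 < q"
    and log_local: "\<And>x y. x \<noteq> y \<Longrightarrow> \<bar>1 / p x - 1 / p y\<bar> * ln (exp 1 + 1 / \<bar>x - y\<bar>) \<le> c"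
    and log_decay: "\<And>x. \<bar>1 / p x - 1 / q\<bar> * ln (exp 1 + \<bar>x\<bar>) \<le> c"
begin

lemma ln_e_plus: "0 \<le> x \<Longrightarrow> 1 \<le> ln (exp 1 + x)" for x :: real
  by (smt (verit) exp_gt_zero ln_ge_iff)

lemma c_nonneg: "0 \<le> c"
proof -
  have "0 \<le> \<bar>1 / p 0 - 1 / q\<bar> * ln (exp 1 + \<bar>0\<bar>)"
    using ln_e_plus[of 0] by (intro mult_nonneg_nonneg) auto
  then show ?thesis using log_decay[of 0] by linarith
qed

definition window_modular :: "real \<Rightarrow> real \<Rightarrow> (real \<Rightarrow> real) \<Rightarrow> real \<Rightarrow> ennreal" where
  "window_modular a b f x = (\<integral>\<^sup>+ y\<in>{x+a..x+b}. ennreal (\<bar>f y\<bar> powr p y) \<partial>lborel)"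

text \<open>Where \<open>f \<ge> 1\<close>, larger exponents give larger powers. So with \<open>1 / S\<close> the infimum of the exponents in the window,
\<open>f powr (1 / S) \<le> f powr p y\<close>, and Jensen's inequality applies to the constant exponent \<open>1 / S\<close>. The
return from \<open>1 / S\<close> to \<open>p x\<close> costs a power \<open>S - 1 / p x\<close> of a number that is at most \<open>1 / (b - a)\<close>,
because the whole modular is at most 1, and the local log-Hoelder condition bounds this power by
\<open>exp c\<close>.\<close>
lemma mean_large_part:
  assumes f [measurable]: "f \<in> borel_measurable borel"
    and large: "\<And>y. f y = 0 \<or> 1 \<le> f y"
    and int: "(\<integral>\<^sup>+ y. ennreal (\<bar>f y\<bar> powr p y) \<partial>lborel) \<le> 1"
    and ab: "a \<le> 0" "0 \<le> b" "a < b" and G: "0 \<le> G"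
    and mean: "(\<integral>\<^sup>+ y\<in>{x+a..x+b}. ennreal (f y) \<partial>lborel) = ennreal ((b - a) * G)"
  shows "ennreal ((b - a) * (exp (- c) * G) powr p x) \<le> window_modular a b f x"
proof -
  define I where "I = {x+a..x+b}"
  define S where "S = (SUP y\<in>I. 1 / p y)"
  have f0: "0 \<le> f y" for y using large[of y] by auto
  have xI: "x \<in> I" using ab by (simp add: I_def)
  have bdd: "bdd_above ((\<lambda>y. 1 / p y) ` I)"
    using p_ge_1 by (intro bdd_aboveI[of _ 1]) (auto simp: divide_le_eq_1 intro: less_le_trans[OF zero_less_one])
  have S_upper: "1 / p y \<le> S" if "y \<in> I" for y
    unfolding S_def using that bdd by (intro cSUP_upper)
  have S_pos: "0 < S" using S_upper[OF xI] p_pos[of x] by (smt (verit) divide_pos_pos)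
  have S_1: "S \<le> 1" unfolding S_def using xI p_ge_1
    by (intro cSUP_least) (auto simp: divide_le_eq_1 intro: less_le_trans[OF zero_less_one])
  define d where "d = S - 1 / p x"
  have d0: "0 \<le> d" using S_upper[OF xI] by (simp add: d_def)
  define W where "W = exp 1 + 1 / (b - a)"
  have W: "1 / (b - a) < W" "1 \<le> ln W" "0 < W"
    using ln_e_plus[of "1 / (b - a)"] ab by (auto simp: W_def add_pos_nonneg)
  have dW: "d * ln W \<le> c"
  proof -
    have "1 / p y \<le> 1 / p x + c / ln W" if y: "y \<in> I" for y
    proof (cases "y = x")
      case True
      moreover have "0 \<le> c / ln W" using c_nonneg W(2) by (intro divide_nonneg_nonneg) auto
      ultimately show ?thesis by simp
    next
      case False
      have "\<bar>x - y\<bar> \<le> b - a" using y ab by (auto simp: I_def)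
      then have "W \<le> exp 1 + 1 / \<bar>x - y\<bar>"
        using False ab unfolding W_def by (intro add_left_mono divide_left_mono) auto
      then have "ln W \<le> ln (exp 1 + 1 / \<bar>x - y\<bar>)" using W by (intro ln_mono) auto
      then have "\<bar>1 / p x - 1 / p y\<bar> * ln W \<le> c"
        using log_local[of x y] False by (smt (verit) mult_left_mono)
      then have "\<bar>1 / p x - 1 / p y\<bar> \<le> c / ln W" using W(2) pos_le_divide_eq[of "ln W"] by simp
      then show ?thesis by linarith
    qed
    then have "S \<le> 1 / p x + c / ln W" unfolding S_def using xI by (intro cSUP_least) auto
    then have "d \<le> c / ln W" by (simp add: d_def)
    then show ?thesis using W(2) pos_le_divide_eq[of "ln W" d c] by simp
  qed
  have "ennreal ((b - a) * G powr (1 / S)) = ennreal ((x + b - (x + a)) * G powr (1 / S))" by simp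
  also have "\<dots> \<le> (\<integral>\<^sup>+ y\<in>{x+a..x+b}. ennreal (f y powr (1 / S)) \<partial>lborel)"
    using f0 ab S_pos S_1 G mean by (intro interval_Jensen) auto
  also have "\<dots> \<le> window_modular a b f x"
    unfolding window_modular_def
  proof (intro nn_integral_mono)
    fix y
    show "ennreal (f y powr (1 / S)) * indicator {x+a..x+b} y
      \<le> ennreal (\<bar>f y\<bar> powr p y) * indicator {x+a..x+b} y"
    proof (cases "y \<in> I \<and> f y \<noteq> 0")
      case True
      then have "1 \<le> f y" using large by auto
      moreover have "1 / S \<le> p y" using S_upper[of y] True S_pos p_pos[of y] by (simp add: field_simps)
      ultimately have "f y powr (1 / S) \<le> \<bar>f y\<bar> powr p y"
        by (simp add: powr_mono)
      then show ?thesis by (intro mult_right_mono ennreal_leI) auto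
    qed (auto simp: I_def)
  qed
  finally have J: "ennreal ((b - a) * G powr (1 / S)) \<le> window_modular a b f x" .
  define j where "j = G powr (1 / S)"
  have "window_modular a b f x \<le> (\<integral>\<^sup>+ y. ennreal (\<bar>f y\<bar> powr p y) \<partial>lborel)"
    unfolding window_modular_def by (intro nn_integral_mono) (auto simp: indicator_def)
  with J int have "ennreal ((b - a) * j) \<le> 1" unfolding j_def by order
  then have "j \<le> 1 / (b - a)" using ab by (simp add: field_simps)
  then have jW: "j \<le> W" using W by linarith
  have "(exp (- c) * G) powr p x \<le> j"
  proof (cases "G = 0")
    case False
    then have Gj: "0 < j" "G = j powr S" using G S_pos by (auto simp: j_def powr_powr)
    have "j powr d \<le> W powr d" using Gj jW d0 by (intro powr_mono2) auto
    also have "\<dots> \<le> exp c" using W dW by (simp add: powr_def mult.commute)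
    finally have "exp (- c) * j powr d \<le> exp (- c) * exp c" by (intro mult_left_mono) auto
    then have e: "exp (- c) * j powr d \<le> 1" by (simp add: exp_add[symmetric])
    have "exp (- c) * G = exp (- c) * j powr d * j powr (1 / p x)"
      using Gj by (simp add: d_def powr_diff)
    also have "\<dots> \<le> 1 * j powr (1 / p x)" using e by (intro mult_right_mono) auto
    finally have "(exp (- c) * G) powr p x \<le> (j powr (1 / p x)) powr p x"
      using p_pos[of x] G by (intro powr_mono2) auto
    also have "\<dots> = j" using p_pos[of x] Gj by (simp add: powr_powr)
    finally show ?thesis .
  qed (simp add: j_def)
  then have "ennreal ((b - a) * (exp (- c) * G) powr p x) \<le> ennreal ((b - a) * j)"
    using ab by (intro ennreal_leI mult_left_mono) auto
  also have "\<dots> \<le> window_modular a b f x" using J by (simp add: j_def)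
  finally show ?thesis .
qed

text \<open>Where \<open>f \<le> 1\<close>, long windows matter and the local condition is of no help. Both \<open>p y\<close> and \<open>p x\<close> are
compared with the constant exponent \<open>q\<close>, with Jensen's inequality for \<open>q\<close> in between. Each of the two
comparisons costs a factor \<open>exp (- 2 * c)\<close> and an integrable error.\<close>
lemma mean_small_part:
  assumes f [measurable]: "f \<in> borel_measurable borel"
    and small: "\<And>y. 0 \<le> f y \<and> f y \<le> 1"
    and ab: "a < b" and G: "0 \<le> G"
    and mean: "(\<integral>\<^sup>+ y\<in>{x+a..x+b}. ennreal (f y) \<partial>lborel) = ennreal ((b - a) * G)"
  shows "ennreal ((b - a) * (exp (- 4 * c) * G) powr p x)
    \<le> window_modular a b f x + (\<integral>\<^sup>+ y\<in>{x+a..x+b}. ennreal (decay_weight y) \<partial>lborel)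
      + ennreal ((b - a) * decay_weight x)"
proof -
  define \<beta> where "\<beta> = exp (- 2 * c)"
  have \<beta>: "0 < \<beta>" "\<beta> \<le> 1" "exp (- 4 * c) = \<beta> * \<beta>"
    using c_nonneg by (auto simp: \<beta>_def simp flip: exp_add)
  have \<beta>\<beta>: "exp (- 4 * c) * G = \<beta> * (\<beta> * G)" by (simp only: \<beta>(3) mult.assoc)
  have W: "1 < exp 1 + \<bar>y\<bar>" for y :: real using exp_gt_one[of 1] by linarith
  have to_q: "(\<beta> * t) powr p y \<le> t powr q + decay_weight y" if "0 \<le> t" "t \<le> 1" for t y
    unfolding \<beta>_def decay_weight_def using that p_pos q_gt_1 c_nonneg log_decay W
    by (intro exponent_switch) auto
  have from_q: "(\<beta> * t) powr q \<le> t powr p y + decay_weight y" if "0 \<le> t" "t \<le> 1" for t y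
    unfolding \<beta>_def decay_weight_def using that p_pos q_gt_1 c_nonneg log_decay W
    by (intro exponent_switch) (auto simp: abs_minus_commute)
  have "ennreal ((b - a) * G) \<le> (\<integral>\<^sup>+ y\<in>{x+a..x+b}. 1 \<partial>lborel)"
    unfolding mean[symmetric] using small by (intro nn_integral_mono mult_right_mono) auto
  then have "(b - a) * G \<le> b - a" using ab by (simp add: ennreal_le_iff)
  then have G1: "G \<le> 1" using ab by simp
  have "(exp (- 4 * c) * G) powr p x = (\<beta> * (\<beta> * G)) powr p x" by (simp only: \<beta>\<beta>)
  also have "\<dots> \<le> (\<beta> * G) powr q + decay_weight x"
    using G G1 \<beta> by (intro to_q) (auto intro: mult_le_one)
  finally have "ennreal ((b - a) * (exp (- 4 * c) * G) powr p x)
      \<le> ennreal ((b - a) * ((\<beta> * G) powr q + decay_weight x))"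
    using ab by (intro ennreal_leI mult_left_mono) auto
  also have "\<dots> = ennreal ((b - a) * (\<beta> * G) powr q) + ennreal ((b - a) * decay_weight x)"
    using ab by (simp add: distrib_left decay_weight_def flip: ennreal_plus)
  also have "ennreal ((b - a) * (\<beta> * G) powr q)
      \<le> window_modular a b f x + (\<integral>\<^sup>+ y\<in>{x+a..x+b}. ennreal (decay_weight y) \<partial>lborel)"
  proof -
    have "ennreal (x + b - (x + a)) * ennreal (\<beta> * G) = ennreal \<beta> * ennreal ((b - a) * G)"
      using ab \<beta> G by (simp flip: ennreal_mult add: mult_ac)
    also have "\<dots> = (\<integral>\<^sup>+ y. ennreal \<beta> * (ennreal (f y) * indicator {x+a..x+b} y) \<partial>lborel)"
      by (subst nn_integral_cmult) (auto simp: mean)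
    also have "\<dots> = (\<integral>\<^sup>+ y\<in>{x+a..x+b}. ennreal (\<beta> * f y) \<partial>lborel)"
      using small \<beta> by (intro nn_integral_cong) (simp add: ennreal_mult mult.assoc)
    finally have m: "(\<integral>\<^sup>+ y\<in>{x+a..x+b}. ennreal (\<beta> * f y) \<partial>lborel)
        = ennreal ((x + b - (x + a)) * (\<beta> * G))"
      using ab \<beta> G by (simp add: ennreal_mult)
    have "ennreal ((b - a) * (\<beta> * G) powr q) = ennreal ((x + b - (x + a)) * (\<beta> * G) powr q)" by simp
    also have "\<dots> \<le> (\<integral>\<^sup>+ y\<in>{x+a..x+b}. ennreal ((\<beta> * f y) powr q) \<partial>lborel)"
      using small \<beta> ab q_gt_1 G m by (intro interval_Jensen) auto
    also have "\<dots> \<le> (\<integral>\<^sup>+ y. ennreal (\<bar>f y\<bar> powr p y) * indicator {x+a..x+b} y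
        + ennreal (decay_weight y) * indicator {x+a..x+b} y \<partial>lborel)"
    proof (intro nn_integral_mono)
      fix y
      have "ennreal ((\<beta> * f y) powr q) \<le> ennreal (\<bar>f y\<bar> powr p y) + ennreal (decay_weight y)"
        using ennreal_leI[OF from_q[of "f y" y]] small[of y]
        by (simp add: decay_weight_def)
      then show "ennreal ((\<beta> * f y) powr q) * indicator {x+a..x+b} y
        \<le> ennreal (\<bar>f y\<bar> powr p y) * indicator {x+a..x+b} y
          + ennreal (decay_weight y) * indicator {x+a..x+b} y"
        by (auto simp: indicator_def)
    qed
    also have "\<dots> = window_modular a b f x + (\<integral>\<^sup>+ y\<in>{x+a..x+b}. ennreal (decay_weight y) \<partial>lborel)"
      unfolding window_modular_def by (rule nn_integral_add) measurable
    finally show ?thesis .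
  qed
  finally show ?thesis by (simp add: add.assoc add_right_mono)
qed

text \<open>Integrating a window estimate over \<open>x\<close> produces the factor \<open>b - a\<close> on both sides, so the resulting norm
bound is independent of the length of the window.\<close>
lemma modular_interval_mean_le:
  assumes f [measurable]: "f \<in> borel_measurable borel" and ab: "a < b" and K: "0 < K"
    and \<Phi> [measurable]: "\<Phi> \<in> borel_measurable borel"
    and pt: "\<And>x. ennreal ((b - a) * (K * interval_mean a b f x) powr p x)
      \<le> (\<integral>\<^sup>+ y\<in>{x+a..x+b}. \<Phi> y \<partial>lborel) + ennreal (b - a) * \<Psi> x"
    and \<Psi> [measurable]: "\<Psi> \<in> borel_measurable borel"
    and bound: "(\<integral>\<^sup>+ y. \<Phi> y \<partial>lborel) + (\<integral>\<^sup>+ y. \<Psi> y \<partial>lborel) \<le> ennreal N" and N: "1 \<le> N"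
  shows "norm_le (interval_mean a b f) (N / K)"
proof -
  have [measurable]: "interval_mean a b f \<in> borel_measurable borel"
    by (rule interval_mean_borel) measurable
  have lm: "interval_mean a b f \<in> borel_measurable lebesgue"
    by (rule borel_imp_lebesgue_measurable) measurable
  have i: "(\<lambda>x. \<integral>\<^sup>+ y\<in>{x+a..x+b}. \<Phi> y \<partial>lborel)
      = (\<lambda>x. \<integral>\<^sup>+ y. \<Phi> y * indicator {a..b} (y - x) \<partial>lborel)"
    by (intro ext nn_integral_cong) (auto simp: indicator_def)
  have [measurable]: "(\<lambda>x. \<integral>\<^sup>+ y\<in>{x+a..x+b}. \<Phi> y \<partial>lborel) \<in> borel_measurable borel"
    unfolding i by measurable
  have m: "modular p (\<lambda>x. K * interval_mean a b f x)
      = (\<integral>\<^sup>+ x. ennreal ((K * interval_mean a b f x) powr p x) \<partial>lborel)"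
    unfolding modular_def using K ab interval_mean_nonneg[of a b f]
    by (subst nn_integral_completion) (auto simp: abs_mult)
  have "ennreal (b - a) * modular p (\<lambda>x. K * interval_mean a b f x)
      = (\<integral>\<^sup>+ x. ennreal ((b - a) * (K * interval_mean a b f x) powr p x) \<partial>lborel)"
    unfolding m using ab by (subst nn_integral_cmult[symmetric]) (auto simp: ennreal_mult)
  also have "\<dots> \<le> (\<integral>\<^sup>+ x. (\<integral>\<^sup>+ y\<in>{x+a..x+b}. \<Phi> y \<partial>lborel) + ennreal (b - a) * \<Psi> x \<partial>lborel)"
    using pt by (intro nn_integral_mono)
  also have "\<dots> = ennreal (b - a) * (\<integral>\<^sup>+ y. \<Phi> y \<partial>lborel) + ennreal (b - a) * (\<integral>\<^sup>+ y. \<Psi> y \<partial>lborel)"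
    using ab by (simp add: nn_integral_add nn_integral_cmult nn_integral_window)
  also have "\<dots> \<le> ennreal (b - a) * ennreal N"
    unfolding distrib_left[symmetric] using bound by (intro mult_left_mono) auto
  finally have mod: "modular p (\<lambda>x. K * interval_mean a b f x) \<le> ennreal N"
    using ab by (simp add: ennreal_mult_le_mult_iff)
  have "modular p (\<lambda>x. interval_mean a b f x / (N / K))
      = modular p (\<lambda>x. (1 / N) * (K * interval_mean a b f x))"
    by (simp add: mult.commute)
  also have "\<dots> \<le> ennreal (1 / N) * modular p (\<lambda>x. K * interval_mean a b f x)"
    using N lm by (intro modular_scale_le) auto
  also have "\<dots> \<le> ennreal (1 / N) * ennreal N" using mod by (intro mult_left_mono) auto
  also have "\<dots> = 1" using N by (simp flip: ennreal_mult)
  finally show ?thesis using lm N K by (auto simp: norm_le_def)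
qed

text \<open>The function is split at height 1. The large values contribute \<open>exp c\<close>, the small ones at most
\<open>(1 + 2 * pi) * exp (4 * c)\<close>. A Borel representative is used because Tonelli's theorem is applied to
the product of Borel measures.\<close>
lemma norm_le_interval_mean_unit:
  assumes f: "norm_le f 1" and ab: "a \<le> 0" "0 \<le> b" "a < b"
  shows "norm_le (interval_mean a b f) (9 * exp (4 * c))"
proof -
  have fm [measurable]: "f \<in> borel_measurable lebesgue" and fmod: "modular p f \<le> 1"
    using f by (auto simp: norm_le_def)
  obtain g where g [measurable]: "g \<in> borel_measurable borel" and fg: "AE x in lborel. f x = g x"
    using completion_ex_borel_measurable_real[OF fm] by auto
  have fg': "AE x in lebesgue. f x = g x" using fg by (rule AE_completion)
  have "modular p g = modular p f"
    unfolding modular_def using fg' by (intro nn_integral_cong_AE) (auto elim: eventually_mono)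
  then have gmod: "modular p g \<le> 1" using fmod by simp
  have modb: "modular p h = (\<integral>\<^sup>+ y. ennreal (\<bar>h y\<bar> powr p y) \<partial>lborel)"
    if "h \<in> borel_measurable borel" for h
    unfolding modular_def using that by (subst nn_integral_completion) auto
  define g1 where "g1 = (\<lambda>y. if 1 \<le> \<bar>g y\<bar> then \<bar>g y\<bar> else 0)"
  define g2 where "g2 = (\<lambda>y. if 1 \<le> \<bar>g y\<bar> then 0 else \<bar>g y\<bar>)"
  have g12 [measurable]: "g1 \<in> borel_measurable borel" "g2 \<in> borel_measurable borel"
    by (auto simp: g1_def g2_def)
  have mod1: "modular p g1 \<le> 1"
    by (rule order_trans[OF modular_mono gmod]) (simp add: g1_def)
  have mod2: "modular p g2 \<le> 1"
    by (rule order_trans[OF modular_mono gmod]) (simp add: g2_def)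
  have n1: "norm_le g1 1" and n2: "norm_le g2 1"
    using mod1 mod2 borel_imp_lebesgue_measurable[OF g12(1)] borel_imp_lebesgue_measurable[OF g12(2)] by (simp_all add: norm_le_def)
  have pos: "0 \<le> g1 y" "0 \<le> g2 y" for y by (auto simp: g1_def g2_def)
  have int: "(\<integral>\<^sup>+ y\<in>{x+a..x+b}. ennreal (h y) \<partial>lborel) = ennreal ((b - a) * interval_mean a b h x)"
    if h: "norm_le h 1" "h \<in> borel_measurable borel" "\<And>y. 0 \<le> h y" for h x
  proof -
    have "(\<integral>\<^sup>+ y\<in>{x+a..x+b}. ennreal (h y) \<partial>lborel) = (\<integral>\<^sup>+ y\<in>{x+a..x+b}. ennreal \<bar>h y\<bar> \<partial>lebesgue)"
      using h by (subst nn_integral_completion) auto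
    then show ?thesis using nn_integral_interval_mean[OF norm_le_set_integrable[OF h(1)] ab(3)] by simp
  qed
  have N1: "norm_le (interval_mean a b g1) (1 / exp (- c))"
  proof (rule modular_interval_mean_le)
    show "ennreal ((b - a) * (exp (- c) * interval_mean a b g1 x) powr p x)
      \<le> (\<integral>\<^sup>+ y\<in>{x+a..x+b}. ennreal (\<bar>g1 y\<bar> powr p y) \<partial>lborel) + ennreal (b - a) * 0" for x
    proof -
      have "g1 y = 0 \<or> 1 \<le> g1 y" for y by (auto simp: g1_def)
      from mean_large_part[OF g12(1) this _ ab interval_mean_nonneg int[OF n1 g12(1) pos(1)]]
      show ?thesis using mod1 ab by (simp add: modb window_modular_def)
    qed
    show "(\<integral>\<^sup>+ y. ennreal (\<bar>g1 y\<bar> powr p y) \<partial>lborel) + (\<integral>\<^sup>+ y. 0 \<partial>lborel) \<le> ennreal 1"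
      using mod1 by (simp add: modb)
  qed (use ab in auto)
  have g2_small: "0 \<le> g2 y \<and> g2 y \<le> 1" for y by (auto simp: g2_def)
  have N2: "norm_le (interval_mean a b g2) (8 / exp (- 4 * c))"
  proof (rule modular_interval_mean_le)
    show "ennreal ((b - a) * (exp (- 4 * c) * interval_mean a b g2 x) powr p x)
      \<le> (\<integral>\<^sup>+ y\<in>{x+a..x+b}. (ennreal (\<bar>g2 y\<bar> powr p y) + ennreal (decay_weight y)) \<partial>lborel)
        + ennreal (b - a) * ennreal (decay_weight x)" for x
    proof -
      have "(\<integral>\<^sup>+ y\<in>{x+a..x+b}. (ennreal (\<bar>g2 y\<bar> powr p y) + ennreal (decay_weight y)) \<partial>lborel)
          = window_modular a b g2 x + (\<integral>\<^sup>+ y\<in>{x+a..x+b}. ennreal (decay_weight y) \<partial>lborel)"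
        unfolding window_modular_def distrib_right by (rule nn_integral_add) measurable
      then show ?thesis
        using mean_small_part[OF g12(2) g2_small ab(3) interval_mean_nonneg int[OF n2 g12(2) pos(2)], of x]
          ab by (simp add: ennreal_mult decay_weight_def)
    qed
    let ?W = "(\<integral>\<^sup>+ y. ennreal (decay_weight y) \<partial>lborel)"
    have "(\<integral>\<^sup>+ y. (ennreal (\<bar>g2 y\<bar> powr p y) + ennreal (decay_weight y)) \<partial>lborel)
        + ?W
        = modular p g2 + ?W + ?W"
      by (simp add: nn_integral_add modb)
    also have "\<dots> \<le> ennreal 1 + ennreal pi + ennreal pi"
      using mod2 nn_integral_decay_weight by (intro add_mono) auto
    also have "\<dots> = ennreal (1 + pi + pi)"
      by (metis ennreal_plus pi_ge_zero zero_le_one add_nonneg_nonneg)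
    also have "\<dots> \<le> ennreal 8" using pi_less_4 pi_approx by (intro ennreal_leI) auto
    finally show "(\<integral>\<^sup>+ y. (ennreal (\<bar>g2 y\<bar> powr p y) + ennreal (decay_weight y)) \<partial>lborel)
        + ?W \<le> ennreal 8" .
  qed (use ab in auto)
  have "norm_le (\<lambda>x. interval_mean a b g1 x + interval_mean a b g2 x) (1 / exp (- c) + 8 / exp (- 4 * c))"
    by (rule norm_le_add[OF N1 N2])
  moreover have "interval_mean a b g1 x + interval_mean a b g2 x = interval_mean a b f x" for x
  proof -
    have "interval_mean a b f x = interval_mean a b g x"
      using fg' borel_imp_lebesgue_measurable[OF g] by (intro interval_mean_cong_AE fm) (auto elim: eventually_mono)
    also have "\<dots> = 1 / (b - a) * (LINT y:{x+a..x+b}|lebesgue. (\<bar>g1 y\<bar> + \<bar>g2 y\<bar>))"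
      unfolding interval_mean_def set_lebesgue_integral_def
      by (intro arg_cong2[where f = "(*)"] refl Bochner_Integration.integral_cong)
         (auto simp: g1_def g2_def)
    also have "\<dots> = interval_mean a b g1 x + interval_mean a b g2 x"
      unfolding interval_mean_def
      by (simp add: distrib_left set_integral_add set_integrable_abs
          norm_le_set_integrable[OF n1] norm_le_set_integrable[OF n2])
    finally show ?thesis by simp
  qed
  moreover have "1 / exp (- c) + 8 / exp (- 4 * c) \<le> 9 * exp (4 * c)"
  proof -
    have "exp c \<le> exp (4 * c)" using c_nonneg by simp
    then show ?thesis by (simp add: exp_minus field_simps)
  qed
  ultimately show ?thesis using norm_le_mono_bound by simp
qed

text \<open>In general translations are not bounded on \<open>L_var p\<close>, but means over intervals that contain the point are, with a
constant that is the same for all intervals. The operators below are estimated through such means.\<close>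
lemma norm_le_interval_mean:
  assumes f: "norm_le f K" and ab: "a \<le> 0" "0 \<le> b" "a < b"
  shows "norm_le (interval_mean a b f) (9 * exp (4 * c) * K)"
proof -
  have K: "0 < K" using f by (simp add: norm_le_def)
  have "norm_le (\<lambda>x. f x / K) 1" using f by (auto simp: norm_le_def)
  from norm_le_scale[OF norm_le_interval_mean_unit[OF this ab] K]
  have "norm_le (\<lambda>x. K * interval_mean a b (\<lambda>x. f x / K) x) (9 * exp (4 * c) * K)"
    by (simp add: mult_ac)
  moreover have "K * interval_mean a b (\<lambda>x. f x / K) x = interval_mean a b f x" for x
    using K by (simp add: interval_mean_def)
  ultimately show ?thesis by simp
qed

end

section \<open>The Phragmen-Lindeloef principle in a quadrant\<close>

text \<open>On the quadrant the rotated and shifted variable \<open>w\<close> satisfies \<open>\<bar>arg w\<bar> \<le> pi / 4\<close>, so that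
\<open>w powr (3 / 2)\<close> has argument at most \<open>3 * pi / 8\<close> in modulus and a real part comparable with its modulus. The power is written as
\<open>csqrt w ^ 3\<close>, and the shift by 1 keeps \<open>w\<close> off the branch cut, also at \<open>z = 0\<close>.\<close>
lemma quadrant_damping:
  assumes "0 \<le> Re z" "0 \<le> Im z"
  defines "w \<equiv> cis (- pi / 4) * z + 1"
  shows "0 < Re w" "cmod z \<le> cmod w" "3 / 10 * cmod w * sqrt (cmod w) \<le> Re (csqrt w ^ 3)"
proof -
  have rw: "Re w = (Re z + Im z) / sqrt 2 + 1" "Im w = (Im z - Re z) / sqrt 2"
    by (auto simp: w_def cos_45 sin_45 field_simps real_divide_square_eq)
  show pos: "0 < Re w" using assms(1,2) by (simp add: rw add_nonneg_pos)
  have "cmod z = cmod (cis (- pi / 4) * z)" by (simp add: norm_mult)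
  also have "\<dots> \<le> cmod w"
  proof -
    define v where "v = cis (- pi / 4) * z"
    have "0 \<le> Re w - 1" using assms(1,2) unfolding rw by simp
    then have "0 \<le> Re v" by (simp add: w_def v_def)
    then have "(Re v)\<^sup>2 + (Im v)\<^sup>2 \<le> (Re v + 1)\<^sup>2 + (Im v)\<^sup>2"
      by (intro add_right_mono power_mono) auto
    moreover have "w = v + 1" by (simp only: w_def v_def)
    ultimately show ?thesis unfolding v_def[symmetric] by (simp add: cmod_def)
  qed
  finally show "cmod z \<le> cmod w" .
  define a b where "a = Re (csqrt w)" and "b = Im (csqrt w)"
  have sq: "csqrt w ^ 2 = w" by simp
  have csq: "csqrt w = Complex a b" unfolding a_def b_def by (rule complex_surj[symmetric])
  have re: "Re w = a\<^sup>2 - b\<^sup>2" and im: "Im w = 2 * a * b"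
    using arg_cong[OF sq, of Re] arg_cong[OF sq, of Im] by (auto simp: csq power2_eq_square)
  have a: "0 < a"
  proof -
    have "0 < a \<or> a = 0" using csqrt_principal[of w] unfolding a_def[symmetric] by blast
    moreover have "a \<noteq> 0" using pos unfolding re by auto
    ultimately show ?thesis by blast
  qed
  have "\<bar>Im w\<bar> \<le> Re w"
    using assms(1,2) unfolding rw by (auto simp: abs_le_iff field_simps)
  then have "2 * a * \<bar>b\<bar> \<le> a\<^sup>2 - b\<^sup>2" using a by (simp add: re im abs_mult)
  then have key: "b\<^sup>2 + 2 * a * \<bar>b\<bar> \<le> a\<^sup>2" by simp
  have b: "\<bar>b\<bar> \<le> a / 2"
  proof (rule ccontr)
    assume "\<not> ?thesis"
    then have "a / 2 < \<bar>b\<bar>" by simp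
    then have "2 * a * (a / 2) < 2 * a * \<bar>b\<bar>" using a by (intro mult_strict_left_mono) auto
    then have "a\<^sup>2 < 2 * a * \<bar>b\<bar>" by (simp add: power2_eq_square)
    then show False using key zero_le_power2[of b] by linarith
  qed
  have "b\<^sup>2 = \<bar>b\<bar> * \<bar>b\<bar>" by (simp add: power2_eq_square)
  also have "\<dots> \<le> a / 2 * \<bar>b\<bar>" using b by (intro mult_right_mono) auto
  finally have b5: "5 * b\<^sup>2 \<le> a\<^sup>2" using key by linarith
  have n: "cmod w = a\<^sup>2 + b\<^sup>2"
    using arg_cong[OF sq, of cmod] by (simp add: norm_power csq cmod_power2)
  have c3: "Re (csqrt w ^ 3) = a * (a\<^sup>2 - 3 * b\<^sup>2)"
    by (simp add: csq power3_eq_cube power2_eq_square algebra_simps)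
  have "sqrt (cmod w) \<le> 11 / 10 * a"
  proof (rule real_le_lsqrt)
    have "(11 / 10 * a)\<^sup>2 = 121 / 100 * a\<^sup>2" by (simp add: power_mult_distrib power_divide)
    then show "cmod w \<le> (11 / 10 * a)\<^sup>2" using b5 zero_le_power2[of a] unfolding n by linarith
  qed (use a in auto)
  then have "3 / 10 * cmod w * sqrt (cmod w) \<le> 3 / 10 * (6 / 5 * a\<^sup>2) * (11 / 10 * a)"
  proof (intro mult_mono)
    show "cmod w \<le> 6 / 5 * a\<^sup>2" using b5 unfolding n by linarith
  qed (use a in auto)
  also have "\<dots> \<le> a * (2 / 5 * a\<^sup>2)" using a by (simp add: power2_eq_square)
  also have "\<dots> \<le> a * (a\<^sup>2 - 3 * b\<^sup>2)"
    using a b5 by (intro mult_left_mono) linarith+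
  finally show "3 / 10 * cmod w * sqrt (cmod w) \<le> Re (csqrt w ^ 3)" by (simp add: c3)
qed

text \<open>The factor \<open>exp (- \<epsilon> * w powr (3 / 2))\<close> decays faster than any exponential of \<open>\<bar>z\<bar>\<close> grows. The maximum
principle on large quarter discs bounds the damped function, and \<open>\<epsilon>\<close> tends to 0.\<close>
lemma Phragmen_Lindeloef_quadrant:
  fixes F :: "complex \<Rightarrow> complex"
  assumes hol: "F holomorphic_on {z. 0 < Re z \<and> 0 < Im z}"
    and cont: "continuous_on {z. 0 \<le> Re z \<and> 0 \<le> Im z} F"
    and growth: "\<And>z. 0 \<le> Re z \<Longrightarrow> 0 \<le> Im z \<Longrightarrow> cmod (F z) \<le> A * exp (B * cmod z)"
    and re: "\<And>x. 0 \<le> x \<Longrightarrow> cmod (F (of_real x)) \<le> M"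
    and im: "\<And>y. 0 \<le> y \<Longrightarrow> cmod (F (\<i> * of_real y)) \<le> M"
    and z: "0 \<le> Re z" "0 \<le> Im z"
  shows "cmod (F z) \<le> M"
proof -
  define w where "w = (\<lambda>z. cis (- pi / 4) * z + 1)"
  define \<psi> where "\<psi> = (\<lambda>z. csqrt (w z) ^ 3)"
  have damp: "0 < Re (w z)" "cmod z \<le> cmod (w z)" "3 / 10 * cmod (w z) * sqrt (cmod (w z)) \<le> Re (\<psi> z)"
    if "0 \<le> Re z" "0 \<le> Im z" for z
    using quadrant_damping[OF that] by (auto simp: w_def \<psi>_def)
  have M0: "0 \<le> M" using order_trans[OF norm_ge_zero re[of 0]] by simp
  have main: "cmod (F z) * exp (- (\<epsilon> * Re (\<psi> z))) \<le> M + \<epsilon>" if \<epsilon>: "0 < \<epsilon>" for \<epsilon>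
  proof -
    define G where "G = (\<lambda>z. F z * exp (- (of_real \<epsilon> * \<psi> z)))"
    have nG: "cmod (G z) = cmod (F z) * exp (- (\<epsilon> * Re (\<psi> z)))" for z
      by (simp add: G_def norm_mult)
    have "((\<lambda>R. \<bar>A\<bar> * exp (B * R - \<epsilon> * (3 / 10 * R * sqrt R))) \<longlongrightarrow> 0) at_top"
      using \<epsilon> by real_asymp
    then have "\<forall>\<^sub>F R in at_top. \<bar>A\<bar> * exp (B * R - \<epsilon> * (3 / 10 * R * sqrt R)) < \<epsilon>"
      using \<epsilon> by (rule order_tendstoD(2))
    then have "\<forall>\<^sub>F R in at_top. \<bar>A\<bar> * exp (B * R - \<epsilon> * (3 / 10 * R * sqrt R)) < \<epsilon> \<and> cmod z < R"
      using eventually_gt_at_top by (rule eventually_conj)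
    from eventually_happens'[OF trivial_limit_at_top_linorder this]
    obtain R where R: "\<bar>A\<bar> * exp (B * R - \<epsilon> * (3 / 10 * R * sqrt R)) < \<epsilon>" "cmod z < R"
      by blast
    then have "0 < R" using norm_ge_zero le_less_trans by blast
    note R = R this
    define Q where "Q = {z. 0 \<le> Re z \<and> 0 \<le> Im z} \<inter> cball 0 R"
    have Q_closed: "closed Q" unfolding Q_def
      by (intro closed_Int closed_Collect_conj closed_Collect_le continuous_intros) auto
    have int: "interior Q \<subseteq> {z. 0 < Re z \<and> 0 < Im z}"
    proof
      fix u assume "u \<in> interior Q"
      then obtain e where e: "0 < e" "cball u e \<subseteq> Q" by (auto simp: mem_interior_cball)
      have "u - of_real e \<in> cball u e" "u - \<i> * of_real e \<in> cball u e"
        using e by (auto simp: dist_norm norm_mult)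
      then have "u - of_real e \<in> Q" "u - \<i> * of_real e \<in> Q" using e by auto
      then show "u \<in> {z. 0 < Re z \<and> 0 < Im z}" using e(1) by (auto simp: Q_def)
    qed
    have w_slit: "w z \<notin> \<real>\<^sub>\<le>\<^sub>0" if "0 \<le> Re z" "0 \<le> Im z" for z
      using damp(1)[OF that] by (auto simp: complex_nonpos_Reals_iff)
    have "cmod (G z) \<le> M + \<epsilon>"
    proof (rule maximum_modulus_frontier[of G Q])
      show "G holomorphic_on interior Q"
        unfolding G_def \<psi>_def w_def using int
        by (intro holomorphic_intros holomorphic_on_subset[OF hol]) (use w_slit in \<open>auto simp: w_def dest!: subsetD\<close>)
      show "continuous_on (closure Q) G"
        unfolding G_def \<psi>_def closure_closed[OF Q_closed]
      proof (intro continuous_intros continuous_on_subset[OF cont])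
        show "continuous_on Q (\<lambda>z. csqrt (w z))"
          using w_slit by (intro continuous_at_imp_continuous_on ballI isCont_csqrt')
            (auto simp: Q_def w_def)
      qed (auto simp: Q_def)
      show "bounded Q" unfolding Q_def by (intro bounded_Int) auto
      show "z \<in> Q" using z R by (auto simp: Q_def)
      fix u assume u: "u \<in> frontier Q"
      then have uQ: "u \<in> Q" using Q_closed by (simp add: frontier_def)
      then have u0: "0 \<le> Re u" "0 \<le> Im u" by (auto simp: Q_def)
      have e1: "cmod (G u) \<le> cmod (F u)"
      proof -
        have "0 \<le> \<epsilon> * Re (\<psi> u)"
          using damp(3)[OF u0] \<epsilon> by (intro mult_nonneg_nonneg order_trans[OF _ damp(3)[OF u0]]) auto
        then show ?thesis unfolding nG by (intro mult_left_le) auto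
      qed
      have "u \<notin> {z. 0 < Re z \<and> 0 < Im z} \<inter> ball 0 R"
      proof
        assume "u \<in> {z. 0 < Re z \<and> 0 < Im z} \<inter> ball 0 R"
        moreover have "open ({z. 0 < Re z \<and> 0 < Im z} \<inter> ball 0 R)"
          by (intro open_Int open_Collect_conj open_Collect_less continuous_intros) auto
        ultimately have "u \<in> interior Q" by (intro interiorI) (auto simp: Q_def)
        then show False using u by (simp add: frontier_def)
      qed
      then consider "Re u = 0" | "Im u = 0" | "cmod u = R" using uQ u0 by (force simp: Q_def)
      then show "cmod (G u) \<le> M + \<epsilon>"
      proof cases
        case 1
        then have "u = \<i> * of_real (Im u)" by (simp add: complex_eq_iff)
        then show ?thesis using e1 im[OF u0(2)] \<epsilon> by simp
      next
        case 2
        then have "u = of_real (Re u)" by (simp add: complex_eq_iff)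
        then show ?thesis using e1 re[OF u0(1)] \<epsilon> by simp
      next
        case 3
        have "3 / 10 * R * sqrt R \<le> 3 / 10 * cmod (w u) * sqrt (cmod (w u))"
          using damp(2)[OF u0] 3 R by (intro mult_mono) auto
        also have "\<dots> \<le> Re (\<psi> u)" by (rule damp(3)[OF u0])
        finally have "- (\<epsilon> * Re (\<psi> u)) \<le> - (\<epsilon> * (3 / 10 * R * sqrt R))"
          using \<epsilon> by (intro le_imp_neg_le mult_left_mono) linarith+
        then have e2: "exp (- (\<epsilon> * Re (\<psi> u))) \<le> exp (- (\<epsilon> * (3 / 10 * R * sqrt R)))"
          by (rule exp_le_cancel_iff[THEN iffD2])
        have "A * exp (B * R) \<le> \<bar>A\<bar> * exp (B * R)" by (intro mult_right_mono) auto
        then have e3: "cmod (F u) \<le> \<bar>A\<bar> * exp (B * R)" using growth[OF u0, unfolded 3] by linarith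
        have "cmod (G u) \<le> (\<bar>A\<bar> * exp (B * R)) * exp (- (\<epsilon> * (3 / 10 * R * sqrt R)))"
          unfolding nG by (rule mult_mono[OF e3 e2]) simp_all
        also have "\<dots> = \<bar>A\<bar> * exp (B * R - \<epsilon> * (3 / 10 * R * sqrt R))"
          unfolding mult.assoc exp_add[symmetric] by (simp only: diff_conv_add_uminus)
        finally show ?thesis using R M0 by linarith
      qed
    qed
    then show ?thesis by (simp add: nG)
  qed
  have l1: "((\<lambda>\<epsilon>. cmod (F z) * exp (- (\<epsilon> * Re (\<psi> z)))) \<longlongrightarrow> cmod (F z) * exp (- (0 * Re (\<psi> z)))) (at_right 0)"
    by (intro tendsto_intros)
  have l2: "((\<lambda>\<epsilon>. M + \<epsilon>) \<longlongrightarrow> M + 0) (at_right 0)" by (intro tendsto_intros)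
  have ev: "\<forall>\<^sub>F \<epsilon> in at_right 0. cmod (F z) * exp (- (\<epsilon> * Re (\<psi> z))) \<le> M + \<epsilon>"
    using eventually_at_right_less by (rule eventually_mono) (rule main)
  show ?thesis using tendsto_le[OF _ l2 l1 ev] by simp
qed

section \<open>The Poisson inequality\<close>

lemma contour_integral_horizontal:
  assumes "l < r"
  shows "contour_integral (linepath (Complex l h) (Complex r h)) f = integral {l..r} (\<lambda>u. f (Complex u h))"
proof -
  have "linepath (Complex l h) (Complex r h) = (+) (Complex 0 h) \<circ> linepath (of_real l) (of_real r)"
    by (rule ext) (simp add: linepath_def complex_eq_iff algebra_simps)
  then have "contour_integral (linepath (Complex l h) (Complex r h)) f
      = contour_integral (linepath (of_real l) (of_real r)) (\<lambda>z. f (z + Complex 0 h))"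
    by (simp only: contour_integral_translate)
  also have "\<dots> = integral {l..r} (\<lambda>u. f (of_real u + Complex 0 h))"
    using assms by (subst contour_integral_linepath_Reals_eq) auto
  also have "(\<lambda>u. f (of_real u + Complex 0 h)) = (\<lambda>u. f (Complex u h))"
    by (intro ext arg_cong[where f = f]) (simp add: complex_eq_iff)
  finally show ?thesis .
qed

text \<open>For a contour that is widened to two horizontal lines: the vertical sides enter only through \<open>D\<close>, which
tends to 0.\<close>
lemma rectangle_contour_bound:
  fixes f :: "complex \<Rightarrow> complex"
  assumes lr: "l < r" and bt: "b < t"
    and cont: "continuous_on (path_image (rectpath (Complex l b) (Complex r t))) f"
    and left: "\<And>u. b \<le> u \<Longrightarrow> u \<le> t \<Longrightarrow> cmod (f (Complex l u)) \<le> D"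
    and right: "\<And>u. b \<le> u \<Longrightarrow> u \<le> t \<Longrightarrow> cmod (f (Complex r u)) \<le> D"
  shows "cmod (contour_integral (rectpath (Complex l b) (Complex r t)) f)
    \<le> integral {l..r} (\<lambda>u. cmod (f (Complex u b))) + integral {l..r} (\<lambda>u. cmod (f (Complex u t)))
      + 2 * D * (t - b)"
proof -
  let ?a1 = "Complex l b" and ?a2 = "Complex r b" and ?a3 = "Complex r t" and ?a4 = "Complex l t"
  have pi: "path_image (rectpath ?a1 ?a3)
      = closed_segment ?a1 ?a2 \<union> closed_segment ?a2 ?a3 \<union> closed_segment ?a3 ?a4 \<union> closed_segment ?a4 ?a1"
    by (simp add: rectpath_def Let_def path_image_join Un_assoc)
  have c: "continuous_on (closed_segment ?a1 ?a2) f" "continuous_on (closed_segment ?a2 ?a3) f"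
    "continuous_on (closed_segment ?a3 ?a4) f" "continuous_on (closed_segment ?a4 ?a1) f"
    using cont unfolding pi by (auto elim!: continuous_on_subset)
  then have ci: "f contour_integrable_on linepath ?a1 ?a2" "f contour_integrable_on linepath ?a2 ?a3"
    "f contour_integrable_on linepath ?a3 ?a4" "f contour_integrable_on linepath ?a4 ?a1"
    by (auto intro: contour_integrable_continuous_linepath)
  have split: "contour_integral (rectpath ?a1 ?a3) f = contour_integral (linepath ?a1 ?a2) f
    + contour_integral (linepath ?a2 ?a3) f + contour_integral (linepath ?a3 ?a4) f
    + contour_integral (linepath ?a4 ?a1) f"
    using ci by (simp add: rectpath_def Let_def)
  have D0: "0 \<le> D" using left[of b] bt norm_ge_zero order_trans by (metis less_imp_le order_refl)
  have vert: "cmod (contour_integral (linepath (Complex x u) (Complex x v)) f) \<le> D * (t - b)"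
    if "f contour_integrable_on linepath (Complex x u) (Complex x v)" "x = l \<or> x = r" "{u, v} = {b, t}" for x u v
  proof -
    have "cmod (contour_integral (linepath (Complex x u) (Complex x v)) f) \<le> D * cmod (Complex x v - Complex x u)"
    proof (rule contour_integral_bound_linepath[OF that(1) D0])
      fix w assume "w \<in> closed_segment (Complex x u) (Complex x v)"
      then have "Re w = x" "b \<le> Im w" "Im w \<le> t"
        using bt that(3) by (auto simp: closed_segment_same_Re closed_segment_eq_real_ivl doubleton_eq_iff)
      then show "cmod (f w) \<le> D" using left[of "Im w"] right[of "Im w"] that(2) by (metis complex_surj)
    qed
    also have "cmod (Complex x v - Complex x u) = t - b"
      using bt that(3) by (auto simp: cmod_def doubleton_eq_iff)
    finally show ?thesis .
  qed
  have hor: "cmod (contour_integral (linepath (Complex l h) (Complex r h)) f)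
      \<le> integral {l..r} (\<lambda>u. cmod (f (Complex u h)))"
    if "continuous_on (closed_segment (Complex l h) (Complex r h)) f" for h
  proof -
    have "continuous_on {l..r} (\<lambda>u. f (Complex u h))"
    proof (rule continuous_on_compose2[OF that])
      show "continuous_on {l..r} (\<lambda>u. Complex u h)" by (intro continuous_intros)
      show "(\<lambda>u. Complex u h) ` {l..r} \<subseteq> closed_segment (Complex l h) (Complex r h)"
        using lr by (auto simp: closed_segment_same_Im closed_segment_eq_real_ivl)
    qed
    then show ?thesis unfolding contour_integral_horizontal[OF lr]
      by (intro integral_norm_bound_integral integrable_continuous_interval continuous_intros) auto
  qed
  have r: "contour_integral (linepath ?a3 ?a4) f = - contour_integral (linepath ?a4 ?a3) f"
    using c(3) by (subst contour_integral_reverse_linepath) (auto simp: closed_segment_commute)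
  have "cmod (contour_integral (rectpath ?a1 ?a3) f) \<le> cmod (contour_integral (linepath ?a1 ?a2) f)
    + cmod (contour_integral (linepath ?a2 ?a3) f) + cmod (contour_integral (linepath ?a3 ?a4) f)
    + cmod (contour_integral (linepath ?a4 ?a1) f)"
    unfolding split by (intro norm_triangle_le add_mono order_refl)
  also have "\<dots> \<le> integral {l..r} (\<lambda>u. cmod (f (Complex u b))) + D * (t - b)
      + integral {l..r} (\<lambda>u. cmod (f (Complex u t))) + D * (t - b)"
    using hor[OF c(1)] hor[of t] c(3) vert[OF ci(2)] vert[OF ci(4)] unfolding r
    by (intro add_mono) (auto simp: closed_segment_commute)
  finally show ?thesis by (simp add: algebra_simps)
qed

definition poisson_kernel :: "real \<Rightarrow> real \<Rightarrow> real" where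
  "poisson_kernel y u = y / (pi * (u\<^sup>2 + y\<^sup>2))"

definition poisson_mean :: "real \<Rightarrow> (real \<Rightarrow> real) \<Rightarrow> real \<Rightarrow> real" where
  "poisson_mean y f x = (LINT u|lborel. poisson_kernel y (u - x) * f u)"

lemma poisson_kernel_borel [measurable]: "poisson_kernel y \<in> borel_measurable borel"
  unfolding poisson_kernel_def by measurable

lemma poisson_kernel_nonneg: "0 < y \<Longrightarrow> 0 \<le> poisson_kernel y u"
  unfolding poisson_kernel_def by (intro divide_nonneg_nonneg mult_nonneg_nonneg) auto

lemma poisson_kernel_integral:
  assumes y: "0 < y"
  shows "integrable lborel (\<lambda>u. poisson_kernel y (u - x))" "(LINT u|lborel. poisson_kernel y (u - x)) = 1"
proof -
  have i: "has_bochner_integral lborel (\<lambda>u::real. inverse (1 + u\<^sup>2)) pi"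
    using integrable_inverse_1_plus_square LBINT_inverse_1_plus_square
    by (simp add: has_bochner_integral_iff set_integrable_def interval_lebesgue_integral_def
        set_lebesgue_integral_def)
  have "has_bochner_integral lborel (\<lambda>u. inverse (1 + (- x / y + 1 / y * u)\<^sup>2)) (pi /\<^sub>R \<bar>1 / y\<bar>)"
    using y by (intro lborel_has_bochner_integral_real_affine_iff[THEN iffD1, OF _ i]) auto
  from has_bochner_integral_mult_right[OF this, of "1 / (pi * y)"]
  have "has_bochner_integral lborel (\<lambda>u. 1 / (pi * y) * inverse (1 + (- x / y + 1 / y * u)\<^sup>2)) 1"
    using y by simp
  also have "(\<lambda>u. 1 / (pi * y) * inverse (1 + (- x / y + 1 / y * u)\<^sup>2)) = (\<lambda>u. poisson_kernel y (u - x))"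
  proof
    fix u
    have "1 + (- x / y + 1 / y * u)\<^sup>2 = ((u - x)\<^sup>2 + y\<^sup>2) / y\<^sup>2"
      using y by (simp add: field_simps power2_eq_square)
    then show "1 / (pi * y) * inverse (1 + (- x / y + 1 / y * u)\<^sup>2) = poisson_kernel y (u - x)"
      using y by (simp add: poisson_kernel_def power2_eq_square)
  qed
  finally show "integrable lborel (\<lambda>u. poisson_kernel y (u - x))"
    "(LINT u|lborel. poisson_kernel y (u - x)) = 1"
    by (auto simp: has_bochner_integral_iff)
qed

lemma poisson_integrable:
  assumes y: "0 < y" and [measurable]: "f \<in> borel_measurable borel" and b: "\<And>u. \<bar>f u\<bar> \<le> M"
  shows "integrable lborel (\<lambda>u. poisson_kernel y (u - x) * f u)"
proof (rule Bochner_Integration.integrable_bound)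
  show "integrable lborel (\<lambda>u. M * poisson_kernel y (u - x))"
    using poisson_kernel_integral(1)[OF y] by simp
  show "AE u in lborel. norm (poisson_kernel y (u - x) * f u) \<le> norm (M * poisson_kernel y (u - x))"
  proof (intro AE_I2)
    fix u
    have "\<bar>f u\<bar> \<le> \<bar>M\<bar>" using b[of u] by linarith
    then show "norm (poisson_kernel y (u - x) * f u) \<le> norm (M * poisson_kernel y (u - x))"
      unfolding real_norm_def abs_mult
      by (subst mult.commute) (rule mult_right_mono, auto)
  qed
qed measurable

text \<open>Cauchy's formula for the kernel \<open>1 / (w - z) - 1 / (w - cnj z)\<close>, whose second term is holomorphic in the
half-plane. On the real axis its modulus is \<open>2 * pi\<close> times the Poisson kernel. It decays quadratically, so
that the other sides of a rectangle of size \<open>N\<close> contribute \<open>O(1 / N)\<close>. The assumption allows a pole of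
\<open>G\<close> at \<open>- \<i>\<close>, as for the quotient by \<open>z + \<i>\<close> below.\<close>
lemma poisson_inequality:
  assumes hol: "G holomorphic_on {z. - 1 < Im z}"
    and bound: "\<And>z. 0 \<le> Im z \<Longrightarrow> cmod (G z) \<le> M"
    and y: "0 < y"
  shows "cmod (G (Complex x y)) \<le> poisson_mean y (\<lambda>u. cmod (G (of_real u))) x"
proof -
  define z where "z = Complex x y"
  \<comment> \<open>\<open>\<Phi> w / (w - z)\<close> is \<open>G w\<close> times the kernel above, and \<open>\<Phi> z = G z\<close>.\<close>
  define \<Phi> where "\<Phi> = (\<lambda>w. G w * (2 * \<i> * y) / (w - cnj z))"
  define S where "S = {w. - min 1 y < Im w}"
  define P where "P = poisson_mean y (\<lambda>u. cmod (G (of_real u))) x"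
  have S_eq: "S = {w. inner \<i> w > - min 1 y}" by (auto simp: S_def inner_complex_def)
  have convS: "convex S" unfolding S_eq by (rule convex_halfspace_gt)
  have openS: "open S" unfolding S_eq by (rule open_halfspace_gt)
  have ne: "w \<noteq> cnj z" if "w \<in> S" for w using that by (auto simp: S_def z_def)
  have hol\<Phi>: "\<Phi> holomorphic_on S"
    unfolding \<Phi>_def using ne
    by (intro holomorphic_intros holomorphic_on_subset[OF hol]) (auto simp: S_def)
  have zS: "z \<in> S" using y by (auto simp: S_def z_def)
  have \<Phi>z: "\<Phi> z = G z" using y
    by (simp add: \<Phi>_def complex_diff_cnj) (simp add: z_def)
  have M0: "0 \<le> M" using order_trans[OF norm_ge_zero bound[of 0]] by simp
  have contG: "continuous_on {z. -1 < Im z} G" using hol by (rule holomorphic_on_imp_continuous_on)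
  have "continuous_on UNIV (\<lambda>u::real. G (of_real u))"
    by (rule continuous_on_compose2[OF contG]) (auto intro!: continuous_intros)
  then have contn: "continuous_on UNIV (\<lambda>u::real. cmod (G (of_real u)))" by (intro continuous_intros)
  have meas: "(\<lambda>u::real. cmod (G (of_real u))) \<in> borel_measurable borel"
    using contn by (rule borel_measurable_continuous_onI)
  have pint: "integrable lborel (\<lambda>u. poisson_kernel y (u - x) * cmod (G (of_real u)))"
    using bound by (intro poisson_integrable[OF y meas, of M]) auto
  have main: "2 * pi * cmod (G z) \<le> 2 * pi * P + 32 * M * y / N" if N: "2 * \<bar>x\<bar> < N" "2 * y < N" for N
  proof -
    have N0: "0 < N" using N y by linarith
    define R where "R = rectpath (Complex (- N) 0) (Complex N N)"
    have zbox: "z \<in> box (Complex (- N) 0) (Complex N N)"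
      using N y by (auto simp: in_box_complex_iff z_def)
    have pimg: "path_image R \<subseteq> {w. 0 \<le> Im w} - {z}"
      using zbox N0 unfolding R_def
      by (subst path_image_rectpath_cbox_minus_box) (auto simp: in_cbox_complex_iff)
    then have pimgS: "path_image R \<subseteq> S - {z}" using y by (auto simp: S_def)
    have "((\<lambda>w. \<Phi> w / (w - z)) has_contour_integral (2 * pi * \<i> * winding_number R z * \<Phi> z)) R"
      using convS hol\<Phi> zS openS pimgS
      by (intro Cauchy_integral_formula_convex_simple) (auto simp: R_def interior_open)
    moreover have "winding_number R z = 1" unfolding R_def by (rule winding_number_rectpath[OF zbox])
    ultimately have I: "contour_integral R (\<lambda>w. \<Phi> w / (w - z)) = 2 * pi * \<i> * G z"
      by (simp add: contour_integral_unique \<Phi>z)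
    have cont: "continuous_on (S - {z}) (\<lambda>w. \<Phi> w / (w - z))"
      by (intro continuous_intros continuous_on_subset[OF holomorphic_on_imp_continuous_on[OF hol\<Phi>]]) auto
    have est: "cmod (\<Phi> w / (w - z)) \<le> 8 * M * y / N\<^sup>2"
      if w: "0 \<le> Im w" "\<bar>Re w\<bar> = N \<or> Im w = N" for w
    proof -
      have d: "N / 2 \<le> cmod (w - z)" "N / 2 \<le> cmod (w - cnj z)"
        using w(2) N y abs_Re_le_cmod[of "w - z"] abs_Im_le_cmod[of "w - z"]
          abs_Re_le_cmod[of "w - cnj z"] abs_Im_le_cmod[of "w - cnj z"]
        by (auto simp: z_def)
      have "cmod (\<Phi> w / (w - z)) = cmod (G w) * (2 * y) / (cmod (w - cnj z) * cmod (w - z))"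
        using y by (simp add: \<Phi>_def norm_mult norm_divide)
      also have "\<dots> \<le> M * (2 * y) / ((N / 2) * (N / 2))"
        using bound[OF w(1)] d N0 y M0 by (intro frac_le mult_right_mono mult_mono mult_nonneg_nonneg) auto
      also have "\<dots> = 8 * M * y / N\<^sup>2" using N0 by (simp add: power2_eq_square)
      finally show ?thesis .
    qed
    have "2 * pi * cmod (G z) = cmod (contour_integral R (\<lambda>w. \<Phi> w / (w - z)))"
      by (simp add: I norm_mult)
    also have "\<dots> \<le> integral {- N..N} (\<lambda>u. cmod (\<Phi> (Complex u 0) / (Complex u 0 - z)))
        + integral {- N..N} (\<lambda>u. cmod (\<Phi> (Complex u N) / (Complex u N - z)))
        + 2 * (8 * M * y / N\<^sup>2) * (N - 0)"
      unfolding R_def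
    proof (rule rectangle_contour_bound)
      show "continuous_on (path_image (rectpath (Complex (- N) 0) (Complex N N))) (\<lambda>w. \<Phi> w / (w - z))"
        using cont pimgS unfolding R_def by (rule continuous_on_subset)
    qed (use N0 in \<open>auto intro!: est\<close>)
    also have "integral {- N..N} (\<lambda>u. cmod (\<Phi> (Complex u N) / (Complex u N - z)))
        \<le> integral {-N..N} (\<lambda>u. 8 * M * y / N\<^sup>2)"
    proof (rule integral_le)
      show "(\<lambda>u. cmod (\<Phi> (Complex u N) / (Complex u N - z))) integrable_on {- N..N}"
        using N y
        by (intro integrable_continuous_interval continuous_on_norm continuous_on_compose2[OF cont]
            continuous_intros) (auto simp: S_def z_def complex_eq_iff)
    qed (use N0 in \<open>auto intro!: est\<close>)
    also have "integral {- N..N} (\<lambda>u. cmod (\<Phi> (Complex u 0) / (Complex u 0 - z))) \<le> 2 * pi * P"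
    proof -
      let ?k = "\<lambda>u. 2 * pi * (poisson_kernel y (u - x) * cmod (G (of_real u)))"
      have eq: "cmod (\<Phi> (Complex u 0) / (Complex u 0 - z))
          = 2 * pi * (poisson_kernel y (u - x) * cmod (G (of_real u)))" for u
      proof -
        have "cmod (Complex u 0 - cnj z) = sqrt ((u - x)\<^sup>2 + y\<^sup>2)"
          "cmod (Complex u 0 - z) = sqrt ((u - x)\<^sup>2 + y\<^sup>2)"
          by (simp_all add: z_def cmod_def)
        moreover have "sqrt ((u - x)\<^sup>2 + y\<^sup>2) * sqrt ((u - x)\<^sup>2 + y\<^sup>2) = (u - x)\<^sup>2 + y\<^sup>2"
          by simp
        moreover have "Complex u 0 = of_real u" by (simp add: complex_eq_iff)
        ultimately show ?thesis
          using y by (simp add: \<Phi>_def norm_mult norm_divide poisson_kernel_def mult.commute)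
      qed
      have i: "integrable lborel ?k"
        using pint by simp
      have "integral {- N..N} ?k
          \<le> integral UNIV ?k"
      proof (rule integral_subset_le)
        show u: "?k integrable_on UNIV"
          by (rule integrable_on_lborel[OF i])
        show "?k integrable_on {- N..N}"
          by (rule integrable_on_subinterval[OF u]) simp
      qed (use poisson_kernel_nonneg[OF y] in auto)
      also have "\<dots> = 2 * pi * P"
        by (subst integral_lborel[OF i]) (simp add: P_def poisson_mean_def)
      finally show ?thesis unfolding eq .
    qed
    finally show ?thesis using N0 by (simp add: field_simps power2_eq_square)
  qed
  have "((\<lambda>N. 2 * pi * P + 32 * M * y / N) \<longlongrightarrow> 2 * pi * P + 0) at_top"
    by (intro tendsto_intros real_tendsto_divide_at_top[OF tendsto_const] filterlim_ident)
  moreover have "\<forall>\<^sub>F N in at_top. 2 * pi * cmod (G z) \<le> 2 * pi * P + 32 * M * y / N"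
    using eventually_gt_at_top[of "max (2 * \<bar>x\<bar>) (2 * y)"] by eventually_elim (auto intro: main)
  ultimately have "2 * pi * cmod (G z) \<le> 2 * pi * P + 0"
    by (intro tendsto_lowerbound[of _ _ at_top]) auto
  then show ?thesis by (simp add: P_def z_def)
qed

section \<open>Entire functions of exponential type\<close>

text \<open>Together with the next lemma, this replaces the limit superior by explicit growth bounds. Small \<open>\<bar>z\<bar>\<close>
are covered by compactness.\<close>
lemma exp_type_imp_bound:
  assumes "exp_type \<sigma> f" "0 \<le> \<sigma>" "0 < \<epsilon>"
  shows "\<exists>C. \<forall>z. cmod (f z) \<le> C * exp ((\<sigma> + \<epsilon>) * cmod z)"
proof -
  have hol: "f holomorphic_on UNIV"
    and lim: "Limsup at_top (\<lambda>\<rho>::real. ereal (ln (SUP z\<in>sphere 0 \<rho>. norm (f z)) / \<rho>)) \<le> ereal \<sigma>"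
    using assms by (auto simp: exp_type_def)
  have cont: "continuous_on S (\<lambda>z. cmod (f z))" for S
    using hol by (intro continuous_on_norm holomorphic_on_imp_continuous_on) (rule holomorphic_on_subset, auto)
  have bdd: "bdd_above ((\<lambda>z. cmod (f z)) ` T)" if "compact T" for T
    using compact_continuous_image[OF cont that] by (intro bounded_imp_bdd_above compact_imp_bounded)
  have "Limsup at_top (\<lambda>\<rho>::real. ereal (ln (SUP z\<in>sphere 0 \<rho>. norm (f z)) / \<rho>)) < ereal (\<sigma> + \<epsilon>)"
    using lim assms by (simp add: le_less_trans)
  then have "\<forall>\<^sub>F \<rho> in at_top. ereal (ln (SUP z\<in>sphere 0 \<rho>. norm (f z)) / \<rho>) < ereal (\<sigma> + \<epsilon>)"
    by (rule Limsup_lessD)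
  then obtain R where R: "\<And>\<rho>. R \<le> \<rho> \<Longrightarrow> ln (SUP z\<in>sphere 0 \<rho>. norm (f z)) / \<rho> < \<sigma> + \<epsilon>"
    by (auto simp: eventually_at_top_linorder)
  define R' where "R' = max R 1"
  obtain K where K: "\<And>z. z \<in> cball 0 R' \<Longrightarrow> cmod (f z) \<le> K"
    using bdd[OF compact_cball[of 0 R']] by (fastforce simp: bdd_above_def)
  have "cmod (f z) \<le> max 1 K * exp ((\<sigma> + \<epsilon>) * cmod z)" for z
  proof (cases "cmod z \<le> R'")
    case True
    then have "cmod (f z) \<le> max 1 K * 1" using K[of z] by simp
    also have "\<dots> \<le> max 1 K * exp ((\<sigma> + \<epsilon>) * cmod z)"
      using assms by (intro mult_left_mono) auto
    finally show ?thesis .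
  next
    case False
    define s where "s = (SUP w\<in>sphere 0 (cmod z). norm (f w))"
    have z: "R \<le> cmod z" "0 < cmod z" using False by (auto simp: R'_def)
    have le: "cmod (f z) \<le> s" unfolding s_def by (intro cSUP_upper bdd) auto
    have "s \<le> exp ((\<sigma> + \<epsilon>) * cmod z)"
    proof (cases "0 < s")
      case True
      have "ln s < (\<sigma> + \<epsilon>) * cmod z" using R[OF z(1)] z by (simp add: s_def divide_less_eq)
      then show ?thesis using True by (metis exp_ln exp_le_cancel_iff less_imp_le)
    qed (auto intro: order_trans[OF _ exp_ge_zero])
    also have "\<dots> \<le> max 1 K * exp ((\<sigma> + \<epsilon>) * cmod z)"
      by (simp add: mult_le_cancel_right1)
    finally show ?thesis using le by linarith
  qed
  then show ?thesis by blast
qed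

lemma exp_typeI:
  assumes hol: "f holomorphic_on UNIV" and "0 \<le> \<sigma>"
    and bound: "\<And>\<epsilon>. 0 < \<epsilon> \<Longrightarrow> \<exists>C. \<forall>z. cmod (f z) \<le> C * exp ((\<sigma> + \<epsilon>) * cmod z)"
  shows "exp_type \<sigma> f"
  unfolding exp_type_def
proof (rule conjI[OF hol], rule ereal_le_epsilon2)
  fix e :: real assume e: "0 < e"
  obtain C where C: "\<And>z. cmod (f z) \<le> C * exp ((\<sigma> + e / 2) * cmod z)"
    using bound[of "e / 2"] e by auto
  define C' where "C' = max 1 C"
  have C': "1 \<le> C'" "cmod (f z) \<le> C' * exp ((\<sigma> + e / 2) * cmod z)" for z
    using order_trans[OF C mult_right_mono[of C C']] by (auto simp: C'_def)
  have "((\<lambda>\<rho>. ln C' / \<rho>) \<longlongrightarrow> 0) at_top"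
    by (intro real_tendsto_divide_at_top[OF tendsto_const] filterlim_ident)
  then have "\<forall>\<^sub>F \<rho> in at_top. ln C' / \<rho> < e / 2" using e by (intro order_tendstoD(2)) auto
  then have "\<forall>\<^sub>F \<rho> in at_top. ereal (ln (SUP z\<in>sphere 0 \<rho>. norm (f z)) / \<rho>) \<le> ereal (\<sigma> + e)"
    using eventually_gt_at_top[of 0]
  proof eventually_elim
    case (elim \<rho>)
    define s where "s = (SUP z\<in>sphere 0 \<rho>. norm (f z))"
    have "of_real \<rho> \<in> sphere (0::complex) \<rho>" using elim by simp
    then have le: "s \<le> C' * exp ((\<sigma> + e / 2) * \<rho>)"
      unfolding s_def using C' by (intro cSUP_least) (blast, use C'(2) in force)
    have "ln s \<le> ln C' + (\<sigma> + e / 2) * \<rho>"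
    proof (cases "0 < s")
      case True
      have "ln s \<le> ln (C' * exp ((\<sigma> + e / 2) * \<rho>))" using le True by (intro ln_mono) auto
      also have "\<dots> = ln C' + (\<sigma> + e / 2) * \<rho>" using C' by (subst ln_mult) auto
      finally show ?thesis .
    next
      case False
      have "0 \<le> s" unfolding s_def
      proof -
        have "bdd_above ((\<lambda>z. cmod (f z)) ` sphere 0 \<rho>)"
          using C' by (intro bdd_aboveI2[of _ _ "C' * exp ((\<sigma> + e / 2) * \<rho>)"]) (use C'(2) in force)
        then have "cmod (f (of_real \<rho>)) \<le> (SUP z\<in>sphere 0 \<rho>. cmod (f z))"
          using \<open>of_real \<rho> \<in> sphere (0::complex) \<rho>\<close> by (intro cSUP_upper)
        then show "0 \<le> (SUP z\<in>sphere 0 \<rho>. cmod (f z))" by (rule order_trans[OF norm_ge_zero])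
      qed
      then have "ln s = 0" using False by simp
      then show ?thesis using C' elim e assms(2) by simp
    qed
    then have "ln s / \<rho> \<le> ln C' / \<rho> + (\<sigma> + e / 2)" using elim by (simp add: field_simps)
    then have "ln s / \<rho> \<le> \<sigma> + e" using elim(1) by linarith
    then show ?case by (simp add: s_def)
  qed
  then have "Limsup at_top (\<lambda>\<rho>::real. ereal (ln (SUP z\<in>sphere 0 \<rho>. norm (f z)) / \<rho>)) \<le> ereal (\<sigma> + e)"
    by (rule Limsup_bounded)
  then show "Limsup at_top (\<lambda>\<rho>::real. ereal (ln (SUP z\<in>sphere 0 \<rho>. norm (f z)) / \<rho>)) \<le> ereal \<sigma> + ereal e"
    by simp
qed

lemma exp_type_mono:
  assumes "exp_type \<sigma> f" "\<sigma> \<le> \<tau>" shows "exp_type \<tau> f"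
  using assms order_trans[of _ "ereal \<sigma>" "ereal \<tau>"] by (auto simp: exp_type_def)

lemma exp_type_diff:
  assumes "exp_type \<sigma> f" "exp_type \<sigma> g" "0 \<le> \<sigma>" shows "exp_type \<sigma> (\<lambda>z. f z - g z)"
proof (rule exp_typeI)
  show "(\<lambda>z. f z - g z) holomorphic_on UNIV"
    using assms by (intro holomorphic_intros) (auto simp: exp_type_def)
  fix \<epsilon> :: real assume e: "0 < \<epsilon>"
  obtain C D where C: "\<And>z. cmod (f z) \<le> C * exp ((\<sigma> + \<epsilon>) * cmod z)"
    and D: "\<And>z. cmod (g z) \<le> D * exp ((\<sigma> + \<epsilon>) * cmod z)"
    using exp_type_imp_bound[OF assms(1,3) e] exp_type_imp_bound[OF assms(2,3) e] by auto
  have "cmod (f z - g z) \<le> (C + D) * exp ((\<sigma> + \<epsilon>) * cmod z)" for z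
    using norm_triangle_ineq4[of "f z" "g z"] C[of z] D[of z] by (simp add: distrib_right)
  then show "\<exists>C. \<forall>z. cmod (f z - g z) \<le> C * exp ((\<sigma> + \<epsilon>) * cmod z)" by blast
qed fact

lemma poisson_mean_bounded:
  assumes y: "0 < y" and m: "f \<in> borel_measurable borel" and b: "\<And>u. \<bar>f u\<bar> \<le> M"
  shows "poisson_mean y f x \<le> M"
proof -
  have "poisson_mean y f x \<le> (LINT u|lborel. poisson_kernel y (u - x) * M)"
    unfolding poisson_mean_def
  proof (rule integral_mono[OF poisson_integrable[OF y m b]])
    show "integrable lborel (\<lambda>u. poisson_kernel y (u - x) * M)"
      using poisson_kernel_integral(1)[OF y] by simp
    show "poisson_kernel y (u - x) * f u \<le> poisson_kernel y (u - x) * M" for u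
      using b[of u] poisson_kernel_nonneg[OF y] by (intro mult_left_mono) auto
  qed
  then show ?thesis using poisson_kernel_integral[OF y] by simp
qed

lemma exp_mult_le_imp_le:
  fixes a b d :: real
  assumes "exp (- a) * b \<le> d" shows "b \<le> exp a * d"
proof -
  have "b = exp a * (exp (- a) * b)" by (simp add: mult.assoc[symmetric] exp_add[symmetric])
  also have "\<dots> \<le> exp a * d" using assms by (intro mult_left_mono) auto
  finally show ?thesis .
qed

text \<open>The two quadrants give boundedness by \<open>max K M\<close>. The Poisson inequality then improves this to the
bound \<open>K\<close> on the real axis alone, which does not see the growth constants.\<close>
lemma Phragmen_Lindeloef_half_plane:
  assumes hol: "G holomorphic_on {z. - 1 < Im z}"
    and growth: "\<And>z. 0 \<le> Im z \<Longrightarrow> cmod (G z) \<le> A * exp (B * cmod z)"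
    and re: "\<And>x::real. cmod (G (of_real x)) \<le> K"
    and im: "\<And>y::real. 0 \<le> y \<Longrightarrow> cmod (G (\<i> * of_real y)) \<le> M"
    and z: "0 \<le> Im z"
  shows "cmod (G z) \<le> K"
proof -
  have cont: "continuous_on {z. - 1 < Im z} G" using hol by (rule holomorphic_on_imp_continuous_on)
  have bounded: "cmod (G z) \<le> max K M" if "0 \<le> Im z" for z
  proof (cases "0 \<le> Re z")
    case True
    show ?thesis
    proof (rule Phragmen_Lindeloef_quadrant[OF _ _ growth _ _ True that])
      show "G holomorphic_on {z. 0 < Re z \<and> 0 < Im z}" by (rule holomorphic_on_subset[OF hol]) auto
      show "continuous_on {z. 0 \<le> Re z \<and> 0 \<le> Im z} G" by (rule continuous_on_subset[OF cont]) auto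
      show "cmod (G (of_real x)) \<le> max K M" for x using re[of x] by simp
      show "cmod (G (\<i> * of_real y)) \<le> max K M" if "0 \<le> y" for y using im[OF that] by simp
    qed
  next
    case False
    have "cmod (G (\<i> * (- \<i> * z))) \<le> max K M"
    proof (rule Phragmen_Lindeloef_quadrant[where F = "\<lambda>z. G (\<i> * z)" and A = A and B = B])
      show "(\<lambda>z. G (\<i> * z)) holomorphic_on {z. 0 < Re z \<and> 0 < Im z}"
        by (rule holomorphic_on_compose_gen[OF _ hol, unfolded o_def]) (auto intro!: holomorphic_intros)
      show "continuous_on {z. 0 \<le> Re z \<and> 0 \<le> Im z} (\<lambda>z. G (\<i> * z))"
        by (rule continuous_on_compose2[OF cont]) (auto intro!: continuous_intros)
      show "cmod (G (\<i> * z)) \<le> A * exp (B * cmod z)" if "0 \<le> Re z" "0 \<le> Im z" for z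
        using growth[of "\<i> * z"] that by (simp add: norm_mult)
      show "cmod (G (\<i> * of_real x)) \<le> max K M" if "0 \<le> x" for x using im[OF that] by simp
      show "cmod (G (\<i> * (\<i> * of_real y))) \<le> max K M" for y
        using re[of "- y"] by (simp add: mult.assoc[symmetric])
    qed (use False that in auto)
    then show ?thesis by (simp add: mult.assoc[symmetric])
  qed
  show ?thesis
  proof (cases "Im z = 0")
    case True
    then have "z = of_real (Re z)" by (simp add: complex_eq_iff)
    then show ?thesis using re[of "Re z"] by simp
  next
    case False
    then have y: "0 < Im z" using z by simp
    have "continuous_on UNIV (\<lambda>u::real. G (of_real u))"
      by (rule continuous_on_compose2[OF cont]) (auto intro!: continuous_intros)
    then have "(\<lambda>u::real. cmod (G (of_real u))) \<in> borel_measurable borel"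
      by (intro borel_measurable_continuous_onI continuous_intros)
    then have "poisson_mean (Im z) (\<lambda>u. cmod (G (of_real u))) (Re z) \<le> K"
      using re by (intro poisson_mean_bounded[OF y]) auto
    with poisson_inequality[OF hol bounded y, of "Re z"] show ?thesis by simp
  qed
qed

text \<open>Applies the half-plane principle to \<open>exp (\<i> * B * z) * F z / (z + \<i>)\<close>: the exponential absorbs the
growth on the imaginary axis and the denominator absorbs the linear growth on the real axis.\<close>
lemma half_plane_linear_growth:
  assumes hol: "F holomorphic_on UNIV"
    and growth: "\<And>z. cmod (F z) \<le> A * exp (B * cmod z)" and B: "0 \<le> B"
    and re: "\<And>x::real. cmod (F (of_real x)) \<le> K * (1 + \<bar>x\<bar>)"
    and z: "0 \<le> Im z"
  shows "cmod (F z) \<le> 2 * K * exp (B * Im z) * cmod (z + \<i>)"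
proof -
  define G where "G = (\<lambda>z. exp (\<i> * of_real B * z) * F z / (z + \<i>))"
  have nG: "cmod (G z) = exp (- (B * Im z)) * cmod (F z) / cmod (z + \<i>)" for z
    by (simp add: G_def norm_mult norm_divide)
  have A0: "0 \<le> A" using order_trans[OF norm_ge_zero growth[of 0]] by simp
  have K0: "0 \<le> K" using order_trans[OF norm_ge_zero re[of 0]] by simp
  have i1: "1 \<le> cmod (z + \<i>)" if "0 \<le> Im z" for z
    using abs_Im_le_cmod[of "z + \<i>"] that by simp
  have "cmod (G z) \<le> 2 * K"
  proof (rule Phragmen_Lindeloef_half_plane[OF _ _ _ _ z])
    have "z + \<i> \<noteq> 0" if "- 1 < Im z" for z using that by (auto simp: complex_eq_iff)
    then show "G holomorphic_on {z. - 1 < Im z}"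
      unfolding G_def by (intro holomorphic_intros holomorphic_on_subset[OF hol]) auto
    show "cmod (G z) \<le> A * exp (B * cmod z)" if "0 \<le> Im z" for z
    proof -
      have "cmod (G z) \<le> 1 * cmod (F z) / 1"
        unfolding nG using i1[OF that] B that by (intro frac_le mult_right_mono) auto
      then show ?thesis using growth[of z] by simp
    qed
    show "cmod (G (of_real x)) \<le> 2 * K" for x
    proof -
      have "1 + \<bar>x\<bar> \<le> 2 * cmod (of_real x + \<i>)"
        using i1[of "of_real x"] abs_Re_le_cmod[of "of_real x + \<i>"] by simp
      then have "K * (1 + \<bar>x\<bar>) \<le> K * (2 * cmod (of_real x + \<i>))" using K0 by (intro mult_left_mono)
      then have "cmod (F (of_real x)) \<le> 2 * K * cmod (of_real x + \<i>)" using re[of x] by simp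
      then show ?thesis unfolding nG using i1[of "of_real x"] K0 by (simp add: divide_le_eq)
    qed
    show "cmod (G (\<i> * of_real y)) \<le> A" if "0 \<le> y" for y
    proof -
      have "cmod (G (\<i> * of_real y)) \<le> exp (- (B * y)) * (A * exp (B * y)) / 1"
        unfolding nG using i1[of "\<i> * of_real y"] growth[of "\<i> * of_real y"] that A0
        by (intro frac_le mult_mono) (auto simp: norm_mult)
      then show ?thesis by (simp add: exp_minus field_simps)
    qed
  qed
  then have "exp (- (B * Im z)) * cmod (F z) \<le> 2 * K * cmod (z + \<i>)"
    unfolding nG using i1[OF z] by (subst (asm) pos_divide_le_eq) linarith+
  from exp_mult_le_imp_le[OF this] show ?thesis by (simp add: mult_ac)
qed

text \<open>A primitive \<open>F\<close> of \<open>h\<close> grows at most linearly on the real axis away from any base point \<open>x0\<close>, with a constant that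
does not depend on \<open>x0\<close>. This extends to the unit circle about \<open>x0\<close>, and Cauchy's inequality there
bounds \<open>h x0\<close>, the derivative of \<open>F\<close>. The sign \<open>s\<close> in the proof treats the lower half-plane as the
upper half-plane of the reflected function.\<close>
lemma exp_type_bounded_on_reals:
  assumes hol: "h holomorphic_on UNIV"
    and growth: "\<And>z. cmod (h z) \<le> A * exp (B * cmod z)" and B: "0 \<le> B"
    and int: "\<And>u v::real. u \<le> v \<Longrightarrow> integral {u..v} (\<lambda>x. cmod (h (of_real x))) \<le> K * (v - u + 1)"
  shows "\<exists>M. \<forall>x::real. cmod (h (of_real x)) \<le> M"
proof -
  obtain F where F: "\<And>z. (F has_field_derivative h z) (at z)"
    using holomorphic_convex_primitive'[OF convex_UNIV open_UNIV hol] by auto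
  have A0: "0 \<le> A" using order_trans[OF norm_ge_zero growth[of 0]] by simp
  have conth: "continuous_on S (\<lambda>x::real. h (of_real x))" for S
    by (rule continuous_on_compose2[OF holomorphic_on_imp_continuous_on[OF hol]])
       (auto intro!: continuous_intros)
  have "cmod (h (of_real x0)) \<le> 4 * K * exp (B + 1)" for x0 :: real
  proof -
    \<comment> \<open>Increment of the primitive from \<open>x0\<close>, for \<open>s = -1\<close> in the reflected variable.\<close>
    define D where "D = (\<lambda>s z. F (of_real x0 + of_real s * z) - F (of_real x0))"
    have DF: "(D s has_field_derivative h (of_real x0 + of_real s * z) * of_real s) (at z)" for s z
      unfolding D_def by (auto intro!: derivative_eq_intros DERIV_chain2[OF F])
    have holD: "D s holomorphic_on UNIV" for s
      using DF by (auto simp: holomorphic_on_def field_differentiable_def intro: has_field_derivative_at_within)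
    have growthD: "cmod (D s z) \<le> (A * exp (B * \<bar>x0\<bar>)) * exp ((B + 1) * cmod z)" if s: "\<bar>s\<bar> = 1" for s z
    proof -
      have "cmod (F (of_real x0 + of_real s * z) - F (of_real x0))
          \<le> (A * exp (B * (\<bar>x0\<bar> + cmod z))) * cmod (of_real x0 + of_real s * z - of_real x0)"
      proof (rule field_differentiable_bound[where f' = h])
        show "convex (cball (of_real x0 :: complex) (cmod z))" by (rule convex_cball)
        show "(F has_field_derivative h w) (at w within cball (of_real x0) (cmod z))" for w
          using F by (rule has_field_derivative_at_within)
        fix w :: complex assume "w \<in> cball (of_real x0) (cmod z)"
        then have "cmod w \<le> \<bar>x0\<bar> + cmod z"
          using norm_triangle_ineq2[of w "of_real x0"] by (simp add: dist_norm norm_minus_commute)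
        then have "A * exp (B * cmod w) \<le> A * exp (B * (\<bar>x0\<bar> + cmod z))"
          using A0 B by (intro mult_left_mono) (auto intro: mult_left_mono)
        then show "cmod (h w) \<le> A * exp (B * (\<bar>x0\<bar> + cmod z))" using growth[of w] by linarith
      qed (use s in \<open>auto simp: dist_norm norm_mult\<close>)
      also have "\<dots> = (A * exp (B * \<bar>x0\<bar>)) * (exp (B * cmod z) * cmod z)"
        using s by (simp add: norm_mult distrib_left exp_add)
      also have "\<dots> \<le> (A * exp (B * \<bar>x0\<bar>)) * (exp (B * cmod z) * exp (cmod z))"
      proof -
        have "cmod z \<le> exp (cmod z)" using exp_ge_add_one_self[of "cmod z"] by linarith
        then show ?thesis using A0 by (intro mult_left_mono) auto
      qed
      finally show ?thesis by (simp add: D_def distrib_right exp_add)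
    qed
    have FTC: "cmod (F (of_real v) - F (of_real u)) \<le> K * (v - u + 1)" if "u \<le> v" for u v :: real
    proof -
      have "((\<lambda>x. h (of_real x)) has_integral (F (of_real v) - F (of_real u))) {u..v}"
      proof (rule fundamental_theorem_of_calculus[OF that])
        fix x
        have "((\<lambda>x. F (of_real x)) has_vector_derivative 1 * h (of_real x)) (at x within {u..v})"
          using field_vector_diff_chain_within[OF has_vector_derivative_of_real[OF DERIV_ident]
              has_field_derivative_at_within[OF F]] by (simp add: o_def)
        then show "((\<lambda>x. F (of_real x)) has_vector_derivative h (of_real x)) (at x within {u..v})" by simp
      qed
      then have "F (of_real v) - F (of_real u) = integral {u..v} (\<lambda>x. h (of_real x))"
        by (simp add: integral_unique)
      also have "cmod \<dots> \<le> integral {u..v} (\<lambda>x. cmod (h (of_real x)))"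
        using conth by (intro integral_norm_bound_integral integrable_continuous_interval continuous_intros) auto
      also have "\<dots> \<le> K * (v - u + 1)" using int[OF that] .
      finally show ?thesis .
    qed
    have reD: "cmod (D s (of_real x)) \<le> K * (1 + \<bar>x\<bar>)" if s: "s = 1 \<or> s = -1" for s x
    proof -
      have "cmod (F (of_real (x0 + t)) - F (of_real x0)) \<le> K * (1 + \<bar>t\<bar>)" for t
        using FTC[of x0 "x0 + t"] FTC[of "x0 + t" x0]
        by (cases "0 \<le> t") (auto simp: norm_minus_commute add.commute)
      from this[of "s * x"] s show ?thesis by (auto simp: D_def)
    qed
    have half: "cmod (D s z) \<le> 4 * K * exp (B + 1)" if s: "s = 1 \<or> s = -1" and z: "cmod z = 1" "0 \<le> Im z" for s z
    proof -
      have K0: "0 \<le> K" using order_trans[OF norm_ge_zero reD[of 1 0]] by simp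
      have "cmod (D s z) \<le> 2 * K * exp ((B + 1) * Im z) * cmod (z + \<i>)"
        using half_plane_linear_growth[OF holD growthD _ reD[OF s] z(2)] s B by auto
      also have "\<dots> \<le> 2 * K * exp ((B + 1) * 1) * 2"
        using abs_Im_le_cmod[of z] z norm_triangle_ineq[of z \<i>] K0 B
        by (intro mult_mono) (auto intro: mult_left_mono)
      finally show ?thesis by simp
    qed
    have "cmod ((deriv ^^ 1) (D 1) 0) \<le> fact 1 * (4 * K * exp (B + 1)) / 1 ^ 1"
    proof (rule Cauchy_inequality)
      show "D 1 holomorphic_on ball 0 1" using holD by (rule holomorphic_on_subset) auto
      show "continuous_on (cball 0 1) (D 1)"
        using holomorphic_on_imp_continuous_on[OF holD] by (rule continuous_on_subset) auto
      fix z :: complex assume "cmod (0 - z) = 1"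
      then have z: "cmod z = 1" by simp
      show "cmod (D 1 z) \<le> 4 * K * exp (B + 1)"
      proof (cases "0 \<le> Im z")
        case True
        then show ?thesis using half[of 1 z] z by simp
      next
        case False
        then have "cmod (D (- 1) (- z)) \<le> 4 * K * exp (B + 1)" using half[of "-1" "- z"] z by simp
        then show ?thesis by (simp add: D_def)
      qed
    qed simp
    moreover have "deriv (D 1) 0 = h (of_real x0)" using DERIV_imp_deriv[OF DF[of 1 0]] by simp
    ultimately show ?thesis by simp
  qed
  then show ?thesis by blast
qed

lemma poisson_mean_reflect: "poisson_mean y (\<lambda>u. f (- u)) (- x) = poisson_mean y f x"
proof -
  have "poisson_mean y f x = (LINT u|lborel. poisson_kernel y (- u - x) * f (- u))"
    unfolding poisson_mean_def
    using lborel_integral_real_affine[of "-1" "\<lambda>u. poisson_kernel y (u - x) * f u" 0] by simp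
  also have "\<dots> = poisson_mean y (\<lambda>u. f (- u)) (- x)"
    unfolding poisson_mean_def
    by (intro Bochner_Integration.integral_cong) (auto simp: poisson_kernel_def power2_eq_square algebra_simps)
  finally show ?thesis by simp
qed

text \<open>The function \<open>exp (\<i> * (\<sigma> + \<epsilon>) * z) * h z\<close> is bounded in the upper half-plane, so the Poisson inequality
applies to it; then \<open>\<epsilon>\<close> tends to 0.\<close>
lemma exp_type_upper_half_plane:
  assumes h: "exp_type \<sigma> h" "0 \<le> \<sigma>" and M: "\<And>x::real. cmod (h (of_real x)) \<le> M" and y: "0 < y"
  shows "cmod (h (Complex x y)) \<le> exp (\<sigma> * y) * poisson_mean y (\<lambda>u. cmod (h (of_real u))) x"
proof -
  define P where "P = poisson_mean y (\<lambda>u. cmod (h (of_real u))) x"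
  have hol: "h holomorphic_on UNIV" using h by (simp add: exp_type_def)
  have main: "cmod (h (Complex x y)) \<le> exp ((\<sigma> + \<epsilon>) * y) * P" if \<epsilon>: "0 < \<epsilon>" for \<epsilon>
  proof -
    define B where "B = \<sigma> + \<epsilon>"
    have B: "0 \<le> B" using h \<epsilon> by (simp add: B_def)
    obtain A where A: "\<And>z. cmod (h z) \<le> A * exp (B * cmod z)"
      using exp_type_imp_bound[OF h \<epsilon>] by (auto simp: B_def)
    define G where "G = (\<lambda>z. exp (\<i> * of_real B * z) * h z)"
    have nG: "cmod (G z) = exp (- (B * Im z)) * cmod (h z)" for z by (simp add: G_def norm_mult)
    have holG: "G holomorphic_on {z. - 1 < Im z}"
      unfolding G_def by (intro holomorphic_intros holomorphic_on_subset[OF hol]) auto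
    have bG: "cmod (G z) \<le> M" if "0 \<le> Im z" for z
    proof (rule Phragmen_Lindeloef_half_plane[OF holG _ _ _ that])
      show "cmod (G z) \<le> A * exp (B * cmod z)" if "0 \<le> Im z" for z
      proof -
        have "cmod (G z) \<le> 1 * cmod (h z)" unfolding nG using B that by (intro mult_right_mono) auto
        then show ?thesis using A[of z] by simp
      qed
      show "cmod (G (of_real x)) \<le> M" for x unfolding nG using M by simp
      show "cmod (G (\<i> * of_real y)) \<le> A" if "0 \<le> y" for y
      proof -
        have "cmod (G (\<i> * of_real y)) \<le> exp (- (B * y)) * (A * exp (B * y))"
          unfolding nG using A[of "\<i> * of_real y"] that by (simp add: norm_mult)
        then show ?thesis by (simp add: exp_minus field_simps)
      qed
    qed
    have "exp (- (B * y)) * cmod (h (Complex x y)) \<le> poisson_mean y (\<lambda>u. cmod (G (of_real u))) x"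
      using poisson_inequality[OF holG bG y, of x] by (simp add: nG)
    also have "\<dots> = P" by (simp add: nG P_def)
    finally show ?thesis unfolding B_def[symmetric] by (rule exp_mult_le_imp_le)
  qed
  have "((\<lambda>\<epsilon>. exp ((\<sigma> + \<epsilon>) * y) * P) \<longlongrightarrow> exp ((\<sigma> + 0) * y) * P) (at_right 0)"
    by (intro tendsto_intros)
  moreover have "\<forall>\<^sub>F \<epsilon> in at_right 0. cmod (h (Complex x y)) \<le> exp ((\<sigma> + \<epsilon>) * y) * P"
    using eventually_at_right_less by (rule eventually_mono) (rule main)
  ultimately have "cmod (h (Complex x y)) \<le> exp ((\<sigma> + 0) * y) * P"
    by (intro tendsto_lowerbound[of _ _ "at_right 0"]) auto
  then show ?thesis by (simp add: P_def)
qed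

lemma exp_type_minus:
  assumes "exp_type \<sigma> h" shows "exp_type \<sigma> (\<lambda>z. h (- z))"
proof -
  have "(\<lambda>z. h (- z)) holomorphic_on UNIV"
    using assms by (intro holomorphic_on_compose_gen[of uminus UNIV h UNIV, unfolded o_def])
      (auto simp: exp_type_def intro!: holomorphic_intros)
  moreover have "(SUP z\<in>sphere 0 \<rho>. cmod (h (- z))) = (SUP z\<in>sphere 0 \<rho>. cmod (h z))" for \<rho>
  proof -
    have e: "sphere (0::complex) \<rho> = uminus ` sphere 0 \<rho>" by (auto intro!: image_eqI[of _ _ "- _"])
    have "(\<lambda>z. cmod (h z)) ` sphere 0 \<rho> = (\<lambda>z. cmod (h (- z))) ` sphere 0 \<rho>"
      by (subst e) (simp add: image_image)
    then show ?thesis by simp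
  qed
  ultimately show ?thesis using assms by (simp add: exp_type_def)
qed

lemma exp_type_poisson_bound:
  assumes h: "exp_type \<sigma> h" "0 \<le> \<sigma>" and M: "\<And>x::real. cmod (h (of_real x)) \<le> M" and y: "y \<noteq> 0"
  shows "cmod (h (Complex x y)) \<le> exp (\<sigma> * \<bar>y\<bar>) * poisson_mean \<bar>y\<bar> (\<lambda>u. cmod (h (of_real u))) x"
proof (cases "0 < y")
  case True
  then show ?thesis using exp_type_upper_half_plane[OF h M True] by simp
next
  case False
  then have y': "0 < - y" using y by simp
  have "cmod (h (- Complex (- x) (- y)))
      \<le> exp (\<sigma> * - y) * poisson_mean (- y) (\<lambda>u. cmod (h (- of_real u))) (- x)"
    using M[of "- _"] by (intro exp_type_upper_half_plane[OF exp_type_minus[OF h(1)] h(2) _ y']) simp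
  moreover have "- Complex (- x) (- y) = Complex x y" by (simp add: complex_eq_iff)
  ultimately show ?thesis
    using False poisson_mean_reflect[of "- y" "\<lambda>u. cmod (h (of_real u))" x] by simp
qed

lemma poisson_mean_borel [measurable]:
  assumes [measurable]: "f \<in> borel_measurable borel"
  shows "poisson_mean y f \<in> borel_measurable borel"
proof -
  have "(\<lambda>x. LINT u|lborel. poisson_kernel y (u - x) * f u) \<in> borel_measurable lborel"
    by (rule lborel.borel_measurable_lebesgue_integral) measurable
  then show ?thesis unfolding poisson_mean_def[abs_def] by simp
qed

lemma poisson_mean_nonneg:
  assumes "0 < y" "\<And>u. 0 \<le> f u" shows "0 \<le> poisson_mean y f x"
  unfolding poisson_mean_def using assms poisson_kernel_nonneg
  by (intro integral_nonneg_AE AE_I2) auto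

text \<open>Cauchy's formula for the derivative on the two lines \<open>Im w = \<plusminus> Y\<close>. There \<open>\<bar>h\<bar>\<close> is at most
\<open>exp (\<sigma> * Y)\<close> times a Poisson mean, and the kernel \<open>\<bar>w - x\<bar> ^ - (r + 1)\<close> is at most \<open>pi / Y ^ r\<close>
times a Poisson kernel, which gives a second Poisson mean. The choice \<open>Y = r / \<sigma>\<close> minimises
\<open>exp (\<sigma> * Y) / Y ^ r\<close>, and \<open>fact r \<le> r ^ r\<close> leaves a constant that is only exponential in \<open>r\<close>.
Lines are used in place of a circle because they stay away from the real axis, near which the
Poisson kernels concentrate.\<close>
lemma exp_type_higher_deriv_bound:
  assumes h: "exp_type \<sigma> h" "0 < \<sigma>" and M: "\<And>x::real. cmod (h (of_real x)) \<le> M" and r: "1 \<le> r"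
  defines "Y \<equiv> real r / \<sigma>"
  shows "cmod ((deriv ^^ r) h (of_real x))
    \<le> (3 * \<sigma>) ^ r * poisson_mean Y (poisson_mean Y (\<lambda>u. cmod (h (of_real u)))) x"
proof -
  define H where "H = (\<lambda>u::real. cmod (h (of_real u)))"
  define Q where "Q = poisson_mean Y H"
  define P where "P = poisson_mean Y Q x"
  define E where "E = exp (\<sigma> * Y)"
  have Y: "0 < Y" using r h by (simp add: Y_def)
  have hol: "h holomorphic_on UNIV" using h by (simp add: exp_type_def)
  have conth: "continuous_on S h" for S
    using holomorphic_on_imp_continuous_on[OF hol] by (rule continuous_on_subset) auto
  have H [measurable]: "H \<in> borel_measurable borel" unfolding H_def
    by (intro borel_measurable_continuous_onI continuous_intros continuous_on_compose2[OF conth]) auto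
  have HM: "\<bar>H u\<bar> \<le> M" for u using M by (simp add: H_def)
  have Q [measurable]: "Q \<in> borel_measurable borel" unfolding Q_def by measurable
  have Q0: "0 \<le> Q u" for u unfolding Q_def by (rule poisson_mean_nonneg[OF Y]) (simp add: H_def)
  have QM: "\<bar>Q u\<bar> \<le> M" for u
    using Q0[of u] poisson_mean_bounded[OF Y H HM, of u] by (simp add: Q_def)
  have M0: "0 \<le> M" using HM[of 0] by linarith
  have pint: "integrable lborel (\<lambda>u. poisson_kernel Y (u - x) * Q u)"
    by (rule poisson_integrable[OF Y Q QM])
  define K where "K = E * pi / Y ^ r"
  have K0: "0 \<le> K" using Y by (simp add: K_def E_def)
  define f where "f = (\<lambda>w. h w / (w - of_real x) ^ Suc r)"
  define L where "L = cmod ((deriv ^^ r) h (of_real x))"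
  have main: "2 * pi / fact r * L \<le> 2 * K * P + 4 * Y * E * M / N" if N: "1 \<le> N" for N
  proof -
    define R where "R = rectpath (Complex (x - N) (- Y)) (Complex (x + N) Y)"
    have box: "of_real x \<in> box (Complex (x - N) (- Y)) (Complex (x + N) Y)"
      using N Y by (auto simp: in_box_complex_iff)
    have pimg: "path_image R \<subseteq> UNIV - {of_real x}"
      using box N Y unfolding R_def
      by (subst path_image_rectpath_cbox_minus_box) auto
    have contf: "continuous_on (UNIV - {of_real x}) f"
      unfolding f_def by (intro continuous_intros conth) auto
    have "contour_integral R f = 2 * pi * \<i> * (\<Sum>p\<in>{of_real x}. winding_number R p * residue f p)"
    proof (rule Residue_theorem)
      show "f holomorphic_on UNIV - {of_real x}"
        unfolding f_def by (intro holomorphic_intros holomorphic_on_subset[OF hol]) auto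
    qed (use pimg in \<open>auto simp: R_def\<close>)
    also have "\<dots> = 2 * pi * \<i> * ((deriv ^^ r) h (of_real x) / fact r)"
      using winding_number_rectpath[OF box] residue_holomorphic_over_power[OF open_UNIV UNIV_I hol]
      by (simp add: R_def f_def)
    finally have "2 * pi / fact r * L = cmod (contour_integral R f)"
      by (simp add: L_def norm_mult norm_divide)
    also have "\<dots> \<le> integral {x - N..x + N} (\<lambda>u. cmod (f (Complex u (- Y))))
        + integral {x - N..x + N} (\<lambda>u. cmod (f (Complex u Y))) + 2 * (E * M / N) * (Y - - Y)"
      unfolding R_def
    proof (rule rectangle_contour_bound)
      show "continuous_on (path_image (rectpath (Complex (x - N) (- Y)) (Complex (x + N) Y))) f"
        using contf pimg unfolding R_def by (rule continuous_on_subset)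
      have side: "cmod (f (Complex u v)) \<le> E * M / N" if v: "- Y \<le> v" "v \<le> Y" and u: "\<bar>u - x\<bar> = N" for u v
      proof -
        have "cmod (h (Complex u v)) \<le> E * M"
        proof (cases "v = 0")
          case True
          then have "Complex u v = of_real u" by (simp add: complex_eq_iff)
          then have "cmod (h (Complex u v)) \<le> 1 * M" using M by simp
          also have "\<dots> \<le> E * M" using Y h M0 by (intro mult_right_mono) (auto simp: E_def)
          finally show ?thesis .
        next
          case False
          have "cmod (h (Complex u v)) \<le> exp (\<sigma> * \<bar>v\<bar>) * poisson_mean \<bar>v\<bar> H u"
            using exp_type_poisson_bound[OF h(1) _ M False] h by (simp add: H_def)
          also have "\<dots> \<le> E * M"
            unfolding E_def using v h False poisson_mean_bounded[OF _ H HM]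
            by (intro mult_mono poisson_mean_nonneg) (auto simp: H_def)
          finally show ?thesis .
        qed
        moreover have "N \<le> cmod (Complex u v - of_real x) ^ Suc r"
        proof -
          have "N \<le> cmod (Complex u v - of_real x)"
            using abs_Re_le_cmod[of "Complex u v - of_real x"] u by simp
          also have "\<dots> = cmod (Complex u v - of_real x) ^ 1" by simp
          also have "\<dots> \<le> cmod (Complex u v - of_real x) ^ Suc r"
            using calculation N by (intro power_increasing) auto
          finally show ?thesis .
        qed
        ultimately show ?thesis using N M0 unfolding f_def norm_divide norm_power
          by (intro frac_le) (auto simp: E_def)
      qed
      show "cmod (f (Complex (x - N) u)) \<le> E * M / N" if "- Y \<le> u" "u \<le> Y" for u
        using side[OF that] N by simp
      show "cmod (f (Complex (x + N) u)) \<le> E * M / N" if "- Y \<le> u" "u \<le> Y" for u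
        using side[OF that] N by simp
    qed (use N Y in auto)
    finally have total: "2 * pi / fact r * L \<le> integral {x - N..x + N} (\<lambda>u. cmod (f (Complex u (- Y))))
        + integral {x - N..x + N} (\<lambda>u. cmod (f (Complex u Y))) + 2 * (E * M / N) * (Y - - Y)" .
    have hor: "integral {x - N..x + N} (\<lambda>u. cmod (f (Complex u s))) \<le> K * P" if s: "\<bar>s\<bar> = Y" for s
    proof -
      have pt: "cmod (f (Complex u s)) \<le> K * (poisson_kernel Y (u - x) * Q u)" for u
      proof -
        define d where "d = cmod (Complex u s - of_real x)"
        have s2: "s\<^sup>2 = Y\<^sup>2" using s by (metis power2_abs)
        have d2: "d\<^sup>2 = (u - x)\<^sup>2 + Y\<^sup>2" by (simp add: d_def cmod_power2 s2)
        have "Y \<le> d" using abs_Im_le_cmod[of "Complex u s - of_real x"] s by (simp add: d_def)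
        then have dY: "Y ^ (r - 1) \<le> d ^ (r - 1)" "0 < d" using Y by (auto intro: power_mono)
        have rr: "Suc r = (r - 1) + 2" "r = Suc (r - 1)" using r by auto
        have "cmod (h (Complex u s)) \<le> E * Q u"
          using exp_type_poisson_bound[OF h(1) _ M, of s u] h s Y by (auto simp: E_def Q_def H_def)
        then have "cmod (f (Complex u s)) \<le> E * Q u / (Y ^ (r - 1) * d\<^sup>2)"
          unfolding f_def norm_divide norm_power d_def[symmetric] unfolding rr(1) power_add
          using dY Y Q0 by (intro frac_le mult_right_mono) (auto simp: E_def)
        also have "\<dots> = K * (poisson_kernel Y (u - x) * Q u)"
        proof -
          have "Y ^ r = Y * Y ^ (r - 1)" by (subst rr(2)) simp
          moreover have "poisson_kernel Y (u - x) = Y / (pi * d\<^sup>2)"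
            by (simp only: poisson_kernel_def d2)
          ultimately show ?thesis using Y dY by (simp add: K_def)
        qed
        finally show ?thesis .
      qed
      let ?k = "\<lambda>u. K * (poisson_kernel Y (u - x) * Q u)"
      have i: "integrable lborel ?k"
        using pint by simp
      have iU: "?k integrable_on UNIV"
        by (rule integrable_on_lborel[OF i])
      have iN: "?k integrable_on {x - N..x + N}"
        by (rule integrable_on_subinterval[OF iU]) simp
      have "integral {x - N..x + N} (\<lambda>u. cmod (f (Complex u s)))
          \<le> integral {x - N..x + N} ?k"
      proof (rule integral_le[OF _ iN pt])
        show "(\<lambda>u. cmod (f (Complex u s))) integrable_on {x - N..x + N}"
          using s Y by (intro integrable_continuous_interval continuous_on_norm
            continuous_on_compose2[OF contf] continuous_intros) (auto simp: complex_eq_iff)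
      qed
      also have "\<dots> \<le> integral UNIV ?k"
        by (rule integral_subset_le[OF _ iN iU]) (use K0 poisson_kernel_nonneg[OF Y] Q0 in auto)
      also have "\<dots> = K * P" by (subst integral_lborel[OF i]) (simp add: P_def poisson_mean_def)
      finally show ?thesis .
    qed
    note total
    also have "integral {x - N..x + N} (\<lambda>u. cmod (f (Complex u (- Y))))
        + integral {x - N..x + N} (\<lambda>u. cmod (f (Complex u Y))) + 2 * (E * M / N) * (Y - - Y)
        \<le> K * P + K * P + 2 * (E * M / N) * (Y - - Y)"
      using Y by (intro add_mono hor) auto
    also have "\<dots> = 2 * K * P + 4 * Y * E * M / N" by (simp add: field_simps)
    finally show ?thesis .
  qed
  have "((\<lambda>N. 2 * K * P + 4 * Y * E * M / N) \<longlongrightarrow> 2 * K * P + 0) at_top"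
    by (intro tendsto_intros real_tendsto_divide_at_top[OF tendsto_const] filterlim_ident)
  moreover have "\<forall>\<^sub>F N in at_top. 2 * pi / fact r * L \<le> 2 * K * P + 4 * Y * E * M / N"
    using eventually_ge_at_top[of 1] by (rule eventually_mono) (rule main)
  ultimately have "2 * pi / fact r * L \<le> 2 * K * P + 0"
    by (intro tendsto_lowerbound[of _ _ at_top]) auto
  then have "L \<le> fact r * E / Y ^ r * P" using Y by (simp add: K_def field_simps)
  also have "\<dots> \<le> (3 * \<sigma>) ^ r * P"
  proof (rule mult_right_mono)
    have "E = exp 1 ^ r" using h by (simp add: E_def Y_def exp_of_nat_mult[symmetric])
    also have "\<dots> \<le> 3 ^ r" using exp_le by (intro power_mono) auto
    finally have "E \<le> 3 ^ r" .
    moreover have "fact r \<le> real r ^ r" using fact_le_power[of r, where 'a = real] by simp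
    ultimately have "fact r * E / Y ^ r \<le> real r ^ r * 3 ^ r / Y ^ r"
      using Y by (intro divide_right_mono mult_mono) (auto simp: E_def)
    also have "\<dots> = (3 * \<sigma>) ^ r"
      using r h by (simp add: Y_def power_divide power_mult_distrib)
    finally show "fact r * E / Y ^ r \<le> (3 * \<sigma>) ^ r" .
    show "0 \<le> P" unfolding P_def by (rule poisson_mean_nonneg[OF Y Q0])
  qed
  finally show ?thesis by (simp add: L_def P_def Q_def H_def)
qed

section \<open>Poisson means in variable exponent spaces\<close>

context log_exponent
begin

definition C_mean :: real where "C_mean = 9 * exp (4 * c)"

lemma C_mean_ge_1: "1 \<le> C_mean"
proof -
  have "1 \<le> exp (4 * c)" using c_nonneg by simp
  then show ?thesis unfolding C_mean_def by linarith
qed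

text \<open>The Poisson kernel is dominated by a sum of normalised indicators of the intervals of half-length
\<open>l n = 2 ^ n * y\<close> with weights \<open>2 / pi\<close> and \<open>8 / (pi * 2 ^ n)\<close>, whose total is \<open>10 / pi \<le> 4\<close>. The truncations
\<open>T n\<close> to these intervals are bounded inductively and converge to the Poisson mean.\<close>
lemma norm_le_poisson_mean:
  assumes f: "norm_le f K" and fb [measurable]: "f \<in> borel_measurable borel"
    and b: "\<And>u. 0 \<le> f u \<and> f u \<le> M" and y: "0 < y"
  shows "norm_le (poisson_mean y f) (4 * C_mean * K)"
proof -
  define l where "l = (\<lambda>n::nat. 2 ^ n * y)"
  let ?g = "\<lambda>x u. poisson_kernel y (u - x) * f u"
  define T where "T = (\<lambda>n x. LINT u|lborel. indicator {- l n..l n} (u - x) * ?g x u)"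
  have K: "0 < K" using f by (simp add: norm_le_def)
  have l0: "0 < l n" for n using y by (simp add: l_def)
  have l2: "l (Suc n) = 2 * l n" for n by (simp add: l_def)
  have pint: "integrable lborel (?g x)" for x
    using b by (intro poisson_integrable[OF y, where M = M]) (auto simp: abs_le_iff intro: order_trans)
  have Tint: "integrable lborel (\<lambda>u. indicator {- l n..l n} (u - x) * ?g x u)" for n x
    by (rule Bochner_Integration.integrable_bound[OF pint[of x]]) (auto simp: indicator_def abs_mult)
  have iint: "integrable lborel (\<lambda>u. indicator {- s..s} (u - x) * \<bar>f u\<bar>)" for s x
  proof (rule Bochner_Integration.integrable_bound)
    show "integrable lborel (\<lambda>u. M * indicator {x-s..x+s} u)"
      by (intro integrable_mult_right integrable_real_indicator) (auto simp: emeasure_lborel_Icc_eq)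
    show "AE u in lborel. norm (indicator {- s..s} (u - x) * \<bar>f u\<bar>) \<le> norm (M * indicator {x-s..x+s} u)"
      using b by (intro AE_I2) (auto simp: indicator_def intro: order_trans[OF _ abs_ge_self])
  qed measurable
  have Tm: "T n \<in> borel_measurable borel" for n
  proof -
    have "(\<lambda>x. LINT u|lborel. indicator {- l n..l n} (u - x) * ?g x u)
        \<in> borel_measurable lborel"
      by (rule lborel.borel_measurable_lebesgue_integral) measurable
    then show ?thesis unfolding T_def by simp
  qed
  have T0: "0 \<le> T n x" for n x
    unfolding T_def using b poisson_kernel_nonneg[OF y] by (intro integral_nonneg_AE AE_I2) auto
  have im0: "0 \<le> interval_mean (- l n) (l n) f x" for n x
    using l0[of n] by (intro interval_mean_nonneg) simp
  have nm: "norm_le (\<lambda>x. k * interval_mean (- l n) (l n) f x) (k * (C_mean * K))" if "0 < k" for k n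
    using norm_le_scale[OF norm_le_interval_mean[OF f, of "- l n" "l n"] that] l0[of n] by (simp add: C_mean_def)
  have base: "T 0 x \<le> 2 / pi * interval_mean (- l 0) (l 0) f x" for x
  proof -
    have "T 0 x \<le> (LINT u|lborel. 1 / (pi * y) * (indicator {- l 0..l 0} (u - x) * \<bar>f u\<bar>))"
      unfolding T_def
    proof (rule integral_mono[OF Tint])
      fix u
      have "poisson_kernel y (u - x) \<le> y / (pi * (0 + y\<^sup>2))"
        unfolding poisson_kernel_def using y by (intro divide_left_mono mult_left_mono add_right_mono mult_pos_pos add_nonneg_pos) auto
      also have "\<dots> = 1 / (pi * y)" using y by (simp add: power2_eq_square)
      finally have "poisson_kernel y (u - x) * f u \<le> 1 / (pi * y) * f u" using b by (intro mult_right_mono) auto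
      then show "indicator {- l 0..l 0} (u - x) * ?g x u
          \<le> 1 / (pi * y) * (indicator {- l 0..l 0} (u - x) * \<bar>f u\<bar>)"
        using b[of u] by (auto simp: indicator_def)
    qed (use iint in simp)
    also have "\<dots> = 2 / pi * interval_mean (- l 0) (l 0) f x"
      using y by (simp add: interval_mean_lborel l_def)
    finally show ?thesis .
  qed
  have step: "T (Suc n) x \<le> T n x + 8 / (pi * 2 ^ Suc n) * interval_mean (- l (Suc n)) (l (Suc n)) f x" for n x
  proof -
    define k where "k = 1 / (pi * 4 ^ n * y)"
    have k0: "0 \<le> k" using y by (simp add: k_def)
    have "T (Suc n) x \<le> (LINT u|lborel. indicator {- l n..l n} (u - x) * ?g x u
        + k * (indicator {- l (Suc n)..l (Suc n)} (u - x) * \<bar>f u\<bar>))"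
      unfolding T_def
    proof (rule integral_mono[OF Tint])
      fix u
      show "indicator {- l (Suc n)..l (Suc n)} (u - x) * ?g x u
        \<le> indicator {- l n..l n} (u - x) * ?g x u
          + k * (indicator {- l (Suc n)..l (Suc n)} (u - x) * \<bar>f u\<bar>)"
      proof (cases "u - x \<in> {- l n..l n}")
        case True
        then have "u - x \<in> {- l (Suc n)..l (Suc n)}" using l0[of n] unfolding l2 by auto
        then show ?thesis using True k0 b[of u] by (simp add: indicator_def)
      next
        case False
        then have "l n \<le> \<bar>u - x\<bar>" by auto
        then have "(l n)\<^sup>2 \<le> (u - x)\<^sup>2" using l0[of n] by (metis abs_le_square_iff abs_of_pos)
        then have "(l n)\<^sup>2 \<le> (u - x)\<^sup>2 + y\<^sup>2" using zero_le_power2[of y] by linarith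
        then have "poisson_kernel y (u - x) \<le> y / (pi * (l n)\<^sup>2)"
          unfolding poisson_kernel_def using y l0[of n]
          by (intro divide_left_mono mult_left_mono mult_pos_pos add_nonneg_pos) auto
        also have "\<dots> = k"
        proof -
          have "(l n)\<^sup>2 = 4 ^ n * y\<^sup>2"
            by (simp add: l_def power_mult_distrib power_mult[symmetric] mult.commute[of n] power_mult)
          then show ?thesis using y by (simp add: k_def power2_eq_square)
        qed
        finally have "poisson_kernel y (u - x) * f u \<le> k * \<bar>f u\<bar>" using b[of u] by (simp add: mult_right_mono)
        then show ?thesis using False by (auto simp: indicator_def)
      qed
    qed (use iint Tint in simp)
    also have "\<dots> = T n x + k * (LINT u|lborel. indicator {- l (Suc n)..l (Suc n)} (u - x) * \<bar>f u\<bar>)"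
      unfolding T_def by (subst Bochner_Integration.integral_add) (use iint Tint in auto)
    also have "k * (LINT u|lborel. indicator {- l (Suc n)..l (Suc n)} (u - x) * \<bar>f u\<bar>)
        = 8 / (pi * 2 ^ Suc n) * interval_mean (- l (Suc n)) (l (Suc n)) f x"
    proof -
      have "8 / (pi * 2 ^ Suc n) * (1 / (l (Suc n) - - l (Suc n))) = k"
        using y by (simp add: k_def l_def power_mult_distrib[symmetric])
      then show ?thesis by (simp only: interval_mean_lborel[OF fb] mult.assoc[symmetric])
    qed
    finally show ?thesis .
  qed
  have "norm_le (T n) ((10 / pi - 8 / (pi * 2 ^ n)) * (C_mean * K))" for n
  proof (induction n)
    case 0
    have "norm_le (T 0) (2 / pi * (C_mean * K))"
      using base T0 im0 by (intro norm_le_dominated[OF nm borel_imp_lebesgue_measurable[OF Tm]]) (auto intro: order_trans[OF _ abs_ge_self])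
    then show ?case by simp
  next
    case (Suc n)
    have "norm_le (\<lambda>x. T n x + 8 / (pi * 2 ^ Suc n) * interval_mean (- l (Suc n)) (l (Suc n)) f x)
        ((10 / pi - 8 / (pi * 2 ^ n)) * (C_mean * K) + 8 / (pi * 2 ^ Suc n) * (C_mean * K))"
      by (intro norm_le_add Suc nm) simp
    then have "norm_le (T (Suc n)) ((10 / pi - 8 / (pi * 2 ^ n)) * (C_mean * K) + 8 / (pi * 2 ^ Suc n) * (C_mean * K))"
      using step T0 by (intro norm_le_dominated[OF _ borel_imp_lebesgue_measurable[OF Tm]]) (auto intro: order_trans[OF _ abs_ge_self])
    then show ?case by (simp add: field_simps)
  qed
  moreover have "(10 / pi - 8 / (pi * 2 ^ n)) * (C_mean * K) \<le> 4 * C_mean * K" for n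
  proof -
    have "10 / pi \<le> 4" using pi_approx by (simp add: divide_le_eq)
    moreover have "0 \<le> 8 / (pi * 2 ^ n)" by simp
    ultimately have "10 / pi - 8 / (pi * 2 ^ n) \<le> 4" by linarith
    then have "(10 / pi - 8 / (pi * 2 ^ n)) * (C_mean * K) \<le> 4 * (C_mean * K)"
      using K C_mean_ge_1 by (intro mult_right_mono) auto
    then show ?thesis by simp
  qed
  ultimately have T: "norm_le (T n) (4 * C_mean * K)" for n using norm_le_mono_bound by blast
  show ?thesis
  proof (rule norm_le_limit[OF T])
    fix x
    show "(\<lambda>n. T n x) \<longlonglongrightarrow> poisson_mean y f x"
      unfolding T_def poisson_mean_def
    proof (rule integral_dominated_convergence[where w = "\<lambda>u. poisson_kernel y (u - x) * f u"])
      show "integrable lborel (?g x)" by (rule pint)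
      show "AE u in lborel. (\<lambda>n. indicator {- l n..l n} (u - x) * ?g x u)
          \<longlonglongrightarrow> poisson_kernel y (u - x) * f u"
      proof (intro AE_I2 tendsto_eventually)
        fix u
        obtain N where N: "\<bar>u - x\<bar> / y < 2 ^ N" using real_arch_pow[of 2] by auto
        have *: "u - x \<in> {- l n..l n}" if "N \<le> n" for n
        proof -
          have "(2::real) ^ N \<le> 2 ^ n" using that by (intro power_increasing) auto
          then have "\<bar>u - x\<bar> / y \<le> 2 ^ n" using N by linarith
          then have "\<bar>u - x\<bar> \<le> l n" using y by (simp add: l_def divide_le_eq)
          then show ?thesis by (simp add: abs_le_iff)
        qed
        show "\<forall>\<^sub>F n in sequentially. indicator {- l n..l n} (u - x) * ?g x u
            = poisson_kernel y (u - x) * f u"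
          unfolding eventually_sequentially
          by (intro exI[of _ N] allI impI) (simp only: indicator_simps(1)[OF *] mult_1_left)
      qed
    qed (use b poisson_kernel_nonneg[OF y] in \<open>auto simp: indicator_def abs_mult\<close>)
  qed
qed

end

section \<open>Powers of the operator I - T\<close>

text \<open>On locally integrable functions the Bochner integral in \<^const>\<open>T_op\<close> is linear and agrees with the
gauge integral.\<close>
definition loc_integrable :: "(real \<Rightarrow> real) \<Rightarrow> bool" where
  "loc_integrable f \<longleftrightarrow> (\<forall>u v. set_integrable lebesgue {u..v} f)"

text \<open>The operator \<open>I - T\<^sub>\<delta>\<close>, as it occurs in \<^const>\<open>Omega\<close>.\<close>
abbreviation U_op :: "real \<Rightarrow> (real \<Rightarrow> real) \<Rightarrow> real \<Rightarrow> real" where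
  "U_op \<delta> \<equiv> (\<lambda>h x. h x - T_op \<delta> h x)"

lemma loc_integrableD:
  assumes "loc_integrable f"
  shows "f integrable_on {u..v}" "(\<lambda>x. \<bar>f x\<bar>) integrable_on {u..v}"
    "(LINT x:{u..v}|lebesgue. f x) = integral {u..v} f"
    "(LINT x:{u..v}|lebesgue. \<bar>f x\<bar>) = integral {u..v} (\<lambda>x. \<bar>f x\<bar>)"
proof -
  have f: "set_integrable lebesgue {u..v} f" using assms by (simp add: loc_integrable_def)
  have a: "set_integrable lebesgue {u..v} (\<lambda>x. \<bar>f x\<bar>)" using f by (rule set_integrable_abs)
  show "f integrable_on {u..v}" "(LINT x:{u..v}|lebesgue. f x) = integral {u..v} f"
    using set_lebesgue_integral_eq_integral[OF f] by auto
  show "(\<lambda>x. \<bar>f x\<bar>) integrable_on {u..v}"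
    "(LINT x:{u..v}|lebesgue. \<bar>f x\<bar>) = integral {u..v} (\<lambda>x. \<bar>f x\<bar>)"
    using set_lebesgue_integral_eq_integral[OF a] by auto
qed

lemma loc_integrable_continuous: "continuous_on UNIV f \<Longrightarrow> loc_integrable f"
  unfolding loc_integrable_def
  by (auto intro!: absolutely_integrable_continuous_real intro: continuous_on_subset)

lemma loc_integrable_diff: "loc_integrable f \<Longrightarrow> loc_integrable g \<Longrightarrow> loc_integrable (\<lambda>x. f x - g x)"
  unfolding loc_integrable_def by (auto intro: set_integral_diff)

lemma T_op_eq:
  assumes "loc_integrable f"
  shows "T_op \<delta> f x = 1 / \<delta> * integral {x..x + \<delta>} f"
proof -
  have "(LINT y:{x..x + \<delta>}|lebesgue. f y)
      = (LINT t|lebesgue. indicator {x..x + \<delta>} (x + 1 * t) *\<^sub>R f (x + 1 * t))"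
    unfolding set_lebesgue_integral_def
    by (subst lebesgue_integral_real_affine[of 1 _ x]) auto
  also have "\<dots> = (LINT t:{0..\<delta>}|lebesgue. f (x + t))"
    unfolding set_lebesgue_integral_def by (intro Bochner_Integration.integral_cong) (auto simp: indicator_def)
  finally show ?thesis using loc_integrableD(3)[OF assms] by (simp add: T_op_def)
qed

lemma integral_abs_mono_interval:
  assumes "loc_integrable f" "u \<le> u'" "v' \<le> v"
  shows "integral {u'..v'} (\<lambda>x. \<bar>f x\<bar>) \<le> integral {u..v} (\<lambda>x. \<bar>f x\<bar>)"
  using assms by (intro integral_subset_le loc_integrableD) auto

lemma T_op_continuous:
  assumes f: "loc_integrable f" and \<delta>: "0 \<le> \<delta>"
  shows "continuous_on UNIV (T_op \<delta> f)"
proof -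
  have "continuous_on {a..b} (T_op \<delta> f)" for a b
  proof -
    have c: "continuous_on {a..b + \<delta>} (\<lambda>x. integral {a..x} f)"
      using loc_integrableD(1)[OF f] by (rule indefinite_integral_continuous_1)
    have "continuous_on {a..b} (\<lambda>x. 1 / \<delta> * (integral {a..x + \<delta>} f - integral {a..x} f))"
      using \<delta> by (intro continuous_intros continuous_on_compose2[OF c]) auto
    moreover have "T_op \<delta> f x = 1 / \<delta> * (integral {a..x + \<delta>} f - integral {a..x} f)" if "x \<in> {a..b}" for x
    proof -
      have "integral {a..x} f + integral {x..x + \<delta>} f = integral {a..x + \<delta>} f"
        using that \<delta> by (intro Henstock_Kurzweil_Integration.integral_combine loc_integrableD(1)[OF f]) auto
      then show ?thesis by (simp add: T_op_eq[OF f])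
    qed
    ultimately show ?thesis using continuous_on_eq by fastforce
  qed
  then have "isCont (T_op \<delta> f) x" for x
    by (rule continuous_on_interior[of "{x - 1..x + 1}"]) auto
  then show ?thesis by (simp add: continuous_at_imp_continuous_on)
qed

lemma loc_integrable_U_op:
  assumes "loc_integrable f" "0 \<le> \<delta>" shows "loc_integrable ((U_op \<delta> ^^ r) f)"
proof (induction r)
  case (Suc r)
  have "loc_integrable (U_op \<delta> ((U_op \<delta> ^^ r) f))"
    by (intro loc_integrable_diff Suc loc_integrable_continuous T_op_continuous assms)
  then show ?case by simp
qed (simp add: assms)

lemma borel_measurable_U_op:
  assumes "loc_integrable f" "0 \<le> \<delta>" "f \<in> borel_measurable lebesgue"
  shows "(U_op \<delta> ^^ r) f \<in> borel_measurable lebesgue"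
proof (induction r)
  case (Suc r)
  let ?g = "(U_op \<delta> ^^ r) f"
  have "T_op \<delta> ?g \<in> borel_measurable borel"
    by (intro borel_measurable_continuous_onI T_op_continuous loc_integrable_U_op assms)
  then have [measurable]: "T_op \<delta> ?g \<in> borel_measurable lebesgue"
    by (rule borel_imp_lebesgue_measurable)
  show ?case using Suc by simp
qed (simp add: assms)

lemma U_op_diff:
  assumes f: "loc_integrable f" and g: "loc_integrable g" and \<delta>: "0 \<le> \<delta>"
  shows "(U_op \<delta> ^^ r) (\<lambda>x. f x - g x) = (\<lambda>x. (U_op \<delta> ^^ r) f x - (U_op \<delta> ^^ r) g x)"
proof (induction r)
  case (Suc r)
  let ?F = "(U_op \<delta> ^^ r) f" and ?G = "(U_op \<delta> ^^ r) g"
  have i: "loc_integrable ?F" "loc_integrable ?G" using f g \<delta> by (auto intro: loc_integrable_U_op)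
  have T: "T_op \<delta> (\<lambda>x. ?F x - ?G x) x = T_op \<delta> ?F x - T_op \<delta> ?G x" for x
    using i by (simp add: T_op_eq loc_integrable_diff Henstock_Kurzweil_Integration.integral_diff
        loc_integrableD(1) right_diff_distrib diff_divide_distrib)
  show ?case unfolding funpow.simps o_apply Suc T by (intro ext) simp
qed simp

lemma abs_T_op_le:
  assumes f: "loc_integrable f" and \<delta>: "0 < \<delta>"
    and g: "\<And>y. y \<in> {x..x + \<delta>} \<Longrightarrow> \<bar>f y\<bar> \<le> g y" and gi: "g integrable_on {x..x + \<delta>}"
  shows "\<bar>T_op \<delta> f x\<bar> \<le> 1 / \<delta> * integral {x..x + \<delta>} g"
proof -
  have "norm (integral {x..x + \<delta>} f) \<le> integral {x..x + \<delta>} g"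
    using g by (intro integral_norm_bound_integral loc_integrableD(1)[OF f] gi) auto
  then show ?thesis using \<delta> by (simp add: T_op_eq[OF f] abs_mult divide_right_mono)
qed

text \<open>Iterating a norm bound for \<open>T\<^sub>\<delta>\<close> would produce the \<open>r\<close>-th power of its constant. Pointwise, however,
all iterates are dominated by one integral over \<open>[x, x + r * \<delta>]\<close>: each further application only
widens the window by \<open>\<delta>\<close> and turns the coefficient \<open>k\<close> into \<open>2 * k + 1 / \<delta>\<close>.\<close>
lemma abs_U_op_power_le:
  assumes f: "loc_integrable f" and \<delta>: "0 < \<delta>"
  shows "\<bar>(U_op \<delta> ^^ r) f x\<bar> \<le> \<bar>f x\<bar> + (2 ^ r - 1) / \<delta> * integral {x..x + real r * \<delta>} (\<lambda>y. \<bar>f y\<bar>)"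
proof (induction r arbitrary: x)
  case (Suc r)
  let ?g = "(U_op \<delta> ^^ r) f"
  define J where "J = (\<lambda>r x. integral {x..x + real r * \<delta>} (\<lambda>y. \<bar>f y\<bar>))"
  define k where "k = (2 ^ r - 1) / \<delta>"
  have k: "0 \<le> k" using \<delta> by (simp add: k_def)
  have IH: "\<bar>?g x\<bar> \<le> \<bar>f x\<bar> + k * J r x" for x using Suc by (simp add: J_def k_def)
  have J_mono: "J r y \<le> J (Suc r) x" if "y \<in> {x..x + \<delta>}" for y
    unfolding J_def using that by (intro integral_abs_mono_interval[OF f]) (auto simp: algebra_simps)
  have "\<bar>T_op \<delta> ?g x\<bar> \<le> 1 / \<delta> * integral {x..x + \<delta>} (\<lambda>y. \<bar>f y\<bar> + k * J (Suc r) x)"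
  proof (rule abs_T_op_le)
    show "\<bar>?g y\<bar> \<le> \<bar>f y\<bar> + k * J (Suc r) x" if "y \<in> {x..x + \<delta>}" for y
      using IH[of y] mult_left_mono[OF J_mono[OF that] k] by linarith
  qed (use \<delta> in \<open>auto intro!: loc_integrable_U_op f integrable_add loc_integrableD(2)[OF f]\<close>)
  also have "integral {x..x + \<delta>} (\<lambda>y. \<bar>f y\<bar> + k * J (Suc r) x)
      = integral {x..x + \<delta>} (\<lambda>y. \<bar>f y\<bar>) + \<delta> * (k * J (Suc r) x)"
    using \<delta> by (subst Henstock_Kurzweil_Integration.integral_add) (auto intro!: loc_integrableD(2)[OF f])
  also have "\<dots> \<le> J (Suc r) x + \<delta> * (k * J (Suc r) x)"
    unfolding J_def using \<delta> by (intro add_right_mono integral_abs_mono_interval[OF f]) (auto simp: algebra_simps)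
  finally have T: "\<bar>T_op \<delta> ?g x\<bar> \<le> 1 / \<delta> * J (Suc r) x + k * J (Suc r) x"
    using \<delta> by (simp add: field_simps)
  have "\<bar>(U_op \<delta> ^^ Suc r) f x\<bar> \<le> \<bar>?g x\<bar> + \<bar>T_op \<delta> ?g x\<bar>"
    using abs_triangle_ineq4[of "?g x" "T_op \<delta> ?g x"] by simp
  also have "\<dots> \<le> (\<bar>f x\<bar> + k * J (Suc r) x) + (1 / \<delta> * J (Suc r) x + k * J (Suc r) x)"
    using IH[of x] T mult_left_mono[OF J_mono[of x] k] \<delta> by simp
  also have "\<dots> = \<bar>f x\<bar> + (2 * k + 1 / \<delta>) * J (Suc r) x" by (simp add: algebra_simps)
  also have "2 * k + 1 / \<delta> = (2 ^ Suc r - 1) / \<delta>" by (simp add: k_def diff_divide_distrib)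
  finally show ?case by (simp add: J_def)
qed simp

text \<open>\<open>g - T\<^sub>\<delta> g\<close> is the mean over \<open>y\<close> in the window of \<open>g x - g y\<close>.\<close>
lemma abs_U_op_le_derivative:
  assumes g: "\<And>x. (g has_real_derivative g' x) (at x)" and g': "continuous_on UNIV g'" and \<delta>: "0 < \<delta>"
  shows "\<bar>U_op \<delta> g x\<bar> \<le> integral {x..x + \<delta>} (\<lambda>y. \<bar>g' y\<bar>)"
proof -
  have li: "loc_integrable g"
    using DERIV_isCont[OF g] by (intro loc_integrable_continuous) (simp add: continuous_at_imp_continuous_on)
  have li': "loc_integrable g'" using g' by (rule loc_integrable_continuous)
  let ?D = "integral {x..x + \<delta>} (\<lambda>y. \<bar>g' y\<bar>)"
  have d: "\<bar>g x - g y\<bar> \<le> ?D" if y: "y \<in> {x..x + \<delta>}" for y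
  proof -
    have "(g' has_integral (g y - g x)) {x..y}"
      using y by (intro fundamental_theorem_of_calculus)
        (auto intro!: has_field_derivative_at_within[OF g] simp flip: has_real_derivative_iff_has_vector_derivative)
    then have "norm (g y - g x) \<le> integral {x..y} (\<lambda>y. \<bar>g' y\<bar>)"
      by (metis integral_norm_bound_integral integral_unique has_integral_integrable
          loc_integrableD(2)[OF li'] order_refl real_norm_def)
    also have "\<dots> \<le> ?D" using y by (intro integral_abs_mono_interval[OF li']) auto
    finally show ?thesis by (simp add: abs_minus_commute)
  qed
  have e: "U_op \<delta> g x = 1 / \<delta> * integral {x..x + \<delta>} (\<lambda>y. g x - g y)"
    using \<delta> by (subst Henstock_Kurzweil_Integration.integral_diff)
      (auto simp: T_op_eq[OF li] right_diff_distrib intro!: loc_integrableD(1)[OF li])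
  have "norm (integral {x..x + \<delta>} (\<lambda>y. g x - g y)) \<le> integral {x..x + \<delta>} (\<lambda>y. ?D)"
    using d by (intro integral_norm_bound_integral Henstock_Kurzweil_Integration.integrable_diff loc_integrableD(1)[OF li]) auto
  then have "\<bar>integral {x..x + \<delta>} (\<lambda>y. g x - g y)\<bar> \<le> \<delta> * ?D" using \<delta> by simp
  then show ?thesis unfolding e abs_mult using \<delta> by (simp add: divide_le_eq mult.commute)
qed

lemma U_op_derivative:
  assumes g: "\<And>x. (g has_real_derivative g' x) (at x)" and g': "continuous_on UNIV g'" and \<delta>: "0 < \<delta>"
  shows "(U_op \<delta> g has_real_derivative U_op \<delta> g' x) (at x)"
proof -
  have contg: "continuous_on UNIV g" using DERIV_isCont[OF g] by (simp add: continuous_at_imp_continuous_on)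
  have li: "loc_integrable g" using contg by (rule loc_integrable_continuous)
  have li': "loc_integrable g'" using g' by (rule loc_integrable_continuous)
  have T': "T_op \<delta> g' x = 1 / \<delta> * (g (x + \<delta>) - g x)" for x
  proof -
    have "(g' has_integral (g (x + \<delta>) - g x)) {x..x + \<delta>}"
      using \<delta> by (intro fundamental_theorem_of_calculus)
        (auto intro!: has_field_derivative_at_within[OF g] simp flip: has_real_derivative_iff_has_vector_derivative)
    then show ?thesis by (simp add: T_op_eq[OF li'] integral_unique)
  qed
  define a where "a = x - 1"
  define I where "I = (\<lambda>u. integral {a..u} g)"
  have I: "(I has_real_derivative g u) (at u)" if "a < u" for u
  proof -
    have "(I has_real_derivative g u) (at u within {a..u + 1})"
      unfolding I_def using that contg by (intro integral_has_real_derivative) (auto intro: continuous_on_subset)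
    then show ?thesis using that by (subst (asm) at_within_interior) auto
  qed
  have "((\<lambda>u. 1 / \<delta> * (I (u + \<delta>) - I u)) has_real_derivative 1 / \<delta> * (g (x + \<delta>) - g x)) (at x)"
    using \<delta> by (auto intro!: derivative_eq_intros DERIV_chain2[OF I] I simp: a_def)
  then have "(T_op \<delta> g has_real_derivative 1 / \<delta> * (g (x + \<delta>) - g x)) (at x)"
  proof (rule has_field_derivative_transform_within_open)
    show "x \<in> {a<..}" by (simp add: a_def)
    fix u assume u: "u \<in> {a<..}"
    have "integral {a..u} g + integral {u..u + \<delta>} g = integral {a..u + \<delta>} g"
      using u \<delta> by (intro Henstock_Kurzweil_Integration.integral_combine loc_integrableD(1)[OF li]) auto
    then show "1 / \<delta> * (I (u + \<delta>) - I u) = T_op \<delta> g u"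
      by (simp add: I_def T_op_eq[OF li])
  qed auto
  then show ?thesis unfolding T' by (intro DERIV_diff g)
qed

text \<open>Each application of \<open>I - T\<^sub>\<delta>\<close> exchanges a derivative for a factor \<open>\<delta>\<close> and a window widened by \<open>\<delta>\<close>,
because the operator commutes with differentiation.\<close>
lemma abs_U_op_power_le_derivative:
  assumes D: "\<And>k x. (D k has_real_derivative D (Suc k) x) (at x)" and \<delta>: "0 < \<delta>"
  shows "\<bar>(U_op \<delta> ^^ Suc r) (D k) x\<bar>
    \<le> \<delta> ^ r * integral {x..x + real (Suc r) * \<delta>} (\<lambda>y. \<bar>D (k + Suc r) y\<bar>)"
proof -
  have contD: "continuous_on UNIV (D k)" for k
    using DERIV_isCont[OF D] by (simp add: continuous_at_imp_continuous_on)
  have DU: "((U_op \<delta> ^^ r) (D k) has_real_derivative (U_op \<delta> ^^ r) (D (Suc k)) x) (at x)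
      \<and> continuous_on UNIV ((U_op \<delta> ^^ r) (D k))" for r k x
  proof (induction r arbitrary: k x)
    case (Suc r)
    then have s: "((U_op \<delta> ^^ r) (D k) has_real_derivative (U_op \<delta> ^^ r) (D (Suc k)) x) (at x)"
      "continuous_on UNIV ((U_op \<delta> ^^ r) (D k))" for k x by blast+
    have d: "((U_op \<delta> ^^ Suc r) (D k) has_real_derivative (U_op \<delta> ^^ Suc r) (D (Suc k)) x) (at x)" for k x
      using U_op_derivative[OF s(1) s(2) \<delta>] by simp
    then have "continuous_on UNIV ((U_op \<delta> ^^ Suc r) (D k))" for k
      by (meson DERIV_isCont continuous_at_imp_continuous_on)
    with d show ?case by blast
  qed (use D contD in auto)
  show ?thesis
  proof (induction r arbitrary: k x)
    case 0
    show ?case using abs_U_op_le_derivative[OF D contD \<delta>] by simp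
  next
    case (Suc r)
    let ?R = "\<delta> ^ r * integral {x..x + real (Suc (Suc r)) * \<delta>} (\<lambda>y. \<bar>D (k + Suc (Suc r)) y\<bar>)"
    have "\<bar>U_op \<delta> ((U_op \<delta> ^^ Suc r) (D k)) x\<bar>
        \<le> integral {x..x + \<delta>} (\<lambda>y. \<bar>(U_op \<delta> ^^ Suc r) (D (Suc k)) y\<bar>)"
      using DU \<delta> by (intro abs_U_op_le_derivative) blast+
    also have "\<dots> \<le> integral {x..x + \<delta>} (\<lambda>y. ?R)"
    proof (rule integral_le)
      show "(\<lambda>y. \<bar>(U_op \<delta> ^^ Suc r) (D (Suc k)) y\<bar>) integrable_on {x..x + \<delta>}"
        using DU by (intro loc_integrableD loc_integrable_continuous) blast
      fix y assume y: "y \<in> {x..x + \<delta>}"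
      have "\<bar>(U_op \<delta> ^^ Suc r) (D (Suc k)) y\<bar>
          \<le> \<delta> ^ r * integral {y..y + real (Suc r) * \<delta>} (\<lambda>y. \<bar>D (Suc k + Suc r) y\<bar>)"
        by (rule Suc)
      also have "\<dots> \<le> ?R"
      proof (rule mult_left_mono)
        have eq: "Suc k + Suc r = k + Suc (Suc r)" by simp
        have "x \<le> y" "y + real (Suc r) * \<delta> \<le> x + real (Suc (Suc r)) * \<delta>"
          using y by (auto simp: algebra_simps)
        then show "integral {y..y + real (Suc r) * \<delta>} (\<lambda>y. \<bar>D (Suc k + Suc r) y\<bar>)
            \<le> integral {x..x + real (Suc (Suc r)) * \<delta>} (\<lambda>y. \<bar>D (k + Suc (Suc r)) y\<bar>)"
          unfolding eq by (rule integral_abs_mono_interval[OF loc_integrable_continuous[OF contD]])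
        show "0 \<le> \<delta> ^ r" using \<delta> by simp
      qed
      finally show "\<bar>(U_op \<delta> ^^ Suc r) (D (Suc k)) y\<bar> \<le> ?R" .
    qed (rule integrable_const_ivl)
    also have "\<dots> = \<delta> * ?R" using \<delta> by simp
    finally show ?case by (simp add: mult.assoc)
  qed
qed

section \<open>Norm bounds and the Bernstein inequality\<close>

context log_exponent
begin

lemma norm_le_loc_integrable: "norm_le f K \<Longrightarrow> loc_integrable f"
  using norm_le_set_integrable by (auto simp: loc_integrable_def)

lemma interval_mean_loc_integrable:
  assumes "loc_integrable f" "0 < l"
  shows "integral {x..x + l} (\<lambda>y. \<bar>f y\<bar>) = l * interval_mean 0 l f x"
  using assms loc_integrableD(4)[OF assms(1), of x "x + l"] by (simp add: interval_mean_def)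

text \<open>The integral over \<open>[x, x + r * \<delta>]\<close>, divided by \<open>\<delta>\<close>, is \<open>r\<close> times a mean.\<close>
lemma norm_le_U_op:
  assumes f: "norm_le f K" and \<delta>: "0 < \<delta>" and r: "1 \<le> r"
  shows "norm_le ((U_op \<delta> ^^ r) f) ((1 + real r * 2 ^ r * C_mean) * K)"
proof -
  define l where "l = real r * \<delta>"
  have l: "0 < l" using \<delta> r by (simp add: l_def)
  have li: "loc_integrable f" using f by (rule norm_le_loc_integrable)
  have fm: "f \<in> borel_measurable lebesgue" using f by (simp add: norm_le_def)
  have nm: "norm_le (\<lambda>x. real r * 2 ^ r * interval_mean 0 l f x) (real r * 2 ^ r * (C_mean * K))"
    using norm_le_scale[OF norm_le_interval_mean[OF f, of 0 l]] l r by (simp add: C_mean_def)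
  have na: "norm_le (\<lambda>x. \<bar>f x\<bar>) K" using norm_le_dominated[OF f] fm by simp
  have pt: "\<bar>(U_op \<delta> ^^ r) f x\<bar> \<le> \<bar>f x\<bar> + real r * 2 ^ r * interval_mean 0 l f x" for x
  proof -
    have "\<bar>(U_op \<delta> ^^ r) f x\<bar> \<le> \<bar>f x\<bar> + (2 ^ r - 1) / \<delta> * (l * interval_mean 0 l f x)"
      using abs_U_op_power_le[OF li \<delta>, of r x] interval_mean_loc_integrable[OF li l, of x]
      by (simp add: l_def)
    also have "(2 ^ r - 1) / \<delta> * (l * interval_mean 0 l f x) = real r * (2 ^ r - 1) * interval_mean 0 l f x"
      using \<delta> by (simp add: l_def)
    also have "\<dots> \<le> real r * 2 ^ r * interval_mean 0 l f x"
      using interval_mean_nonneg[of 0 l f x] l by (intro mult_right_mono mult_left_mono) auto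
    finally show ?thesis by simp
  qed
  have "norm_le ((U_op \<delta> ^^ r) f) (K + real r * 2 ^ r * (C_mean * K))"
    using pt \<delta> by (intro norm_le_dominated[OF norm_le_add[OF na nm]] borel_measurable_U_op li fm)
      (auto intro: order_trans[OF _ abs_ge_self])
  then show ?thesis by (simp add: algebra_simps)
qed

lemma exp_type_bounded_of_norm_le:
  assumes h: "exp_type \<sigma> h" "0 \<le> \<sigma>" and n: "norm_le (\<lambda>x. cmod (h (of_real x))) K"
  shows "\<exists>M. \<forall>x::real. cmod (h (of_real x)) \<le> M"
proof -
  obtain A where A: "\<And>z. cmod (h z) \<le> A * exp ((\<sigma> + 1) * cmod z)"
    using exp_type_imp_bound[OF h, of 1] by auto
  have hol: "h holomorphic_on UNIV" using h by (simp add: exp_type_def)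
  have K: "0 < K" using n by (simp add: norm_le_def)
  show ?thesis
  proof (rule exp_type_bounded_on_reals[OF hol A])
    fix u v :: real assume uv: "u \<le> v"
    have li: "loc_integrable (\<lambda>x. cmod (h (of_real x)))" using n by (rule norm_le_loc_integrable)
    have "integrable lebesgue (\<lambda>y. indicator {u..v} y * cmod (h (of_real y)))"
      using li by (simp add: loc_integrable_def set_integrable_def)
    from nn_integral_eq_integral[OF this]
    have "ennreal (LINT y:{u..v}|lebesgue. cmod (h (of_real y)))
        = (\<integral>\<^sup>+ y. ennreal (indicator {u..v} y * cmod (h (of_real y))) \<partial>lebesgue)"
      by (simp add: set_lebesgue_integral_def)
    also have "\<dots> = (\<integral>\<^sup>+ y\<in>{u..v}. ennreal \<bar>cmod (h (of_real y))\<bar> \<partial>lebesgue)"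
      by (intro nn_integral_cong) (auto simp: indicator_def)
    also have "\<dots> \<le> ennreal (K * (v - u + 1))" by (rule norm_le_local_integral[OF n uv])
    finally show "integral {u..v} (\<lambda>x. cmod (h (of_real x))) \<le> K * (v - u + 1)"
      using K uv by (simp add: loc_integrableD(3)[OF li])
  qed (use h in auto)
qed

text \<open>The factors come from one mean and two Poisson means, each of norm at most \<^const>\<open>C_mean\<close> and \<open>4 * C_mean\<close>
respectively, from the bound \<open>(3 * \<sigma>) ^ r\<close> for derivatives, and from \<open>r\<close> windows joined into one.\<close>
definition Bern :: "nat \<Rightarrow> real" where "Bern r = 16 * real r * 3 ^ r * C_mean ^ 3"

lemma Bern_pos: "1 \<le> r \<Longrightarrow> 0 < Bern r"
  using C_mean_ge_1 by (simp add: Bern_def)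

text \<open>Bernstein's inequality in the form needed here. The functions \<open>D k\<close> are the derivatives of \<open>h\<close> on the real axis:
\<open>(I - T\<^sub>\<delta>)\<^sup>r h\<close> is at most \<open>r * \<delta> ^ r\<close> times a mean of \<open>\<bar>D r\<bar>\<close>, and \<open>\<bar>D r\<bar>\<close> is at most
\<open>(3 * \<sigma>) ^ r\<close> times a double Poisson mean of \<open>\<bar>h\<bar>\<close>.\<close>
lemma norm_le_U_op_exp_type:
  assumes h: "exp_type \<sigma> h" "0 < \<sigma>" and real: "\<And>x::real. h (of_real x) \<in> \<real>"
    and n: "norm_le (\<lambda>x. Re (h (of_real x))) K" and \<delta>: "0 < \<delta>" and r: "1 \<le> r"
  shows "norm_le ((U_op \<delta> ^^ r) (\<lambda>x. Re (h (of_real x)))) (Bern r * (\<sigma> * \<delta>) ^ r * K)"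
proof -
  define H where "H = (\<lambda>u::real. cmod (h (of_real u)))"
  define Y where "Y = real r / \<sigma>"
  define P where "P = poisson_mean Y (poisson_mean Y H)"
  define D where "D = (\<lambda>k x::real. Re ((deriv ^^ k) h (of_real x)))"
  define l where "l = real r * \<delta>"
  have l: "0 < l" using \<delta> r by (simp add: l_def)
  have Y: "0 < Y" using r h by (simp add: Y_def)
  have hol: "h holomorphic_on UNIV" using h by (simp add: exp_type_def)
  have "continuous_on UNIV (\<lambda>u::real. h (of_real u))"
    by (rule continuous_on_compose2[OF holomorphic_on_imp_continuous_on[OF hol]])
       (auto intro!: continuous_intros)
  then have "continuous_on UNIV H" unfolding H_def by (intro continuous_intros)
  then have H [measurable]: "H \<in> borel_measurable borel" by (rule borel_measurable_continuous_onI)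
  have HRe: "\<bar>Re (h (of_real x))\<bar> = H x" for x using real[of x] by (auto simp: H_def Reals_def)
  have nH: "norm_le H K" using HRe by (intro norm_le_dominated[OF n borel_imp_lebesgue_measurable[OF H]]) (simp add: H_def)
  obtain M where M: "\<And>x. H x \<le> M"
    using exp_type_bounded_of_norm_le[OF h(1) _ nH[unfolded H_def]] h unfolding H_def by auto
  have HM: "0 \<le> H u \<and> H u \<le> M" for u using M by (simp add: H_def)
  have Qm [measurable]: "poisson_mean Y H \<in> borel_measurable borel" by measurable
  have Q: "0 \<le> poisson_mean Y H u \<and> poisson_mean Y H u \<le> M" for u
    using HM by (intro conjI poisson_mean_nonneg poisson_mean_bounded Y H) auto
  have nP: "norm_le P (4 * C_mean * (4 * C_mean * K))"
    unfolding P_def by (intro norm_le_poisson_mean[OF _ Qm Q Y] norm_le_poisson_mean[OF nH H HM Y])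
  have bound: "\<bar>D r x\<bar> \<le> (3 * \<sigma>) ^ r * P x" for x
    using exp_type_higher_deriv_bound[OF h _ r, of M x] HM
      order_trans[OF abs_Re_le_cmod[of "(deriv ^^ r) h (of_real x)"]]
    unfolding D_def P_def Y_def H_def by auto
  have holk: "(deriv ^^ k) h holomorphic_on UNIV" for k
    using hol by (intro holomorphic_higher_deriv) auto
  have DD: "(D k has_real_derivative D (Suc k) x) (at x)" for k x
  proof -
    have "((deriv ^^ k) h has_field_derivative (deriv ^^ Suc k) h (of_real x)) (at (of_real x))"
      using holomorphic_derivI[OF holk open_UNIV, of "of_real x" k] by simp
    then have "(((deriv ^^ k) h \<circ> of_real) has_vector_derivative 1 * (deriv ^^ Suc k) h (of_real x)) (at x)"
      using field_vector_diff_chain_at[OF has_vector_derivative_of_real[OF DERIV_ident]] by fastforce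
    then have "((\<lambda>u. Re (((deriv ^^ k) h \<circ> of_real) u)) has_vector_derivative
        Re (1 * (deriv ^^ Suc k) h (of_real x))) (at x)"
      by (rule bounded_linear.has_vector_derivative[OF bounded_linear_Re])
    then show ?thesis
      by (simp add: D_def o_def has_real_derivative_iff_has_vector_derivative)
  qed
  have contD: "continuous_on UNIV (D k)" for k
    using DERIV_isCont[OF DD] by (simp add: continuous_at_imp_continuous_on)
  have Dm: "D r \<in> borel_measurable lebesgue"
    by (intro borel_imp_lebesgue_measurable borel_measurable_continuous_onI contD)
  have liD: "loc_integrable (D k)" for k by (rule loc_integrable_continuous[OF contD])
  have D0: "D 0 = (\<lambda>x. Re (h (of_real x)))" by (simp add: D_def)
  let ?K = "(3 * \<sigma>) ^ r * (4 * C_mean * (4 * C_mean * K))"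
  have "norm_le (\<lambda>x. (3 * \<sigma>) ^ r * P x) ?K"
    using h by (intro norm_le_scale nP) simp
  then have nD: "norm_le (D r) (?K)"
    using bound by (intro norm_le_dominated[OF _ Dm]) (auto intro: order_trans[OF _ abs_ge_self])
  have nI: "norm_le (\<lambda>x. (real r * \<delta> ^ r) * interval_mean 0 l (D r) x)
      ((real r * \<delta> ^ r) * (C_mean * (?K)))"
    using norm_le_scale[OF norm_le_interval_mean[OF nD, of 0 l], of "real r * \<delta> ^ r"] l r \<delta>
    by (simp add: C_mean_def)
  have pt: "\<bar>(U_op \<delta> ^^ r) (D 0) x\<bar> \<le> (real r * \<delta> ^ r) * interval_mean 0 l (D r) x" for x
  proof -
    obtain k where k: "r = Suc k" using r by (cases r) auto
    have "\<bar>(U_op \<delta> ^^ r) (D 0) x\<bar> \<le> \<delta> ^ k * integral {x..x + l} (\<lambda>y. \<bar>D r y\<bar>)"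
      using abs_U_op_power_le_derivative[of D \<delta> k 0 x, OF DD \<delta>] unfolding l_def k by simp
    also have "\<dots> = (real r * \<delta> ^ r) * interval_mean 0 l (D r) x"
      unfolding interval_mean_loc_integrable[OF liD l] by (simp add: l_def k)
    finally show ?thesis .
  qed
  have "norm_le ((U_op \<delta> ^^ r) (D 0)) ((real r * \<delta> ^ r) * (C_mean * (?K)))"
    using pt \<delta> n by (intro norm_le_dominated[OF nI] borel_measurable_U_op liD)
      (auto simp: D0 norm_le_def intro: order_trans[OF _ abs_ge_self])
  also have "(real r * \<delta> ^ r) * (C_mean * (?K)) = Bern r * (\<sigma> * \<delta>) ^ r * K"
    by (simp add: Bern_def power_mult_distrib power3_eq_cube)
  finally show ?thesis by (simp add: D0)
qed

end

section \<open>Telescoping over dyadic types\<close>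

text \<open>An estimate that holds for every approximant passes to the error of best approximation, without a choice of
near-best approximants.\<close>
lemma le_plus_cmult_INF:
  fixes F :: "'a \<Rightarrow> ennreal"
  assumes "\<And>g. g \<in> S \<Longrightarrow> x \<le> a + ennreal b * F g" "0 < b"
  shows "x \<le> a + ennreal b * (INF g\<in>S. F g)"
proof (cases "INF g\<in>S. F g")
  case (real i)
  show ?thesis
  proof (rule ennreal_le_epsilon)
    fix e :: real assume e: "0 < e"
    have "(INF g\<in>S. F g) < ennreal (i + e / b)" using real e assms by (simp add: ennreal_less_iff)
    then obtain g where g: "g \<in> S" "F g < ennreal (i + e / b)" by (auto simp: INF_less_iff)
    have "x \<le> a + ennreal b * F g" by (rule assms(1)[OF g(1)])
    also have "\<dots> \<le> a + ennreal b * ennreal (i + e / b)"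
      using g by (intro add_left_mono mult_left_mono) auto
    also have "ennreal b * ennreal (i + e / b) = ennreal (b * (i + e / b))"
      using assms real e by (intro ennreal_mult[symmetric]) auto
    also have "b * (i + e / b) = b * i + e" using assms by (simp add: field_simps)
    also have "ennreal (b * i + e) = ennreal b * ennreal i + ennreal e"
      using assms real e by (simp add: ennreal_mult)
    finally show "x \<le> a + ennreal b * (INF g\<in>S. F g) + ennreal e" using real by (simp add: add.assoc)
  qed
next
  case top
  then show ?thesis using assms by (simp add: ennreal_mult_top)
qed

lemma best_approx_antimono:
  assumes "\<sigma> \<le> \<tau>" shows "best_approx \<tau> p f \<le> best_approx \<sigma> p f"
  unfolding best_approx_def G_class_def using exp_type_mono[OF _ assms]
  by (intro INF_superset_mono) auto

text \<open>The blocks are disjoint, so the step function with the values \<open>a j\<close> lies below \<open>F\<close>.\<close>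
lemma dyadic_blocks_le_integral:
  fixes F :: "real \<Rightarrow> ennreal" and s :: real
  assumes s: "0 < s" and a: "\<And>j u. j < n \<Longrightarrow> 2 ^ j * s < u \<Longrightarrow> u \<le> 2 ^ Suc j * s \<Longrightarrow> a j \<le> F u"
  shows "(\<Sum>j<n. a j * ennreal (2 ^ j * s)) \<le> (\<integral>\<^sup>+u\<in>{s<..2 ^ n * s}. F u \<partial>lborel)"
proof -
  let ?b = "\<lambda>j u. a j * indicator {2 ^ j * s<..2 ^ Suc j * s} u"
  have "(\<Sum>j<n. a j * ennreal (2 ^ j * s))
      = (\<Sum>j<n. \<integral>\<^sup>+u. ?b j u \<partial>lborel)"
    using s by (intro sum.cong refl) (simp add: nn_integral_cmult_indicator mult.commute)
  also have "\<dots> = (\<integral>\<^sup>+u. (\<Sum>j<n. ?b j u) \<partial>lborel)"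
    by (intro nn_integral_sum[symmetric]) auto
  also have "\<dots> \<le> (\<integral>\<^sup>+u\<in>{s<..2 ^ n * s}. F u \<partial>lborel)"
  proof (intro nn_integral_mono)
    fix u
    have "m \<le> n \<Longrightarrow> (\<Sum>j<m. ?b j u)
        \<le> F u * indicator {s<..2 ^ m * s} u" for m
    proof (induction m)
      case (Suc m)
      have m: "2 ^ m * s \<le> 2 ^ Suc m * s" "s \<le> 2 ^ m * s" using s by auto
      show ?case
      proof (cases "2 ^ m * s < u")
        case True
        then have 0: "(\<Sum>j<m. ?b j u) = 0"
          using Suc by simp
        show ?thesis unfolding sum.lessThan_Suc 0
          using True a[of m u] Suc.prems m by (auto simp: indicator_def)
      next
        case False
        have "indicator {s<..2 ^ m * s} u \<le> (indicator {s<..2 ^ Suc m * s} u :: ennreal)"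
          using m by (auto simp: indicator_def)
        then show ?thesis unfolding sum.lessThan_Suc using False Suc
          by (auto intro: order_trans[OF _ mult_left_mono])
      qed
    qed simp
    from this[of n] show "(\<Sum>j<n. ?b j u)
        \<le> F u * indicator {s<..2 ^ n * s} u" by simp
  qed
  finally show ?thesis .
qed

lemma (in exponent) G_class_D:
  assumes "g \<in> G_class \<sigma> p"
  shows "exp_type \<sigma> g" "\<And>x::real. g (of_real x) \<in> \<real>"
    "(\<lambda>x. Re (g (of_real x))) \<in> borel_measurable lebesgue"
    "\<exists>K. norm_le (\<lambda>x. Re (g (of_real x))) K"
  using assms L_var_iff_norm_le[of "\<lambda>x. Re (g (of_real x))"]
  by (auto simp: G_class_def) (auto simp: L_var_def)

lemma (in exponent) G_class_diff:
  assumes g: "g \<in> G_class \<sigma> p" and h: "h \<in> G_class \<sigma> p" and \<sigma>: "0 \<le> \<sigma>"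
  shows "(\<lambda>z. g z - h z) \<in> G_class \<sigma> p"
proof -
  note G = G_class_D[OF g] and H = G_class_D[OF h]
  obtain K L where K: "norm_le (\<lambda>x. Re (g (of_real x))) K" and L: "norm_le (\<lambda>x. Re (h (of_real x))) L"
    using G(4) H(4) by auto
  have "norm_le (\<lambda>x. - Re (h (of_real x))) L" using H(3) by (intro norm_le_dominated[OF L]) auto
  from norm_le_add[OF K this]
  have "norm_le (\<lambda>x. Re (g (of_real x)) - Re (h (of_real x))) (K + L)" by simp
  then have "(\<lambda>x. Re (g (of_real x)) - Re (h (of_real x))) \<in> L_var p"
    using G(3) H(3) by (subst L_var_iff_norm_le) auto
  then show ?thesis using G H exp_type_diff[OF G(1) H(1) \<sigma>] by (auto simp: G_class_def)
qed

context log_exponent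
begin

lemma norm_var_U_op:
  assumes f: "f \<in> borel_measurable lebesgue" and \<delta>: "0 < \<delta>" and r: "1 \<le> r"
  shows "norm_var p ((U_op \<delta> ^^ r) f) \<le> ennreal (1 + real r * 2 ^ r * C_mean) * norm_var p f"
  using norm_le_U_op[OF _ \<delta> r] C_mean_ge_1 f by (intro norm_var_le_of_norm_le) (auto intro!: add_pos_nonneg)

lemma norm_var_U_op_G_class:
  assumes g: "g \<in> G_class \<sigma> p" and \<sigma>: "0 < \<sigma>" and \<delta>: "0 < \<delta>" and r: "1 \<le> r"
  shows "norm_var p ((U_op \<delta> ^^ r) (\<lambda>x. Re (g (of_real x))))
    \<le> ennreal (Bern r * (\<sigma> * \<delta>) ^ r) * norm_var p (\<lambda>x. Re (g (of_real x)))"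
  using norm_le_U_op_exp_type[OF G_class_D(1)[OF g] \<sigma> G_class_D(2)[OF g] _ \<delta> r] \<sigma> \<delta> Bern_pos[OF r] G_class_D(3)[OF g]
  by (intro norm_var_le_of_norm_le) auto

text \<open>A function of type 0 is of every type \<open>\<sigma> > 0\<close>, and the Bernstein bound vanishes as \<open>\<sigma>\<close> tends to 0.\<close>
lemma norm_var_U_op_G_class_0:
  assumes g: "g \<in> G_class 0 p" and \<delta>: "0 < \<delta>" and r: "1 \<le> r"
  shows "norm_var p ((U_op \<delta> ^^ r) (\<lambda>x. Re (g (of_real x)))) = 0"
proof -
  let ?R = "\<lambda>x. Re (g (of_real x))"
  obtain K where K: "norm_le ?R K" using G_class_D(4)[OF g] by auto
  have K0: "0 < K" using K by (simp add: norm_le_def)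
  have "norm_var p ((U_op \<delta> ^^ r) ?R) \<le> 0"
  proof (rule ennreal_le_epsilon)
    fix e :: real assume e: "0 < e"
    define k where "k = Bern r * \<delta> ^ r * K"
    have k: "0 < k" using Bern_pos[OF r] \<delta> K0 by (simp add: k_def)
    define \<sigma> where "\<sigma> = min 1 (e / k)"
    have \<sigma>: "0 < \<sigma>" "\<sigma> \<le> 1" "\<sigma> * k \<le> e" using e k by (auto simp: \<sigma>_def min_def field_simps)
    have gs: "exp_type \<sigma> g" using exp_type_mono[OF G_class_D(1)[OF g]] \<sigma> by simp
    have "norm_le ((U_op \<delta> ^^ r) ?R) (Bern r * (\<sigma> * \<delta>) ^ r * K)"
      by (rule norm_le_U_op_exp_type[OF gs \<sigma>(1) G_class_D(2)[OF g] K \<delta> r])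
    then have "norm_var p ((U_op \<delta> ^^ r) ?R) \<le> ennreal (Bern r * (\<sigma> * \<delta>) ^ r * K)"
      by (rule norm_le_imp_norm_var)
    also have "Bern r * (\<sigma> * \<delta>) ^ r * K = \<sigma> ^ r * k" by (simp add: k_def power_mult_distrib)
    also have "\<sigma> ^ r * k \<le> \<sigma> ^ 1 * k"
      using \<sigma> r k by (intro mult_right_mono power_decreasing) auto
    also have "\<sigma> ^ 1 * k \<le> e" using \<sigma> by simp
    finally show "norm_var p ((U_op \<delta> ^^ r) ?R) \<le> 0 + ennreal e"
      by (simp add: ennreal_leI)
  qed
  then show ?thesis by simp
qed

lemma U_op_norm_split:
  assumes "loc_integrable f" "loc_integrable g" "f \<in> borel_measurable lebesgue" "g \<in> borel_measurable lebesgue" "0 < \<delta>"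
  shows "norm_var p ((U_op \<delta> ^^ r) f)
    \<le> norm_var p ((U_op \<delta> ^^ r) (\<lambda>x. f x - g x)) + norm_var p ((U_op \<delta> ^^ r) g)"
proof -
  have "(U_op \<delta> ^^ r) f = (\<lambda>x. (U_op \<delta> ^^ r) (\<lambda>x. f x - g x) x + (U_op \<delta> ^^ r) g x)"
    using assms by (simp add: U_op_diff)
  moreover have "norm_var p (\<lambda>x. (U_op \<delta> ^^ r) (\<lambda>x. f x - g x) x + (U_op \<delta> ^^ r) g x)
      \<le> norm_var p ((U_op \<delta> ^^ r) (\<lambda>x. f x - g x)) + norm_var p ((U_op \<delta> ^^ r) g)"
    using assms by (intro norm_var_triangle borel_measurable_U_op loc_integrable_diff) auto
  ultimately show ?thesis by simp
qed

text \<open>The telescoping argument, organised as an induction over the types: a function \<open>g\<close> of type \<open>\<tau> (Suc i)\<close> is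
compared with an arbitrary \<open>h\<close> of type \<open>\<tau> i\<close>. The Bernstein inequality applies to \<open>g - h\<close>, whose norm is
at most the sum of the distances of \<open>g\<close> and \<open>h\<close> to \<open>f\<close>, and the induction hypothesis to \<open>h\<close>; then the
infimum over \<open>h\<close> is taken. The induction starts from type 0, where \<open>(I - T\<^sub>\<delta>)\<^sup>r\<close> vanishes.\<close>
lemma norm_U_op_le_dyadic_sum:
  assumes f: "f \<in> L_var p" and \<delta>: "0 < \<delta>" and r: "1 \<le> r" and s: "0 < s"
  defines "A \<equiv> \<lambda>\<sigma>. best_approx \<sigma> p f" and "\<tau> \<equiv> \<lambda>j. 2 ^ j * s"
  defines "E \<equiv> Bern r * \<delta> ^ r"
  shows "Omega r p \<delta> f \<le> ennreal (E * s ^ r) * A 0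
    + (\<Sum>j<m. ennreal (E * (2 ^ r + 1) * \<tau> j ^ r) * A (\<tau> j))
    + ennreal (1 + real r * 2 ^ r * C_mean + E * \<tau> m ^ r) * A (\<tau> m)"
proof -
  have fm: "f \<in> borel_measurable lebesgue" using f by (simp add: L_var_def)
  obtain K where K: "norm_le f K" using f fm L_var_iff_norm_le by auto
  have lf: "loc_integrable f" using K by (rule norm_le_loc_integrable)
  define R where "R = (\<lambda>g x. Re (g (complex_of_real x)))"
  define N where "N = (\<lambda>g. norm_var p (\<lambda>x. f x - R g x))"
  define V where "V = (\<lambda>h. norm_var p ((U_op \<delta> ^^ r) h))"
  have A_eq: "A \<sigma> = (INF g\<in>G_class \<sigma> p. N g)" for \<sigma>
    by (simp add: A_def best_approx_def N_def R_def)
  have \<tau>: "0 < \<tau> j" for j using s by (simp add: \<tau>_def)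
  have \<tau>Suc: "\<tau> (Suc j) = 2 * \<tau> j" for j by (simp add: \<tau>_def)
  have \<tau>mono: "\<tau> j \<le> \<tau> (Suc j)" for j using \<tau>[of j] by (simp add: \<tau>Suc)
  have E: "0 < E" using Bern_pos[OF r] \<delta> by (simp add: E_def)
  have Rm: "R g \<in> borel_measurable lebesgue" and Rl: "loc_integrable (R g)" if "g \<in> G_class \<sigma> p" for g \<sigma>
    using G_class_D[OF that] norm_le_loc_integrable unfolding R_def by blast+
  have Gmono: "g \<in> G_class \<sigma>' p" if "g \<in> G_class \<sigma> p" "\<sigma> \<le> \<sigma>'" for g \<sigma> \<sigma>'
    using that exp_type_mono[OF _ that(2)] by (auto simp: G_class_def)
  have step: "V (R g) \<le> ennreal (E * \<sigma> ^ r) * (N g + N h) + V (R h)"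
    if g: "g \<in> G_class \<sigma> p" and h: "h \<in> G_class \<sigma> p" and \<sigma>: "0 < \<sigma>" for g h \<sigma>
  proof -
    have d: "(\<lambda>z. g z - h z) \<in> G_class \<sigma> p" using G_class_diff[OF g h] \<sigma> by simp
    have eq: "(\<lambda>x. R g x - R h x) = R (\<lambda>z. g z - h z)" by (simp add: R_def)
    have "V (R g) \<le> V (\<lambda>x. R g x - R h x) + V (R h)"
      unfolding V_def using Rm Rl g h \<delta> by (intro U_op_norm_split) blast+
    also have "V (\<lambda>x. R g x - R h x) \<le> ennreal (E * \<sigma> ^ r) * norm_var p (\<lambda>x. R g x - R h x)"
      using norm_var_U_op_G_class[OF d \<sigma> \<delta> r] unfolding eq V_def R_def
      by (simp add: E_def power_mult_distrib mult_ac)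
    also have "norm_var p (\<lambda>x. R g x - R h x) \<le> N g + N h"
    proof -
      have "norm_var p (\<lambda>x. R g x - R h x) = norm_var p (\<lambda>x. (f x - R h x) + - (f x - R g x))" by simp
      also have "\<dots> \<le> norm_var p (\<lambda>x. f x - R h x) + norm_var p (\<lambda>x. - (f x - R g x))"
        using fm Rm[OF g] Rm[OF h] by (intro norm_var_triangle) auto
      also have "\<dots> = N g + N h" unfolding norm_var_minus N_def by (simp add: add.commute)
      finally show ?thesis .
    qed
    finally show ?thesis by (simp add: mult_left_mono add_right_mono)
  qed
  define S where "S = (\<lambda>i. ennreal (E * s ^ r) * A 0 + (\<Sum>j<i. ennreal (E * (2 ^ r + 1) * \<tau> j ^ r) * A (\<tau> j)))"
  have chain: "V (R g) \<le> S i + ennreal (E * \<tau> i ^ r) * N g" if "g \<in> G_class (\<tau> i) p" for i g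
    using that
  proof (induction i arbitrary: g)
    case 0
    have "V (R g) \<le> ennreal (E * \<tau> 0 ^ r) * N g + ennreal (E * s ^ r) * A 0"
      unfolding A_eq
    proof (rule le_plus_cmult_INF)
      fix h assume h: "h \<in> G_class 0 p"
      have "V (R g) \<le> ennreal (E * \<tau> 0 ^ r) * (N g + N h) + V (R h)"
        by (rule step[OF 0 Gmono[OF h]]) (use \<tau>[of 0] in auto)
      also have "V (R h) = 0" using norm_var_U_op_G_class_0[OF h \<delta> r] by (simp add: V_def R_def)
      finally show "V (R g) \<le> ennreal (E * \<tau> 0 ^ r) * N g + ennreal (E * s ^ r) * N h"
        by (simp add: distrib_left \<tau>_def)
    qed (use E s in simp)
    then show ?case by (simp add: S_def add.commute)
  next
    case (Suc i)
    have "V (R g) \<le> (S i + ennreal (E * \<tau> (Suc i) ^ r) * N g) + ennreal (E * (2 ^ r + 1) * \<tau> i ^ r) * A (\<tau> i)"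
      unfolding A_eq
    proof (rule le_plus_cmult_INF)
      fix h assume h: "h \<in> G_class (\<tau> i) p"
      have "V (R g) \<le> ennreal (E * \<tau> (Suc i) ^ r) * (N g + N h) + V (R h)"
        using step[OF Suc.prems Gmono[OF h \<tau>mono] \<tau>] .
      also have "V (R h) \<le> S i + ennreal (E * \<tau> i ^ r) * N h" by (rule Suc.IH[OF h])
      also have "ennreal (E * \<tau> (Suc i) ^ r) * (N g + N h) + (S i + ennreal (E * \<tau> i ^ r) * N h)
          = (S i + ennreal (E * \<tau> (Suc i) ^ r) * N g)
            + (ennreal (E * \<tau> (Suc i) ^ r) + ennreal (E * \<tau> i ^ r)) * N h"
        by (simp add: distrib_left distrib_right add_ac)
      also have "ennreal (E * \<tau> (Suc i) ^ r) + ennreal (E * \<tau> i ^ r) = ennreal (E * (2 ^ r + 1) * \<tau> i ^ r)"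
        using E \<tau>[of i] by (simp add: \<tau>Suc power_mult_distrib algebra_simps flip: ennreal_plus)
      finally show "V (R g) \<le> (S i + ennreal (E * \<tau> (Suc i) ^ r) * N g)
          + ennreal (E * (2 ^ r + 1) * \<tau> i ^ r) * N h" by (simp add: add_left_mono)
    qed (use E \<tau>[of i] in \<open>simp add: add_pos_nonneg\<close>)
    then show ?case by (simp add: S_def add_ac)
  qed
  have "V f \<le> S m + ennreal (1 + real r * 2 ^ r * C_mean + E * \<tau> m ^ r) * A (\<tau> m)"
    unfolding A_eq
  proof (rule le_plus_cmult_INF)
    fix g assume g: "g \<in> G_class (\<tau> m) p"
    have "V f \<le> V (\<lambda>x. f x - R g x) + V (R g)"
      unfolding V_def using Rm[OF g] Rl[OF g] lf fm \<delta> by (intro U_op_norm_split)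
    also have "V (\<lambda>x. f x - R g x) \<le> ennreal (1 + real r * 2 ^ r * C_mean) * N g"
      unfolding V_def N_def using fm Rm[OF g] by (intro norm_var_U_op \<delta> r) auto
    also have "V (R g) \<le> S m + ennreal (E * \<tau> m ^ r) * N g" by (rule chain[OF g])
    also have "ennreal (1 + real r * 2 ^ r * C_mean) * N g + (S m + ennreal (E * \<tau> m ^ r) * N g)
        = S m + (ennreal (1 + real r * 2 ^ r * C_mean) + ennreal (E * \<tau> m ^ r)) * N g"
      by (simp add: distrib_right add_ac)
    also have "ennreal (1 + real r * 2 ^ r * C_mean) + ennreal (E * \<tau> m ^ r)
        = ennreal (1 + real r * 2 ^ r * C_mean + E * \<tau> m ^ r)"
      using E \<tau>[of m] C_mean_ge_1 by (intro ennreal_plus[symmetric]) auto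
    finally show "V f \<le> S m + ennreal (1 + real r * 2 ^ r * C_mean + E * \<tau> m ^ r) * N g"
      by (simp add: add_left_mono add_right_mono)
  qed (use E \<tau>[of m] C_mean_ge_1 in \<open>simp add: add_pos_nonneg\<close>)
  then show ?thesis by (simp add: V_def S_def Omega_def)
qed

end

section \<open>The inverse theorem\<close>

text \<open>The local condition is a modulus of continuity for \<open>1 / p\<close>.\<close>
lemma log_Hoelder_borel_measurable:
  assumes H: "log_Hoelder p c1 c2 p_inf" and p1: "\<And>x. 1 \<le> p x"
  shows "p \<in> borel_measurable borel"
proof -
  have c1: "0 < c1" and loc: "\<And>x y. x \<noteq> y \<Longrightarrow> \<bar>1 / p x - 1 / p y\<bar> * ln (exp 1 + 1 / \<bar>x - y\<bar>) \<le> c1"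
    using H by (auto simp: log_Hoelder_def)
  have "continuous_on UNIV (\<lambda>x. 1 / p x)"
    unfolding continuous_on_iff
  proof (intro ballI allI impI)
    fix x e :: real assume e: "0 < e"
    \<comment> \<open>With this \<open>d\<close> the logarithm in the local condition is at least \<open>2 * c1 / e\<close>.\<close>
    define d where "d = exp (- (2 * c1 / e))"
    have "\<bar>1 / p y - 1 / p x\<bar> < e" if y: "\<bar>y - x\<bar> < d" for y
    proof (cases "y = x")
      case False
      then have pos: "0 < \<bar>y - x\<bar>" by simp
      have "exp (2 * c1 / e) = 1 / d" by (simp add: d_def exp_minus divide_inverse)
      also have "\<dots> \<le> 1 / \<bar>y - x\<bar>" using pos y by (intro divide_left_mono) (auto simp: d_def)
      also have "\<dots> \<le> exp 1 + 1 / \<bar>y - x\<bar>" by simp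
      finally have "2 * c1 / e \<le> ln (exp 1 + 1 / \<bar>y - x\<bar>)"
        by (smt (verit) exp_gt_zero ln_ge_iff)
      then have "\<bar>1 / p y - 1 / p x\<bar> * (2 * c1 / e) \<le> \<bar>1 / p y - 1 / p x\<bar> * ln (exp 1 + 1 / \<bar>y - x\<bar>)"
        by (intro mult_left_mono) auto
      also have "\<dots> \<le> c1" by (rule loc[OF False])
      finally have "\<bar>1 / p y - 1 / p x\<bar> * (2 / e) * c1 \<le> 1 * c1" by simp
      then have "\<bar>1 / p y - 1 / p x\<bar> * (2 / e) \<le> 1" using c1 by (rule mult_right_le_imp_le)
      then have "\<bar>1 / p y - 1 / p x\<bar> \<le> e / 2" using e by (simp add: divide_le_eq)
      also have "\<dots> < e" using e by simp
      finally show ?thesis .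
    qed (use e in simp)
    moreover have "0 < d" by (simp add: d_def)
    ultimately show "\<exists>d>0. \<forall>y\<in>UNIV. dist y x < d \<longrightarrow> dist (1 / p y) (1 / p x) < e"
      by (auto simp: dist_real_def)
  qed
  then have "(\<lambda>x. 1 / p x) \<in> borel_measurable borel" by (rule borel_measurable_continuous_onI)
  then have "(\<lambda>x. 1 / (1 / p x)) \<in> borel_measurable borel" by measurable
  then show ?thesis by simp
qed

text \<open>Keeps from the constant only the part that grows with \<open>r\<close> and with \<open>t\<close>: \<open>const5 p t \<ge> 10 * exp (8 * t)\<close>
enters twice, and so does \<open>const7 t\<close>.\<close>
lemma const12_lower_bound:
  assumes p: "p \<in> P_Log" and r: "1 \<le> r"
  shows "345600 * 8 ^ r * exp (8 * t) ^ 4 \<le> const12 r p t"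
proof -
  define E where "E = exp (8 * t)"
  have E: "0 < E" by (simp add: E_def)
  define q where "q = real_of_ereal (p_plus p)"
  define S where "S = (\<Sum>\<^sub>\<infinity>k\<in>{2::nat..}. 1 / 2 ^ k :: real)"
  have S: "0 \<le> S" unfolding S_def by (intro infsum_nonneg) auto
  have "0 \<le> p_plus p"
  proof -
    have "esssup lebesgue (\<lambda>x::real. 0 :: ereal) \<le> p_plus p"
      unfolding p_plus_def
    proof (rule esssup_mono)
      show "0 \<le> ereal (p x)" for x
        using p by (auto simp: P_Log_def intro: order_trans[OF zero_le_one])
    qed simp
    then show ?thesis by (simp add: esssup_const)
  qed
  then have q: "0 \<le> q" by (simp add: q_def real_of_ereal_pos)
  have a: "2 \<le> 2 powr (q + 1)" using powr_mono[of 1 "q + 1" 2] q by simp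
  have b: "1 \<le> 3 powr q" using q by (simp add: ge_one_powr_ge_zero)
  have "5 \<le> 1 + 2 * 3 powr q * (S + 2)"
  proof -
    have "2 * 1 * (0 + 2) \<le> 2 * 3 powr q * (S + 2)" using b S by (intro mult_mono add_mono) auto
    then show ?thesis by simp
  qed
  then have "2 * 1 * 5 * E \<le> 2 powr (q + 1) * 3 powr q * (1 + 2 * 3 powr q * (S + 2)) * E"
    using a b E by (intro mult_mono) auto
  then have k5: "10 * E \<le> const5 p t"
    by (simp add: const5_def Let_def q_def S_def E_def)
  have k7: "const7 t = 2 * E" by (simp add: const7_def E_def)
  have "2 * (10 * E) * (72 * (2 * E) * (10 * E)) \<le> 2 * const5 p t * (1 + 72 * const7 t * const5 p t)"
  proof (intro mult_mono)
    have "72 * (2 * E) * (10 * E) \<le> 72 * const7 t * const5 p t"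
      unfolding k7 using k5 E by (intro mult_left_mono) auto
    then show "72 * (2 * E) * (10 * E) \<le> 1 + 72 * const7 t * const5 p t" by simp
  qed (use k5 E in auto)
  then have k13: "28800 * E ^ 3 \<le> const13 p t"
    by (simp add: const13_def power3_eq_cube mult_ac)
  obtain k where k: "r = Suc k" using r by (cases r) auto
  have "345600 * 8 ^ r * E ^ 4 = 12 * (28800 * E ^ 3) * (2 * E) * (2 ^ (2 * r - 1)) * 2 ^ r"
  proof -
    have "(2::real) ^ (2 * r - 1) * 2 ^ r * 2 = 8 ^ r"
    proof -
      have "(2::real) ^ (2 * r - 1) * 2 ^ r * 2 = 2 ^ (3 * r)"
        unfolding k by (simp flip: power_add power_Suc add: algebra_simps)
      then show ?thesis by (simp add: power_mult)
    qed
    then have "345600 * 8 ^ r * E ^ 4 = 345600 * (2 ^ (2 * r - 1) * 2 ^ r * 2) * E ^ 4" by simp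
    then show ?thesis by (simp add: power3_eq_cube power4_eq_xxxx)
  qed
  also have "\<dots> \<le> 12 * const13 p t * (2 * E) * (1 + 2 ^ (2 * r - 1)) * 2 ^ r"
  proof -
    have "0 \<le> const13 p t" using k13 E by (smt (verit) zero_le_power mult_nonneg_nonneg)
    then show ?thesis using k13 E by (intro mult_mono) auto
  qed
  also have "\<dots> = const12 r p t" by (simp add: const12_def k7)
  finally show ?thesis by (simp add: E_def)
qed

text \<open>Bernoulli's inequality for \<open>(4 / 3) ^ r\<close>.\<close>
lemma linear_le_geometric: "real r * 3 ^ r * 2 ^ r \<le> 3 * 8 ^ r"
proof -
  have "1 + real r * (1 / 3) \<le> (1 + 1 / 3) ^ r" by (rule Bernoulli_inequality) simp
  then have "real r \<le> 3 * (4 / 3) ^ r" by simp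
  then have "real r * 6 ^ r \<le> 3 * (4 / 3) ^ r * 6 ^ r" by (intro mult_right_mono) auto
  then show ?thesis by (simp add: mult.assoc flip: power_mult_distrib)
qed

theorem theorem3p7:
  fixes p f :: "real \<Rightarrow> real" and c1 c2 p_inf \<delta> :: real and r :: nat
  assumes "p \<in> P_Log"
    and "log_Hoelder p c1 c2 p_inf"
    and "r \<ge> 1"
    and "0 < \<delta>" and "\<delta> < 1"
    and "f \<in> L_var p"
  shows "Omega r p \<delta> f \<le>
    ennreal (const12 r p (max c1 c2) * \<delta> ^ r) *
      (best_approx 0 p f +
       (\<integral>\<^sup>+u\<in>{1/2..1/\<delta>}. (ennreal (u ^ (r - 1)) * best_approx (u / 2) p f) \<partial>lborel))"
proof -
  define c where "c = max c1 c2"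
  define C where "C = const12 r p c"
  have p1: "1 \<le> p x" for x using assms(1) by (simp add: P_Log_def)
  interpret log_exponent p c p_inf
  proof
    show "p \<in> borel_measurable borel" by (rule log_Hoelder_borel_measurable[OF assms(2) p1])
    show "1 < p_inf" using assms(2) by (simp add: log_Hoelder_def)
    note H = assms(2)[unfolded log_Hoelder_def]
    show "\<bar>1 / p x - 1 / p y\<bar> * ln (exp 1 + 1 / \<bar>x - y\<bar>) \<le> c" if "x \<noteq> y" for x y
    proof (rule order_trans)
      show "\<bar>1 / p x - 1 / p y\<bar> * ln (exp 1 + 1 / \<bar>x - y\<bar>) \<le> c1" using H that by blast
    qed (simp add: c_def)
    show "\<bar>1 / p x - 1 / p_inf\<bar> * ln (exp 1 + \<bar>x\<bar>) \<le> c" for x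
    proof (rule order_trans)
      show "\<bar>1 / p x - 1 / p_inf\<bar> * ln (exp 1 + \<bar>x\<bar>) \<le> c2" using H by blast
    qed (simp add: c_def)
  qed (rule p1)
  note r = assms(3) and \<delta> = assms(4)
  define A where "A = (\<lambda>\<sigma>. best_approx \<sigma> p f)"
  define e where "e = exp (4 * c)"
  have e: "1 \<le> e" using c_nonneg by (simp add: e_def)
  have C_lower: "345600 * 8 ^ r * e ^ 3 \<le> C"
  proof -
    have "exp (8 * c) = e ^ 2" by (simp add: e_def exp_double[symmetric] mult.assoc[symmetric])
    then have "exp (8 * c) ^ 4 = e ^ 8" by (simp flip: power_mult)
    moreover have "e ^ 3 \<le> e ^ 8" using e by (intro power_increasing) auto
    ultimately have "345600 * 8 ^ r * e ^ 3 \<le> 345600 * 8 ^ r * exp (8 * c) ^ 4" by simp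
    also have "\<dots> \<le> C" unfolding C_def by (rule const12_lower_bound[OF assms(1) r])
    finally show ?thesis .
  qed
  have Bern_eq: "Bern r = 11664 * e ^ 3 * (real r * 3 ^ r)"
    by (simp add: Bern_def C_mean_def e_def power_mult_distrib)
  have r2: "real r \<le> 2 ^ r" using of_nat_less_two_power[of r] by (simp add: less_imp_le)
  have small_power: "real r * 3 ^ r \<le> 3 * 8 ^ r"
    using mult_left_mono[of 1 "2 ^ r" "real r * 3 ^ r"] linear_le_geometric[of r] by simp
  have C1: "Bern r \<le> C"
  proof -
    have "Bern r \<le> 11664 * e ^ 3 * (3 * 8 ^ r)"
      unfolding Bern_eq using e small_power by (intro mult_left_mono) auto
    also have "\<dots> \<le> 345600 * 8 ^ r * e ^ 3" using e by (simp add: mult_ac)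
    finally show ?thesis using C_lower by linarith
  qed
  have C2: "Bern r * (2 ^ r + 1) \<le> C"
  proof -
    have "Bern r * (2 ^ r + 1) \<le> Bern r * (2 * 2 ^ r)"
      using Bern_pos[OF r] by (intro mult_left_mono) auto
    also have "\<dots> = 23328 * e ^ 3 * (real r * 3 ^ r * 2 ^ r)" by (simp add: Bern_eq)
    also have "\<dots> \<le> 23328 * e ^ 3 * (3 * 8 ^ r)"
      using e linear_le_geometric by (intro mult_left_mono) auto
    also have "\<dots> \<le> 345600 * 8 ^ r * e ^ 3" using e by (simp add: mult_ac)
    finally show ?thesis using C_lower by linarith
  qed
  \<comment> \<open>The factor \<open>2 ^ r\<close> is \<open>1 / (\<delta> * \<tau> m) ^ r\<close>.\<close>
  have C3: "(1 + real r * 2 ^ r * C_mean) * 2 ^ r + Bern r \<le> C"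
  proof -
    have "e ^ 1 \<le> e ^ 3" using e by (intro power_increasing) auto
    then have e3: "e \<le> e ^ 3" "1 \<le> e ^ 3" using e by auto
    have "real r * 2 ^ r * 2 ^ r \<le> 2 ^ r * 2 ^ r * 2 ^ r" using r2 by (intro mult_right_mono) auto
    also have "\<dots> = 8 ^ r" by (simp flip: power_mult_distrib)
    finally have "9 * (real r * 2 ^ r * 2 ^ r) * e \<le> 9 * 8 ^ r * e ^ 3"
      using e e3 by (intro mult_mono) auto
    moreover have "(2::real) ^ r * 1 \<le> 8 ^ r * e ^ 3"
      using e3 by (intro mult_mono power_mono) auto
    moreover have "(1 + real r * 2 ^ r * C_mean) * 2 ^ r = 2 ^ r + 9 * (real r * 2 ^ r * 2 ^ r) * e"
      by (simp add: C_mean_def e_def algebra_simps)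
    moreover have "Bern r \<le> 34992 * (8 ^ r * e ^ 3)"
    proof -
      have "Bern r \<le> 11664 * e ^ 3 * (3 * 8 ^ r)"
        unfolding Bern_eq using e small_power by (intro mult_left_mono) auto
      then show ?thesis by (simp add: mult_ac)
    qed
    moreover have "0 \<le> 8 ^ r * e ^ 3" using e by simp
    ultimately show ?thesis using C_lower by linarith
  qed
  have C0: "0 \<le> C" using C1 Bern_pos[OF r] by linarith
  \<comment> \<open>The dyadic grid is anchored at its top, so that \<open>\<delta> * \<tau> m = 1 / 2\<close> exactly; then \<open>s\<close> lies above the lower limit of integration.\<close>
  obtain m :: nat and s :: real where ms: "1 / 2 < s" "s \<le> 1" "2 ^ Suc m * s = 1 / \<delta>"
  proof -
    have "\<exists>k. 1 / \<delta> \<le> 2 ^ k" using real_arch_pow[of 2 "1 / \<delta>"] by (auto intro: less_imp_le)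
    define k where "k = (LEAST k. 1 / \<delta> \<le> 2 ^ k)"
    have k: "1 / \<delta> \<le> 2 ^ k" unfolding k_def using \<open>\<exists>k. 1 / \<delta> \<le> 2 ^ k\<close> by (rule LeastI_ex)
    have "k \<noteq> 0"
    proof
      assume "k = 0"
      then show False using k assms(4,5) by (simp add: divide_le_eq)
    qed
    then obtain m where m: "k = Suc m" by (cases k) auto
    have "\<not> 1 / \<delta> \<le> 2 ^ m" using not_less_Least[of m "\<lambda>k. 1 / \<delta> \<le> 2 ^ k"] m by (simp add: k_def)
    then show ?thesis
      using k assms(4) by (intro that[of "1 / \<delta> / 2 ^ k" m]) (auto simp: m field_simps)
  qed
  define \<tau> where "\<tau> = (\<lambda>j::nat. 2 ^ j * s)"
  have s: "0 < s" using ms by linarith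
  have \<tau>: "0 < \<tau> j" for j using s by (simp add: \<tau>_def)
  have \<tau>m: "\<delta> * \<tau> m = 1 / 2" using ms(3) \<delta> by (simp add: \<tau>_def field_simps)
  define J where "J = (\<integral>\<^sup>+u\<in>{1/2..1/\<delta>}. (ennreal (u ^ (r - 1)) * A (u / 2)) \<partial>lborel)"
  have J: "(\<Sum>j<Suc m. ennreal (\<tau> j ^ r) * A (\<tau> j)) \<le> J"
  proof -
    have "(\<Sum>j<Suc m. ennreal (\<tau> j ^ r) * A (\<tau> j))
        = (\<Sum>j<Suc m. (ennreal (\<tau> j ^ (r - 1)) * A (\<tau> j)) * ennreal (2 ^ j * s))"
    proof (intro sum.cong refl)
      fix j
      have "\<tau> j ^ r = \<tau> j ^ (r - 1) * \<tau> j" using r by (cases r) auto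
      moreover have "2 ^ j * s = \<tau> j" by (simp add: \<tau>_def)
      ultimately show "ennreal (\<tau> j ^ r) * A (\<tau> j) = (ennreal (\<tau> j ^ (r - 1)) * A (\<tau> j)) * ennreal (2 ^ j * s)"
        using \<tau>[of j] by (simp only: ennreal_mult zero_le_power less_imp_le mult_ac)
    qed
    also have "\<dots> \<le> (\<integral>\<^sup>+u\<in>{s<..2 ^ Suc m * s}. (ennreal (u ^ (r - 1)) * A (u / 2)) \<partial>lborel)"
    proof (rule dyadic_blocks_le_integral[OF s])
      fix j u assume u: "2 ^ j * s < u" "u \<le> 2 ^ Suc j * s"
      have "\<tau> j ^ (r - 1) \<le> u ^ (r - 1)" using u \<tau>[of j] by (intro power_mono) (auto simp: \<tau>_def)
      moreover have "A (\<tau> j) \<le> A (u / 2)"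
        unfolding A_def using u by (intro best_approx_antimono) (simp add: \<tau>_def)
      ultimately show "ennreal (\<tau> j ^ (r - 1)) * A (\<tau> j) \<le> ennreal (u ^ (r - 1)) * A (u / 2)"
        by (intro mult_mono ennreal_leI) auto
    qed
    also have "\<dots> \<le> J"
      unfolding J_def ms(3) using ms(1) by (intro nn_integral_mono) (auto simp: indicator_def)
    finally show ?thesis .
  qed
  define K where "K = ennreal (C * \<delta> ^ r)"
  have K: "ennreal x * a \<le> K * (ennreal y * a)" if "x \<le> C * \<delta> ^ r * y" "0 \<le> y" for x y a
  proof -
    have "ennreal x * a \<le> ennreal (C * \<delta> ^ r * y) * a" using that by (intro mult_right_mono ennreal_leI) auto
    also have "\<dots> = K * (ennreal y * a)"
      unfolding K_def using C0 \<delta> that by (simp add: ennreal_mult mult.assoc)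
    finally show ?thesis .
  qed
  have "Omega r p \<delta> f \<le> ennreal (Bern r * \<delta> ^ r * s ^ r) * A 0
    + (\<Sum>j<m. ennreal (Bern r * \<delta> ^ r * (2 ^ r + 1) * \<tau> j ^ r) * A (\<tau> j))
    + ennreal (1 + real r * 2 ^ r * C_mean + Bern r * \<delta> ^ r * \<tau> m ^ r) * A (\<tau> m)"
    unfolding A_def \<tau>_def by (rule norm_U_op_le_dyadic_sum[OF assms(6) \<delta> r s])
  also have "\<dots> \<le> K * (ennreal 1 * A 0) + (\<Sum>j<m. K * (ennreal (\<tau> j ^ r) * A (\<tau> j)))
      + K * (ennreal (\<tau> m ^ r) * A (\<tau> m))"
  proof (intro add_mono sum_mono K)
    have "s ^ r \<le> 1" using s ms by (intro power_le_one) auto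
    then have "Bern r * \<delta> ^ r * s ^ r \<le> Bern r * \<delta> ^ r * 1"
      using Bern_pos[OF r] \<delta> by (intro mult_left_mono) auto
    also have "\<dots> \<le> C * \<delta> ^ r * 1" using C1 \<delta> by (intro mult_right_mono) auto
    finally show "Bern r * \<delta> ^ r * s ^ r \<le> C * \<delta> ^ r * 1" .
    fix j
    have "(Bern r * (2 ^ r + 1)) * (\<delta> ^ r * \<tau> j ^ r) \<le> C * (\<delta> ^ r * \<tau> j ^ r)"
      using C2 \<delta> \<tau>[of j] by (intro mult_right_mono) auto
    then show "Bern r * \<delta> ^ r * (2 ^ r + 1) * \<tau> j ^ r \<le> C * \<delta> ^ r * \<tau> j ^ r" by (simp add: mult_ac)
  next
    have half: "\<delta> ^ r * \<tau> m ^ r = 1 / 2 ^ r"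
      unfolding power_mult_distrib[symmetric] \<tau>m by (simp add: power_divide)
    have "((1 + real r * 2 ^ r * C_mean) * 2 ^ r + Bern r) * (1 / 2 ^ r) \<le> C * (1 / 2 ^ r)"
      using C3 by (intro mult_right_mono) auto
    then show "1 + real r * 2 ^ r * C_mean + Bern r * \<delta> ^ r * \<tau> m ^ r \<le> C * \<delta> ^ r * \<tau> m ^ r"
      unfolding mult.assoc[of _ "\<delta> ^ r"] half by (simp add: field_simps)
  qed (use \<tau> in \<open>auto intro: less_imp_le\<close>)
  also have "\<dots> = K * (A 0 + (\<Sum>j<Suc m. ennreal (\<tau> j ^ r) * A (\<tau> j)))"
    by (simp add: distrib_left sum_distrib_left add.assoc)
  also have "\<dots> \<le> K * (A 0 + J)" using J by (intro mult_left_mono add_left_mono) auto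
  finally show ?thesis by (simp add: K_def C_def c_def J_def A_def)
qed

end
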